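(* Let $\Delta\ge 4$ be an integer and let $G$ be a graph with maximum degree at most $\Delta$. Let \[ t=\begin{cases} \frac{4}{9} & \text{if } \Delta=5,\\ \frac{\Delta}{\lfloor\Delta^2/4\rfloor+\Delta} & \text{otherwise.}\end{cases}\] Then $i(G)\le (1-t)\lvert V(G)\rvert+t\, n_\Delta(G)$.
   Context: All graphs are finite and simple. An independent dominating set of a graph is a set $S$ of pairwise non-adjacent vertices such that every vertex not in $S$ has a neighbor in $S$; $i(G)$ denotes the minimum size of an independent dominating set of $G$. For an integer $\Delta\ge4$, a connected graph is called $\Delta$-special if: (1) every vertex that belongs to some cycle has degree $\Delta$; (2) every edge has at least one end that belongs to some cycle; (3) each component of the subgraph induced by the set of all vertices that belong to cycles is isomorphic to $K_{\lceil \Delta/2\rceil+1}$, or to $K_{\lfloor \Delta/2\rfloor+1}$, or (only when $\Delta=4$) to an odd cycle. (In particular $K_1$ is $\Delta$-special.) $n_\Delta(G)$ denotes the number of connected components of $G$ that are $\Delta$-special. *)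

theory Defs
  imports Complex_Main "Graph_Theory.Graph_Theory"
begin

text \<open>
  Following Graph\_Theory, a finite simple graph is a finite symmetric digraph without loops and
  parallel arcs (locale \<^locale>\<open>graph\<close>): every undirected edge is a pair of opposite arcs.
  Consequently the degree of a vertex is its \<^const>\<open>out_degree\<close>, and the connected components are
  the strongly connected components \<^const>\<open>pre_digraph.sccs\<close> (as induced subgraphs).
\<close>

definition independent_dominating_set :: "('a, 'b) pre_digraph \<Rightarrow> 'a set \<Rightarrow> bool" where
  "independent_dominating_set G S \<longleftrightarrow>
     S \<subseteq> verts G \<and>
     (\<forall>u\<in>S. \<forall>v\<in>S. \<not> u \<rightarrow>\<^bsub>G\<^esub> v) \<and>
     (\<forall>v\<in>verts G - S. \<exists>u\<in>S. v \<rightarrow>\<^bsub>G\<^esub> u)"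

definition indep_domination_number :: "('a, 'b) pre_digraph \<Rightarrow> nat" where
  "indep_domination_number G = Min (card ` {S. independent_dominating_set G S})"

text \<open>
  The length bound excludes the digraph cycles \<open>u, v, u\<close> that traverse a single undirected edge
  back and forth.
\<close>

definition cycle_verts :: "('a, 'b) pre_digraph \<Rightarrow> 'a set" where
  "cycle_verts G = {v. \<exists>p. pre_digraph.cycle G p \<and> 3 \<le> length p \<and> v \<in> tail G ` set p}"

definition cycle_graph :: "nat \<Rightarrow> nat pair_pre_digraph" where
  "cycle_graph n =
     \<lparr> pverts = {0..<n},
       parcs = {(i, j). i < n \<and> j < n \<and> (j = (i + 1) mod n \<or> i = (j + 1) mod n)} \<rparr>"

definition is_odd_cycle :: "('a, 'b) pre_digraph \<Rightarrow> bool" where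
  "is_odd_cycle H \<longleftrightarrow> (\<exists>n\<ge>3. odd n \<and> digraph_iso H (with_proj (cycle_graph n)))"

text \<open>
  \<open>K\<^bsub>n\<^esub> H\<close> says that \<open>H\<close> is a complete graph on \<open>n\<close> vertices; \<open>(\<Delta> + 1) div 2\<close> is the ceiling
  of \<open>\<Delta> / 2\<close>.
\<close>

definition special :: "nat \<Rightarrow> ('a, 'b) pre_digraph \<Rightarrow> bool" where
  "special \<Delta> C \<longleftrightarrow>
     Digraph_Component.connected C \<and>
     (\<forall>v\<in>cycle_verts C. out_degree C v = \<Delta>) \<and>
     (\<forall>e\<in>arcs C. tail C e \<in> cycle_verts C \<or> head C e \<in> cycle_verts C) \<and>
     (\<forall>H\<in>pre_digraph.sccs (C \<restriction> cycle_verts C).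
        K\<^bsub>(\<Delta> + 1) div 2 + 1\<^esub> H \<or> K\<^bsub>\<Delta> div 2 + 1\<^esub> H \<or> (\<Delta> = 4 \<and> is_odd_cycle H))"

definition num_special :: "nat \<Rightarrow> ('a, 'b) pre_digraph \<Rightarrow> nat" where
  "num_special \<Delta> G = card {C \<in> pre_digraph.sccs G. special \<Delta> C}"

definition t_coeff :: "nat \<Rightarrow> real" where
  "t_coeff \<Delta> = (if \<Delta> = 5 then 4 / 9 else real \<Delta> / real (\<Delta>\<^sup>2 div 4 + \<Delta>))"

end

theory Submission
  imports Defs
begin

text \<open>
  Cover a connected graph by vertex-disjoint stars; let \<open>X\<close> be the set of their centres and let the
  centre \<open>x\<close> have \<open>a x \<ge> 1\<close> leaves. If \<open>J\<close> is a maximal independent subset of \<open>X\<close>, then a maximal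
  independent set containing \<open>J\<close> misses \<open>X - J\<close> and all leaves of \<open>J\<close>, that is, at least
  \<open>|X| + (\<Sum>x\<in>J. a x - 1)\<close> vertices. So the theorem asks for a heavy independent set in the subgraph
  induced by \<open>X\<close>, where \<open>x\<close> has weight \<open>a x - 1\<close> and degree at most \<open>\<Delta> - a x\<close>.

  Repeatedly taking a vertex of largest weight and deleting its closed neighbourhood attains the ratio
  \<open>t\<close> unless one meets a component that is \<open>d\<close>-regular with \<open>a\<close> constantly \<open>\<Delta> - d\<close> and \<open>d\<close> is
  \<open>\<Delta> / 2\<close> rounded up or down. A component of this kind that is not complete has an independent set
  containing a fraction \<open>1 / d\<close> of its vertices (as in Brooks' theorem), which is enough. What remains
  are complete graphs and, for \<open>\<Delta> = 4\<close>, odd cycles. They lose at most \<open>t\<close>, and all their outside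
  neighbours are their own leaves.

  By induction on the number of vertices, the star forest can be chosen without such a deficient
  component, except that one is unavoidable if the graph is special.
\<close>

section \<open>Independent sets in graphs without large cliques\<close>

text \<open>A centre \<open>x\<close> stands for \<open>1 + a x\<close> vertices. Choosing a
  heaviest centre with \<open>d\<close> neighbours among the centres settles at most
  \<open>(d + 1) * (a x + 1)\<close> vertices, of which \<open>d + a x\<close> are sure to be
  missed. If \<open>d + a x = \<Delta>\<close>, the product is at most
  \<open>\<Delta>\<^sup>2 div 4 + \<Delta> + 1\<close>, and it drops by at least one unless
  \<open>d\<close> and \<open>a x\<close> are \<Delta>/2 rounded. The denominator of
  \<open>t\<close> is therefore one short of the worst case: only a balanced complete component
  overshoots, by one vertex, at a price of \<open>t\<close>. The exceptional 4/9 comes from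
  \<open>d = a x = 2\<close> with \<Delta> = 5: nine vertices, four of them missed, a worse ratio
  than 5/11.

  The obstacle is that choosing other centres for the independent set cannot repair a deficient
  block; the stars must change. A block is no longer deficient once one of its vertices is a leaf,
  or has an outside neighbour that is not its own leaf. Hence a block is re-starred along a
  Hamiltonian cycle. Special pieces around it would bring deficiencies of their own; each is spoiled
  by handing one of its vertices to the block as a leaf.\<close>

definition nbrs :: "('a \<Rightarrow> 'a \<Rightarrow> bool) \<Rightarrow> 'a set \<Rightarrow> 'a \<Rightarrow> 'a set" where
  "nbrs E V v = {u\<in>V. E v u}"

definition indep :: "('a \<Rightarrow> 'a \<Rightarrow> bool) \<Rightarrow> 'a set \<Rightarrow> bool" where
  "indep E S \<longleftrightarrow> (\<forall>u\<in>S. \<forall>v\<in>S. \<not> E u v)"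

definition clique :: "('a \<Rightarrow> 'a \<Rightarrow> bool) \<Rightarrow> 'a set \<Rightarrow> bool" where
  "clique E Q \<longleftrightarrow> (\<forall>u\<in>Q. \<forall>v\<in>Q. u \<noteq> v \<longrightarrow> E u v)"

lemma finite_nbrs [simp]: "finite V \<Longrightarrow> finite (nbrs E V v)"
  by (simp add: nbrs_def)

lemma nbrs_mono: "U \<subseteq> V \<Longrightarrow> nbrs E U v \<subseteq> nbrs E V v"
  by (auto simp: nbrs_def)

lemma clique_subset: "clique E Q \<Longrightarrow> P \<subseteq> Q \<Longrightarrow> clique E P"
  by (auto simp: clique_def)

lemma card_nbrs_clique:
  assumes "clique E Q" "irreflp E" "x \<in> Q" "finite Q"
  shows "card (nbrs E Q x) = card Q - 1"
proof -
  have "nbrs E Q x = Q - {x}"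
    using assms by (auto simp: nbrs_def clique_def irreflp_def)
  then show ?thesis using assms by simp
qed

text \<open>For a maximum independent set \<open>I\<close>, the outside vertices whose only
  neighbour in \<open>I\<close> is \<open>x\<close> form a clique together with \<open>x\<close>,
  since two non-adjacent ones could replace \<open>x\<close>. So there are at most
  \<open>d - 2\<close> of them for each \<open>x\<close>. All other outside vertices send at least
  two edges to \<open>I\<close>, which receives at most \<open>d\<close> edges per vertex.\<close>

lemma independent_set_clique_free:
  assumes fin: "finite V" and sym: "symp E" and irr: "irreflp E"
    and deg: "\<And>v. v \<in> V \<Longrightarrow> card (nbrs E V v) \<le> d"
    and d: "2 \<le> d" and noK: "\<And>Q. Q \<subseteq> V \<Longrightarrow> clique E Q \<Longrightarrow> card Q \<noteq> d"
  shows "\<exists>I\<subseteq>V. indep E I \<and> card V \<le> d * card I"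
proof -
  let ?F = "{I. I \<subseteq> V \<and> indep E I}"
  have finF: "finite ?F" and neF: "{} \<in> ?F"
    using fin by (auto simp: indep_def)
  obtain I where I: "I \<in> ?F" and Imax: "\<And>J. J \<in> ?F \<Longrightarrow> card J \<le> card I"
  proof -
    have "Max (card ` ?F) \<in> card ` ?F" using finF neF by (intro Max_in) auto
    then obtain I where "I \<in> ?F" "card I = Max (card ` ?F)" by auto
    then show thesis using that finF by simp
  qed
  have IV: "I \<subseteq> V" and indI: "indep E I" using I by auto
  have finI: "finite I" using IV fin finite_subset by blast
  define P where "P x = {u\<in>V - I. nbrs E I u = {x}}" for x
  have finP: "finite (P x)" for x using fin by (simp add: P_def)
  have cardP: "card (P x) \<le> d - 2" if x: "x \<in> I" for x
  proof -
    have cl: "clique E (insert x (P x))"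
      unfolding clique_def
    proof (intro ballI impI)
      fix u v assume uv: "u \<in> insert x (P x)" "v \<in> insert x (P x)" "u \<noteq> v"
      have px: "E w x" "E x w" if "w \<in> P x" for w
        using that sym by (auto simp: P_def nbrs_def symp_def)
      show "E u v"
      proof (cases "u = x \<or> v = x")
        case True then show ?thesis using uv px by auto
      next
        case False
        then have uP: "u \<in> P x" and vP: "v \<in> P x" using uv by auto
        show ?thesis
        proof (rule ccontr)
          assume nE: "\<not> E u v"
          let ?J = "insert u (insert v (I - {x}))"
          have nu: "\<not> E u w" "\<not> E v w" "\<not> E w u" "\<not> E w v" if "w \<in> I - {x}" for w
            using that uP vP sym by (auto simp: P_def nbrs_def symp_def)
          have "\<not> E v u" "\<not> E u u" "\<not> E v v"
            using nE sym irr by (auto dest: sympD irreflpD)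
          then have "indep E ?J"
            using indI nE unfolding indep_def ball_simps
            by (intro conjI ballI) (simp_all only: nu not_False_eq_True, auto)
          then have "?J \<in> ?F"
            using uP vP IV by (auto simp: P_def)
          moreover have "card ?J = card I + 1"
          proof -
            have "card (I - {x}) + 1 = card I" using x finI
              by (metis Suc_eq_plus1 card_Suc_Diff1)
            moreover have "card ?J = card (I - {x}) + 2"
              using uP vP uv finI by (auto simp: P_def)
            ultimately show ?thesis by simp
          qed
          ultimately show False using Imax[of ?J] by simp
        qed
      qed
    qed
    have "card (insert x (P x)) < d"
    proof (rule ccontr)
      assume "\<not> card (insert x (P x)) < d"
      then obtain Q where Q: "Q \<subseteq> insert x (P x)" "card Q = d"
        by (meson not_less obtain_subset_with_card_n)
      moreover have "insert x (P x) \<subseteq> V" using x IV by (auto simp: P_def)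
      ultimately show False using noK[of Q] clique_subset[OF cl, of Q] by auto
    qed
    moreover have "x \<notin> P x" using x by (simp add: P_def)
    ultimately show ?thesis using finP by simp
  qed
  let ?S = "{u\<in>V - I. card (nbrs E I u) = 1}"
  have "?S = (\<Union>x\<in>I. P x)"
    by (auto simp: P_def card_1_singleton_iff nbrs_def)
  then have "card ?S \<le> (\<Sum>x\<in>I. card (P x))"
    using card_UN_le[OF finI] by simp
  also have "\<dots> \<le> (\<Sum>x\<in>I. d - 2)" by (rule sum_mono) (rule cardP)
  finally have S: "card ?S \<le> card I * (d - 2)" by simp
  have ge1: "1 \<le> card (nbrs E I u)" if u: "u \<in> V - I" for u
  proof (rule ccontr)
    assume "\<not> 1 \<le> card (nbrs E I u)"
    then have "nbrs E I u = {}" using finI by (simp add: Suc_le_eq card_gt_0_iff)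
    then have "insert u I \<in> ?F"
      using u IV indI sym irr by (auto simp: indep_def nbrs_def symp_def irreflp_def)
    then show False using Imax[of "insert u I"] u finI by simp
  qed
  \<comment> \<open>The indicator compensates for the vertices that send a single edge to
    \<open>I\<close>.\<close>
  have "(\<Sum>u\<in>V - I. 2) \<le> (\<Sum>u\<in>V - I. card (nbrs E I u) + (if card (nbrs E I u) = 1 then 1 else 0))"
  proof (rule sum_mono)
    fix u assume "u \<in> V - I"
    from ge1[OF this] show "2 \<le> card (nbrs E I u) + (if card (nbrs E I u) = 1 then 1 else 0)" by simp
  qed
  also have "\<dots> = (\<Sum>u\<in>V - I. card (nbrs E I u)) + card ?S"
    using fin by (simp add: sum.distrib sum.If_cases Int_def)
  also have "(\<Sum>u\<in>V - I. card (nbrs E I u)) = (\<Sum>x\<in>I. card (nbrs E (V - I) x))"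
  proof -
    have "E u x = E x u" for u x using sym by (auto dest: sympD)
    then show ?thesis
      unfolding nbrs_def by (intro sum_multicount_gen) (use fin finI in simp_all)
  qed
  also have "\<dots> \<le> (\<Sum>x\<in>I. d)"
  proof (rule sum_mono)
    fix x assume "x \<in> I"
    have "card (nbrs E (V - I) x) \<le> card (nbrs E V x)"
      using fin by (intro card_mono nbrs_mono) auto
    then show "card (nbrs E (V - I) x) \<le> d" using deg[of x] \<open>x \<in> I\<close> IV by fastforce
  qed
  finally have "2 * card (V - I) \<le> card I * d + card I * (d - 2)" using S by simp
  moreover have "card V = card (V - I) + card I"
    using fin IV by (metis add.commute card_Diff_subset card_mono finI le_add_diff_inverse)
  moreover have "card I * d = card I * (d - 2) + 2 * card I"
    using d by (metis add_mult_distrib2 le_add_diff_inverse2 mult.commute)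
  ultimately have "card V \<le> d * card I" by (simp add: mult.commute)
  then show ?thesis using IV indI by blast
qed

text \<open>
  Induction: a clique of size \<open>d\<close> is removed, and two of the vertices outside that it is adjacent to are
  joined by a new edge, so that an independent set misses one of them and can be extended.
\<close>

lemma independent_set_brooks:
  fixes V :: "'a set"
  assumes "finite V" "symp E" "irreflp E" "\<And>v. v \<in> V \<Longrightarrow> card (nbrs E V v) \<le> d" "3 \<le> d"
    "\<And>Q. Q \<subseteq> V \<Longrightarrow> clique E Q \<Longrightarrow> card Q \<noteq> Suc d"
  shows "\<exists>I\<subseteq>V. indep E I \<and> card V \<le> d * card I"
  using assms
proof (induction "card V" arbitrary: V E rule: less_induct)
  case (less V E)
  note fin = less.prems(1) and sym = less.prems(2) and irr = less.prems(3)
    and deg = less.prems(4) and d = less.prems(5) and noK = less.prems(6)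
  have symE: "E x y \<Longrightarrow> E y x" for x y using sym by (rule sympD)
  have irrE: "\<not> E x x" for x using irr by (rule irreflpD)
  show ?case
  proof (cases "\<exists>Q\<subseteq>V. clique E Q \<and> card Q = d")
    case False
    then show ?thesis
      by (intro independent_set_clique_free[OF fin sym irr deg]) (use d in auto)
  next
    case True
    then obtain Q where Q: "Q \<subseteq> V" "clique E Q" "card Q = d" by blast
    have finQ: "finite Q" using Q(1) fin finite_subset by blast
    define V' where "V' = V - Q"
    have V': "V' \<subseteq> V" "finite V'" "V' \<inter> Q = {}" using fin by (auto simp: V'_def)
    have cardV: "card V = card V' + d"
      using Q finQ fin card_mono[of V Q] by (simp add: V'_def card_Diff_subset)
    have smaller: "card V' < card V" using cardV d by simp
    have out: "card (nbrs E V' q) \<le> 1" if "q \<in> Q" for q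
    proof -
      have "nbrs E V q = nbrs E Q q \<union> nbrs E V' q" "nbrs E Q q \<inter> nbrs E V' q = {}"
        using Q(1) by (auto simp: nbrs_def V'_def)
      then have "card (nbrs E V q) = card (nbrs E Q q) + card (nbrs E V' q)"
        using finQ V' by (simp add: card_Un_disjoint)
      then show ?thesis
        using card_nbrs_clique[OF Q(2) irr that finQ] Q(3) deg[of q] that Q(1) d by fastforce
    qed
    \<comment> \<open>Removing \<open>Q\<close> costs \<open>d\<close> vertices, which a single
      vertex of \<open>Q\<close> added to \<open>I\<close> pays for.\<close>
    have ext: ?thesis if I: "I \<subseteq> V'" "indep E I" "card V' \<le> d * card I" and q: "q \<in> Q" "nbrs E I q = {}" for I q
    proof -
      have "finite I" using I V' finite_subset by blast
      moreover have "q \<notin> I" using q I V' by auto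
      moreover have "\<not> E q x" "\<not> E x q" if "x \<in> I" for x
        using that q(2) symE by (auto simp: nbrs_def)
      then have "indep E (insert q I)"
        using I(2) irrE by (simp add: indep_def)
      ultimately show ?thesis
        using I cardV q(1) Q(1) V' by (intro exI[of _ "insert q I"]) auto
    qed
    show ?thesis
    proof (cases "\<exists>q\<in>Q. nbrs E V' q = {}")
      case True
      then obtain q where q: "q \<in> Q" "nbrs E V' q = {}" by blast
      have "\<exists>I\<subseteq>V'. indep E I \<and> card V' \<le> d * card I"
      proof (rule less.hyps[OF smaller V'(2) sym irr _ d])
        show "card (nbrs E V' v) \<le> d" if "v \<in> V'" for v
          using deg[of v] that V' card_mono[OF finite_nbrs[OF fin] nbrs_mono[OF V'(1)], of E v] by auto
        show "card P \<noteq> Suc d" if "P \<subseteq> V'" "clique E P" for P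
          using noK[of P] that V' by auto
      qed
      then obtain I where I: "I \<subseteq> V'" "indep E I" "card V' \<le> d * card I" by blast
      then have "nbrs E I q = {}" using q(2) nbrs_mono[OF I(1)] by blast
      then show ?thesis using ext I q by blast
    next
      case False
      then have "\<forall>q\<in>Q. \<exists>u. nbrs E V' q = {u}"
        using out V'(2) by (metis One_nat_def card_0_eq card_1_singleton_iff finite_nbrs le_Suc_eq le_zero_eq)
      then obtain r where r: "\<And>q. q \<in> Q \<Longrightarrow> nbrs E V' q = {r q}" by metis
      have rV: "r q \<in> V'" "E q (r q)" "E (r q) q" if "q \<in> Q" for q
        using r[OF that] symE by (auto simp: nbrs_def)
      have runiq: "y = r q" if "q \<in> Q" "y \<in> V'" "E q y" for q y
        using r[OF that(1)] that by (auto simp: nbrs_def)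
      \<comment> \<open>The graph with the additional edge \<open>u w\<close>; because of it the
        induction has to generalize \<open>E\<close>.\<close>
      define E2 where "E2 u w = (\<lambda>x y. E x y \<or> (x = u \<and> y = w) \<or> (x = w \<and> y = u))" for u w
      have E2sym: "symp (E2 u w)" for u w using symE by (auto simp: E2_def intro!: sympI)
      have pair: "?thesis \<or> (\<exists>T\<subseteq>V'. clique (E2 (r q1) (r q2)) T \<and> card T = Suc d)"
        if q: "q1 \<in> Q" "q2 \<in> Q" "r q1 \<noteq> r q2" for q1 q2
      proof (cases "\<exists>T\<subseteq>V'. clique (E2 (r q1) (r q2)) T \<and> card T = Suc d")
        case False
        \<comment> \<open>Each \<open>r q\<close> has lost its neighbour \<open>q\<close>, so one
          new edge at it keeps the degree at most \<open>d\<close>.\<close>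
        have less1: "card (nbrs E V' (r q)) < d" if "q \<in> Q" for q
        proof -
          have "insert q (nbrs E V' (r q)) \<subseteq> nbrs E V (r q)"
            using rV[OF that] that Q(1) V'(1) by (auto simp: nbrs_def)
          then have "card (insert q (nbrs E V' (r q))) \<le> card (nbrs E V (r q))"
            using fin by (intro card_mono) auto
          moreover have "q \<notin> nbrs E V' (r q)" using that V' by (auto simp: nbrs_def)
          ultimately show ?thesis using deg[of "r q"] rV[OF that] V' by fastforce
        qed
        have "\<exists>I\<subseteq>V'. indep (E2 (r q1) (r q2)) I \<and> card V' \<le> d * card I"
        proof (rule less.hyps[OF smaller V'(2) E2sym _ _ d])
          show "irreflp (E2 (r q1) (r q2))" using irrE q by (auto simp: E2_def intro!: irreflpI)
          show "card (nbrs (E2 (r q1) (r q2)) V' v) \<le> d" if "v \<in> V'" for v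
          proof -
            have le: "card (nbrs E V' v) \<le> d"
              using deg[of v] that V' card_mono[OF finite_nbrs[OF fin] nbrs_mono[OF V'(1)], of E v] by auto
            consider "v = r q1" | "v = r q2" | "v \<noteq> r q1" "v \<noteq> r q2" by blast
            then show ?thesis
            proof cases
              case 1
              have "nbrs (E2 (r q1) (r q2)) V' v \<subseteq> insert (r q2) (nbrs E V' v)"
                using 1 q by (auto simp: nbrs_def E2_def)
              then have "card (nbrs (E2 (r q1) (r q2)) V' v) \<le> card (insert (r q2) (nbrs E V' v))"
                using V'(2) by (intro card_mono) auto
              also have "\<dots> \<le> Suc (card (nbrs E V' v))" using V'(2) by (simp add: card_insert_if)
              finally show ?thesis using less1[OF q(1)] 1 by simp
            next
              case 2
              have "nbrs (E2 (r q1) (r q2)) V' v \<subseteq> insert (r q1) (nbrs E V' v)"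
                using 2 q by (auto simp: nbrs_def E2_def)
              then have "card (nbrs (E2 (r q1) (r q2)) V' v) \<le> card (insert (r q1) (nbrs E V' v))"
                using V'(2) by (intro card_mono) auto
              also have "\<dots> \<le> Suc (card (nbrs E V' v))" using V'(2) by (simp add: card_insert_if)
              finally show ?thesis using less1[OF q(2)] 2 by simp
            next
              case 3
              then have "nbrs (E2 (r q1) (r q2)) V' v = nbrs E V' v" by (auto simp: nbrs_def E2_def)
              then show ?thesis using le by simp
            qed
          qed
          show "card P \<noteq> Suc d" if "P \<subseteq> V'" "clique (E2 (r q1) (r q2)) P" for P
            using False that by blast
        qed
        then obtain I where I: "I \<subseteq> V'" "indep (E2 (r q1) (r q2)) I" "card V' \<le> d * card I" by blast
        have indI: "indep E I" using I(2) by (auto simp: indep_def E2_def)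
        have "r q1 \<notin> I \<or> r q2 \<notin> I" using I(2) by (auto simp: indep_def E2_def)
        then obtain q where "q \<in> Q" "r q \<notin> I" using q by blast
        then have "nbrs E I q = {}" using runiq I(1) by (auto simp: nbrs_def)
        then show ?thesis using ext[OF I(1) indI I(3) \<open>q \<in> Q\<close>] by blast
      qed blast
      have "\<exists>q1\<in>Q. \<exists>q2\<in>Q. r q1 \<noteq> r q2"
      proof (rule ccontr)
        assume c: "\<not> (\<exists>q1\<in>Q. \<exists>q2\<in>Q. r q1 \<noteq> r q2)"
        obtain q where q: "q \<in> Q" using Q(3) d by fastforce
        have "r x = r q" if "x \<in> Q" for x using c q that by blast
        then have "E x (r q)" "E (r q) x" if "x \<in> Q" for x using rV[of x] that by simp_all
        then have "clique E (insert (r q) Q)" using Q(2) by (auto simp: clique_def)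
        moreover have "card (insert (r q) Q) = Suc d"
          using rV[OF q] V'(3) finQ Q(3) by (subst card_insert_disjoint) auto
        moreover have "insert (r q) Q \<subseteq> V" using rV[OF q] Q(1) V'(1) by auto
        ultimately show False using noK by blast
      qed
      then obtain q1 q2 where q: "q1 \<in> Q" "q2 \<in> Q" "r q1 \<noteq> r q2" by blast
      \<comment> \<open>Otherwise the new edges \<open>r q1\<close>-\<open>r q2\<close> and
        \<open>r q1\<close>-\<open>r q3\<close> both create cliques of size \<open>Suc d\<close>,
        called \<open>T\<close> and \<open>S\<close>. Counting degrees at \<open>r q1\<close> shows
        that they share the core \<open>R\<close>. Vertices of \<open>R\<close> have no neighbours
        outside \<open>T\<close>, yet they are adjacent to \<open>r q3\<close>, which is not in
        \<open>T\<close>.\<close>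
      show ?thesis
      proof (rule ccontr)
        assume no: "\<not> ?thesis"
        then obtain T where T: "T \<subseteq> V'" "clique (E2 (r q1) (r q2)) T" "card T = Suc d"
          using pair[OF q] by blast
        have finT: "finite T" using T V' finite_subset by blast
        have ends: "x \<in> S \<and> y \<in> S" if "S \<subseteq> V'" "clique (E2 x y) S" "card S = Suc d" for S x y
        proof (rule ccontr)
          assume "\<not> (x \<in> S \<and> y \<in> S)"
          then have "clique E S" using that by (auto simp: clique_def E2_def)
          then show False using noK[of S] that V'(1) by auto
        qed
        have uT: "r q1 \<in> T" "r q2 \<in> T" using ends[OF T] by auto
        define R where "R = T - {r q1, r q2}"
        have cardR: "card R = d - 1" using uT q T(3) finT by (simp add: R_def)
        have finR: "finite R" using finT by (simp add: R_def)
        have RV: "R \<subseteq> V'" using T by (auto simp: R_def)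
        have adjR: "E x y" if "x \<in> R" "y \<in> T" "x \<noteq> y" for x y
          using T(2) that unfolding clique_def E2_def R_def by blast
        have full: "nbrs E V v = S" if "S \<subseteq> nbrs E V v" "card S = d" "v \<in> V" for S v
          using card_seteq[OF finite_nbrs[OF fin] that(1)] deg[OF that(3)] that(2) by simp
        have nbrsR: "nbrs E V s = T - {s}" if s: "s \<in> R" for s
        proof (rule full)
          show "T - {s} \<subseteq> nbrs E V s" using adjR[OF s] T(1) V'(1) by (auto simp: nbrs_def)
          show "card (T - {s}) = d" using T(3) finT s by (simp add: R_def)
          show "s \<in> V" using s RV V' by auto
        qed
        have nbrsu: "nbrs E V (r q) = insert q R" if q: "q = q1 \<or> q = q2" for q
        proof (rule full)
          have qQ: "q \<in> Q" using that \<open>q1 \<in> Q\<close> \<open>q2 \<in> Q\<close> by auto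
          have "r q \<in> T" "r q \<notin> R" using uT that by (auto simp: R_def)
          then have "E (r q) x" if "x \<in> R" for x using adjR[OF that, of "r q"] that symE by auto
          then show "insert q R \<subseteq> nbrs E V (r q)"
            using rV[OF qQ] qQ Q(1) RV V'(1) by (auto simp: nbrs_def)
          have "q \<notin> R" using qQ RV V'(3) by auto
          then show "card (insert q R) = d" using finR cardR d by simp
          show "r q \<in> V" using rV[OF qQ] V' by auto
        qed
        have "Q - {q1, q2} \<noteq> {}"
        proof
          assume "Q - {q1, q2} = {}"
          then have "card Q \<le> card {q1, q2}" by (intro card_mono) auto
          also have "\<dots> \<le> 2" by (simp add: card_insert_if)
          finally show False using Q(3) d by simp
        qed
        then obtain q3 where q3: "q3 \<in> Q" "q3 \<noteq> q1" "q3 \<noteq> q2" by blast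
        have q3R: "q3 \<notin> R" using q3 RV V'(3) by auto
        have "q3 \<in> nbrs E V (r q3)" using rV[OF q3(1)] q3 Q(1) by (auto simp: nbrs_def)
        then have r3: "r q3 \<noteq> r q1" "r q3 \<noteq> r q2"
          using nbrsu[of q1] nbrsu[of q2] q3 q3R by auto
        then obtain S where S: "S \<subseteq> V'" "clique (E2 (r q1) (r q3)) S" "card S = Suc d"
          using pair[OF q(1) q3(1)] no by metis
        have finS: "finite S" using S V' finite_subset by blast
        have uS: "r q1 \<in> S" "r q3 \<in> S" using ends[OF S] by auto
        have "S - {r q1, r q3} \<subseteq> R"
        proof
          fix z assume z: "z \<in> S - {r q1, r q3}"
          then have "E2 (r q1) (r q3) (r q1) z" using S(2) uS by (auto simp: clique_def)
          then have "E (r q1) z" using z by (auto simp: E2_def)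
          then have "z \<in> insert q1 R" using nbrsu[of q1] z S V' by (auto simp: nbrs_def)
          then show "z \<in> R" using z S(1) q(1) V'(3) by auto
        qed
        moreover have "card (S - {r q1, r q3}) = d - 1" using uS r3(1) S(3) finS by simp
        ultimately have SR: "S - {r q1, r q3} = R" using cardR finR by (simp add: card_subset_eq)
        obtain s where s: "s \<in> R" using cardR d by fastforce
        then have "E2 (r q1) (r q3) s (r q3)" using SR uS S(2) by (auto simp: clique_def)
        then have "E s (r q3)" using s SR by (auto simp: E2_def)
        then have "r q3 \<in> T" using nbrsR[OF s] rV[OF q3(1)] V'(1) by (auto simp: nbrs_def)
        then have "r q3 \<in> R" using r3 by (auto simp: R_def)
        then show False using SR by blast
      qed
    qed
  qed
qed

section \<open>Connected sets and cycles\<close>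

locale sgraph =
  fixes E :: "'a \<Rightarrow> 'a \<Rightarrow> bool"
  assumes sym: "E u v \<Longrightarrow> E v u" and irr: "\<not> E v v"
begin

text \<open>The trivial path is allowed even at a vertex outside \<open>V\<close>, so membership of
  the endpoints is always tracked separately.\<close>

definition reach :: "'a set \<Rightarrow> 'a \<Rightarrow> 'a \<Rightarrow> bool" where
  "reach V = (\<lambda>x y. x \<in> V \<and> y \<in> V \<and> E x y)\<^sup>*\<^sup>*"

definition conn :: "'a set \<Rightarrow> bool" where
  "conn V \<longleftrightarrow> V \<noteq> {} \<and> (\<forall>u\<in>V. \<forall>v\<in>V. reach V u v)"

definition component :: "'a set \<Rightarrow> 'a \<Rightarrow> 'a set" where
  "component V v = {u\<in>V. reach V v u}"

text \<open>For \<open>S \<subseteq> V\<close> these are the unions of components of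
  \<open>V\<close>, described without paths.\<close>

definition closed_in :: "'a set \<Rightarrow> 'a set \<Rightarrow> bool" where
  "closed_in V S \<longleftrightarrow> (\<forall>x\<in>S. \<forall>y\<in>V. E x y \<longrightarrow> y \<in> S)"

lemma reach_refl [simp]: "reach V v v"
  by (simp add: reach_def)

lemma reach_trans: "reach V u v \<Longrightarrow> reach V v w \<Longrightarrow> reach V u w"
  by (simp add: reach_def)

lemma reach_step: "u \<in> V \<Longrightarrow> v \<in> V \<Longrightarrow> E u v \<Longrightarrow> reach V u v"
  by (auto simp: reach_def)

lemma reach_sym: "reach V u v \<Longrightarrow> reach V v u"
  unfolding reach_def
  by (induction rule: rtranclp_induct) (auto intro: converse_rtranclp_into_rtranclp dest: sym)

lemma reach_mono:
  assumes "reach U u v" "U \<subseteq> V" shows "reach V u v"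
  using assms(1) unfolding reach_def by (rule rtranclp_mono[THEN predicate2D, rotated]) (use assms(2) in auto)

lemma reach_closed:
  assumes "reach V u v" "u \<in> S" "closed_in V S" shows "v \<in> S"
  using assms(1) unfolding reach_def by (induction rule: rtranclp_induct) (use assms in \<open>auto simp: closed_in_def\<close>)

lemma reach_closed_restrict:
  assumes "reach V u v" "u \<in> S" "S \<subseteq> V" "closed_in V S" shows "reach S u v"
  using assms(1) unfolding reach_def
proof (induction rule: rtranclp_induct)
  case (step y z)
  have "reach V u y" using step(1) by (simp add: reach_def)
  then have "y \<in> S" using assms reach_closed by blast
  then have "z \<in> S" using step(2) assms by (auto simp: closed_in_def)
  with step.IH \<open>y \<in> S\<close> step.hyps(2) show ?case
    by (auto intro: rtranclp.rtrancl_into_rtrancl)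
qed simp

lemma reach_in: "reach V u v \<Longrightarrow> u \<in> V \<Longrightarrow> v \<in> V"
  by (erule reach_closed) (auto simp: closed_in_def)

lemma conn_closed: "conn V \<Longrightarrow> S \<subseteq> V \<Longrightarrow> S \<noteq> {} \<Longrightarrow> closed_in V S \<Longrightarrow> S = V"
  unfolding conn_def using reach_closed by blast

lemma component_subset: "component V v \<subseteq> V"
  by (auto simp: component_def)

lemma component_self: "v \<in> V \<Longrightarrow> v \<in> component V v"
  by (simp add: component_def)

lemma closed_in_component: "closed_in V (component V v)"
  unfolding closed_in_def component_def
proof (intro ballI impI)
  fix x y assume x: "x \<in> {u \<in> V. reach V v u}" and y: "y \<in> V" "E x y"
  then have "reach V v y" using reach_trans[OF _ reach_step] by auto
  then show "y \<in> {u \<in> V. reach V v u}" using y by simp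
qed

lemma conn_component: assumes "v \<in> V" shows "conn (component V v)"
proof -
  have r: "reach (component V v) v u" if "u \<in> component V v" for u
    using that by (intro reach_closed_restrict[OF _ component_self[OF assms] component_subset closed_in_component])
      (simp add: component_def)
  have "reach (component V v) u w" if "u \<in> component V v" "w \<in> component V v" for u w
    using reach_trans[OF reach_sym[OF r[OF that(1)]] r[OF that(2)]] .
  then show ?thesis
    using component_self[OF assms] unfolding conn_def by blast
qed

lemma component_eqI: assumes "conn K" "K \<subseteq> V" "closed_in V K" "v \<in> K" shows "component V v = K"
proof
  show "component V v \<subseteq> K" using reach_closed assms by (auto simp: component_def)
  show "K \<subseteq> component V v" using assms reach_mono[of K v _ V] by (auto simp: component_def conn_def)
qed

lemma component_eq: "u \<in> component V v \<Longrightarrow> v \<in> V \<Longrightarrow> component V u = component V v"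
  by (intro component_eqI conn_component component_subset closed_in_component)

lemma conn_nbr: assumes "conn V" "v \<in> V" "card V \<ge> 2" obtains u where "u \<in> V" "E v u"
proof -
  have "\<exists>u\<in>V. E v u"
  proof (rule ccontr)
    assume "\<not> (\<exists>u\<in>V. E v u)"
    then have "closed_in V {v}" by (auto simp: closed_in_def)
    then have "V = {v}" using conn_closed[of V "{v}"] assms by auto
    then show False using assms by simp
  qed
  then show thesis using that by blast
qed

section \<open>Two-regular connected sets are cycles\<close>

definition cycle_enum :: "'a set \<Rightarrow> nat \<Rightarrow> (nat \<Rightarrow> 'a) \<Rightarrow> bool" where
  "cycle_enum D n f \<longleftrightarrow> 3 \<le> n \<and> bij_betw f {0..<n} D \<and>
     (\<forall>i<n. \<forall>j<n. E (f i) (f j) \<longleftrightarrow> j = (i + 1) mod n \<or> i = (j + 1) mod n)"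

text \<open>Take a longest path. The neighbours of its last vertex lie on it, but an inner vertex
  has both its neighbours beside it on the path. So the last vertex is adjacent to the first one.
  The cycle closed in this way uses up all degrees, hence it is closed under adjacency and exhausts
  the connected set.\<close>

lemma two_regular_cycle:
  assumes fin: "finite D" and conn: "conn D" and reg: "\<And>x. x \<in> D \<Longrightarrow> card (nbrs E D x) = 2"
  shows "\<exists>n f. cycle_enum D n f"
proof -
  define path where "path p \<longleftrightarrow> p \<noteq> [] \<and> distinct p \<and> set p \<subseteq> D \<and> (\<forall>i. Suc i < length p \<longrightarrow> E (p ! i) (p ! Suc i))" for p
  have len: "length p \<le> card D" if "path p" for p
    using that fin unfolding path_def by (metis card_mono distinct_card)
  obtain z0 where z0: "z0 \<in> D" using conn by (auto simp: conn_def)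
  have "path [z0]" using z0 by (simp add: path_def)
  then obtain p where p: "path p" and pmax: "\<And>q. path q \<Longrightarrow> length q \<le> length p"
    using ex_has_greatest_nat[of path "[z0]" length "Suc (card D)"] len by (auto simp: less_Suc_eq_le)
  define m where "m = length p"
  have m0: "0 < m" and dist: "distinct p" and pD: "set p \<subseteq> D"
    and pE: "\<And>i. Suc i < m \<Longrightarrow> E (p ! i) (p ! Suc i)"
    using p by (auto simp: path_def m_def)
  have inD: "p ! i \<in> D" if "i < m" for i using that pD by (auto simp: m_def)
  have inj: "p ! i = p ! j \<longleftrightarrow> i = j" if "i < m" "j < m" for i j
    using that dist by (simp add: m_def nth_eq_iff_index_eq)
  have last: "z \<in> set p" if "z \<in> D" "E (p ! (m - 1)) z" for z
  proof (rule ccontr)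
    assume z: "z \<notin> set p"
    have "path (p @ [z])" unfolding path_def
    proof (intro conjI allI impI)
      fix i assume i: "Suc i < length (p @ [z])"
      show "E ((p @ [z]) ! i) ((p @ [z]) ! Suc i)"
      proof (cases "Suc i < m")
        case True then show ?thesis using pE by (simp add: nth_append m_def)
      next
        case False
        then have "i = m - 1" "Suc i = m" using i by (auto simp: m_def)
        then show ?thesis using that(2) by (simp add: nth_append m_def)
      qed
    qed (use dist z pD that in auto)
    from pmax[OF this] show False by simp
  qed
  have sub2: "nbrs E D x = {u, w}" if "x \<in> D" "u \<in> D" "w \<in> D" "E x u" "E x w" "u \<noteq> w" for x u w
  proof -
    have "{u, w} \<subseteq> nbrs E D x" "card {u, w} = 2" using that by (auto simp: nbrs_def)
    then show ?thesis using reg[OF that(1)] fin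
      by (metis card_subset_eq finite_nbrs)
  qed
  have inner: "nbrs E D (p ! i) = {p ! (i - 1), p ! Suc i}" if "0 < i" "Suc i < m" for i
    using that pE[of "i - 1"] pE[of i] inD inj sym by (intro sub2) auto
  have "card (nbrs E D (p ! (m - 1))) = 2" using reg inD m0 by simp
  then obtain u w where uw: "nbrs E D (p ! (m - 1)) = {u, w}" "u \<noteq> w" by (meson card_2_iff)
  then have "u \<in> set p" "w \<in> set p" using last by (auto simp: nbrs_def)
  then obtain a b where ab: "a < m" "b < m" "u = p ! a" "w = p ! b" by (metis in_set_conv_nth m_def)
  \<comment> \<open>Only the first vertex and the predecessor at \<open>m - 2\<close> can be
    adjacent to the last vertex; having two neighbours, it is adjacent to both.\<close>
  have key: "c = 0 \<or> c = m - 2" if c: "c < m" "p ! c \<in> nbrs E D (p ! (m - 1))" for c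
  proof (rule ccontr)
    assume n: "\<not> (c = 0 \<or> c = m - 2)"
    have E: "E (p ! (m - 1)) (p ! c)" using c by (simp add: nbrs_def)
    then have "c \<noteq> m - 1" using irr by auto
    then have c': "0 < c" "Suc c < m" using n c by auto
    have "p ! (m - 1) \<in> nbrs E D (p ! c)" using E sym inD m0 by (auto simp: nbrs_def)
    then have "m - 1 = c - 1 \<or> m - 1 = Suc c" using inner[OF c'] inj c' by auto
    then show False using c' n by auto
  qed
  have "a \<noteq> b" using uw ab by auto
  have mem: "p ! a \<in> nbrs E D (p ! (m - 1))" "p ! b \<in> nbrs E D (p ! (m - 1))" using uw ab by auto
  then have E: "E (p ! (m - 1)) (p ! a)" "E (p ! (m - 1)) (p ! b)" by (auto simp: nbrs_def)
  then have "a \<noteq> m - 1" "b \<noteq> m - 1" using irr by auto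
  then have m3: "3 \<le> m" using key[OF ab(1) mem(1)] key[OF ab(2) mem(2)] \<open>a \<noteq> b\<close> ab by auto
  have E0: "E (p ! (m - 1)) (p ! 0)"
    using key[OF ab(1) mem(1)] key[OF ab(2) mem(2)] \<open>a \<noteq> b\<close> E by auto
  have succ: "E (p ! i) (p ! ((i + 1) mod m))" if "i < m" for i
  proof (cases "Suc i < m")
    case True then show ?thesis using pE by simp
  next
    case False
    then have "i + 1 = m" using that by simp
    then have "i = m - 1" "(i + 1) mod m = 0" by auto
    then show ?thesis using E0 by simp
  qed
  have adj: "E (p ! i) (p ! j) \<longleftrightarrow> j = (i + 1) mod m \<or> i = (j + 1) mod m" if ij: "i < m" "j < m" for i j
  proof
    assume E: "E (p ! i) (p ! j)"
    define k where "k = (if i = 0 then m - 1 else i - 1)"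
    have k: "k < m" "(k + 1) mod m = i" using ij m3 by (auto simp: k_def)
    have s: "(i + 1) mod m < m" using ij by simp
    have "(i + 1) mod m \<noteq> k"
      using ij m3 by (cases "Suc i < m") (auto simp: k_def not_less le_Suc_eq)
    then have "nbrs E D (p ! i) = {p ! ((i + 1) mod m), p ! k}"
      using succ[OF ij(1)] succ[OF k(1)] k s inD ij inj sym by (intro sub2) auto
    moreover have "p ! j \<in> nbrs E D (p ! i)" using E inD ij by (simp add: nbrs_def)
    ultimately have "j = (i + 1) mod m \<or> j = k" using inj[OF ij(2) s] inj[OF ij(2) k(1)] by auto
    then show "j = (i + 1) mod m \<or> i = (j + 1) mod m" using k by auto
  next
    assume "j = (i + 1) mod m \<or> i = (j + 1) mod m"
    then show "E (p ! i) (p ! j)" using succ[OF ij(1)] succ[OF ij(2)] sym by auto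
  qed
  have full: "z \<in> set p" if i: "i < m" and z: "z \<in> D" "E (p ! i) z" for i z
  proof -
    define k where "k = (if i = 0 then m - 1 else i - 1)"
    have k: "k < m" "(k + 1) mod m = i" using i m3 by (auto simp: k_def)
    have s: "(i + 1) mod m < m" using i by simp
    have "(i + 1) mod m \<noteq> k"
      using i m3 by (cases "Suc i < m") (auto simp: k_def not_less le_Suc_eq)
    then have "nbrs E D (p ! i) = {p ! ((i + 1) mod m), p ! k}"
      using succ[OF i] succ[OF k(1)] k s inD i inj sym by (intro sub2) auto
    then have "z \<in> {p ! ((i + 1) mod m), p ! k}" using z by (auto simp: nbrs_def)
    then show ?thesis using k s by (auto simp: m_def)
  qed
  have "closed_in D (set p)"
    unfolding closed_in_def using full by (metis in_set_conv_nth m_def)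
  then have "set p = D" using conn_closed[OF conn pD] m0 by (auto simp: m_def)
  then have "bij_betw (\<lambda>i. p ! i) {0..<m} D"
    using dist by (metis atLeast0LessThan bij_betw_nth m_def)
  then show ?thesis using m3 adj unfolding cycle_enum_def by blast
qed

text \<open>Every second vertex is taken. Stopping below \<open>n div 2\<close> leaves position
  \<open>n - 1\<close> out for either parity, so the edge back to position 0 does no harm.\<close>

lemma cycle_independent_set:
  assumes "cycle_enum D n f" shows "\<exists>I\<subseteq>D. indep E I \<and> card I = n div 2 \<and> card D = n"
proof -
  have n: "3 \<le> n" and bij: "bij_betw f {0..<n} D"
    and adj: "\<And>i j. i < n \<Longrightarrow> j < n \<Longrightarrow> E (f i) (f j) \<longleftrightarrow> j = (i + 1) mod n \<or> i = (j + 1) mod n"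
    using assms by (auto simp: cycle_enum_def)
  let ?I = "(\<lambda>i. f (2 * i)) ` {0..<n div 2}"
  have "inj_on f {0..<n}" using bij by (simp add: bij_betw_def)
  then have "inj_on (\<lambda>i. f (2 * i)) {0..<n div 2}"
    unfolding inj_on_def
  proof (intro ballI impI)
    fix x y assume h: "\<forall>x\<in>{0..<n}. \<forall>y\<in>{0..<n}. f x = f y \<longrightarrow> x = y"
      "x \<in> {0..<n div 2}" "y \<in> {0..<n div 2}" "f (2 * x) = f (2 * y)"
    then have "2 * x \<in> {0..<n}" "2 * y \<in> {0..<n}" by auto
    then have "2 * x = 2 * y" using h(1,4) by blast
    then show "x = y" by simp
  qed
  then have "card ?I = n div 2" by (simp add: card_image)
  moreover have "?I \<subseteq> D" using bij by (auto simp: bij_betw_def)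
  moreover have "indep E ?I"
    unfolding indep_def
  proof (intro ballI)
    fix u v assume "u \<in> ?I" "v \<in> ?I"
    then obtain i j where ij: "i < n div 2" "j < n div 2" "u = f (2 * i)" "v = f (2 * j)" by auto
    have "(2 * i + 1) mod n = 2 * i + 1" "(2 * j + 1) mod n = 2 * j + 1" using ij by auto
    moreover have "2 * j \<noteq> 2 * i + 1" "2 * i \<noteq> 2 * j + 1" by presburger+
    ultimately show "\<not> E u v" using adj[of "2 * i" "2 * j"] ij by auto
  qed
  moreover have "card D = n" using bij by (metis bij_betw_same_card card_atLeastLessThan diff_zero)
  ultimately show ?thesis by blast
qed

end

section \<open>Weighted independent sets\<close>

lemma t_coeff_nonneg: "0 \<le> t_coeff \<Delta>"
  by (simp add: t_coeff_def)

section \<open>Inequalities between \<open>t\<close> and the products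
  \<open>(d + 1) * (a + 1)\<close>\<close>

lemma four_prod_le:
  fixes d a :: nat
  shows "4 * ((d + 1) * (a + 1)) \<le> (d + a + 2)\<^sup>2"
proof -
  have "0 \<le> (int d - int a)\<^sup>2" by simp
  then have "4 * ((int d + 1) * (int a + 1)) \<le> (int d + int a + 2)\<^sup>2"
    by (simp add: power2_eq_square algebra_simps)
  then have "int (4 * ((d + 1) * (a + 1))) \<le> int ((d + a + 2)\<^sup>2)"
    by (simp only: of_nat_add of_nat_mult of_nat_power of_nat_numeral of_nat_1)
  then show ?thesis by (simp only: of_nat_le_iff)
qed

text \<open>The inequality of the arithmetic and geometric means, rounded down: \<open>(\<Delta> +
  2)\<^sup>2 div 4 = \<Delta>\<^sup>2 div 4 + \<Delta> + 1\<close>.\<close>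

lemma prod_le_critical:
  fixes d a \<Delta> :: nat
  assumes "d + a = \<Delta>"
  shows "(d + 1) * (a + 1) \<le> \<Delta>\<^sup>2 div 4 + \<Delta> + 1"
proof -
  have "(d + 1) * (a + 1) \<le> (\<Delta> + 2)\<^sup>2 div 4" using four_prod_le[of d a] assms by simp
  also have "(\<Delta> + 2)\<^sup>2 = \<Delta>\<^sup>2 + (\<Delta> + 1) * 4" by (simp add: power2_eq_square algebra_simps)
  finally show ?thesis by simp
qed

text \<open>Away from the balanced splitting the two factors differ by at least 2. The square of the
  difference is then at least 4, which improves the bound by one.\<close>

lemma prod_le_noncritical:
  fixes d a \<Delta> :: nat
  assumes "d + a = \<Delta>" "a \<noteq> \<Delta> div 2" "a \<noteq> (\<Delta> + 1) div 2"
  shows "(d + 1) * (a + 1) \<le> \<Delta>\<^sup>2 div 4 + \<Delta>"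
proof -
  have "int d - int a \<ge> 2 \<or> int a - int d \<ge> 2" using assms by presburger
  then have "\<bar>2\<bar> \<le> \<bar>int d - int a\<bar>" by linarith
  then have "2\<^sup>2 \<le> (int d - int a)\<^sup>2" by (simp only: abs_le_square_iff)
  then have "4 * ((int d + 1) * (int a + 1)) + 4 \<le> (int d + int a + 2)\<^sup>2"
    by (simp add: power2_eq_square algebra_simps)
  then have "int (4 * ((d + 1) * (a + 1)) + 4) \<le> int ((d + a + 2)\<^sup>2)"
    by (simp only: of_nat_add of_nat_mult of_nat_power of_nat_numeral of_nat_1)
  then have "4 * ((d + 1) * (a + 1)) + 4 \<le> (\<Delta> + 2)\<^sup>2" using assms(1) by (simp only: of_nat_le_iff)
  also have "(\<Delta> + 2)\<^sup>2 = \<Delta>\<^sup>2 + \<Delta> * 4 + 4" by (simp add: power2_eq_square algebra_simps)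
  finally have "4 * ((d + 1) * (a + 1)) \<le> \<Delta>\<^sup>2 + \<Delta> * 4" by simp
  then have "(d + 1) * (a + 1) \<le> (\<Delta>\<^sup>2 + \<Delta> * 4) div 4" by simp
  then show ?thesis by simp
qed

lemma t_coeff_mult_le:
  assumes "4 \<le> \<Delta>" shows "t_coeff \<Delta> * real (\<Delta>\<^sup>2 div 4 + \<Delta>) \<le> real \<Delta>"
  using assms by (simp add: t_coeff_def)

text \<open>The greedy step at a vertex that does not attain its degree bound. For \<Delta> = 5 the
  case \<open>d = a = 2\<close> is an equality and determines the value 4/9. The inequality is used
  again, with \<open>d - 1\<close> for \<open>d\<close>, when an independent set of density
  \<open>1 / d\<close> is available.\<close>

lemma t_coeff_slack:
  assumes "4 \<le> \<Delta>" "1 \<le> a" "d + a < \<Delta>"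
  shows "t_coeff \<Delta> * real ((d + 1) * (a + 1)) \<le> real (d + a)"
proof -
  consider "\<Delta> = 4" | "\<Delta> = 5" | "6 \<le> \<Delta>" using assms by linarith
  then show ?thesis
  proof cases
    case 1
    then have "(d = 0 \<or> d = 1 \<or> d = 2) \<and> (a = 1 \<or> a = 2 \<or> a = 3) \<and> d + a \<le> 3" using assms by auto
    then show ?thesis using 1 by (auto simp: t_coeff_def)
  next
    case 2
    then have "(d = 0 \<or> d = 1 \<or> d = 2 \<or> d = 3) \<and> (a = 1 \<or> a = 2 \<or> a = 3 \<or> a = 4) \<and> d + a \<le> 4" using assms by auto
    then show ?thesis using 2 by (auto simp: t_coeff_def)
  next
    case 3
    define s where "s = d + a"
    define M where "M = \<Delta>\<^sup>2 div 4 + \<Delta>"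
    define P where "P = (d + 1) * (a + 1)"
    have s: "1 \<le> s" "s + 1 \<le> \<Delta>" using assms by (auto simp: s_def)
    \<comment> \<open>Squares are 0 or 1 modulo 4, so the rounding in
      \<open>\<Delta>\<^sup>2 div 4\<close> loses at most 1/4.\<close>
    have "\<Delta>\<^sup>2 mod 4 \<le> 1"
    proof (cases "even \<Delta>")
      case True then show ?thesis by (auto elim!: evenE simp: power2_eq_square)
    next
      case False
      then obtain k where "\<Delta> = 2 * k + 1" by (auto elim!: oddE)
      then have "\<Delta>\<^sup>2 = 4 * (k * k + k) + 1" by (simp add: power2_eq_square algebra_simps)
      then show ?thesis by simp
    qed
    from add_left_mono[OF this, of "4 * (\<Delta>\<^sup>2 div 4)"] have "\<Delta>\<^sup>2 \<le> 4 * (\<Delta>\<^sup>2 div 4) + 1" by simp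
    then have M: "\<Delta>\<^sup>2 + 4 * \<Delta> \<le> 4 * M + 1" unfolding M_def by simp
    have P: "4 * P \<le> (s + 2)\<^sup>2" unfolding P_def s_def by (rule four_prod_le)
    \<comment> \<open>The difference of the two sides splits into three terms that are non-negative
      by \<open>1 \<le> s\<close>, \<open>s + 1 \<le> \<Delta>\<close> and
      \<open>6 \<le> \<Delta>\<close>. The last condition is the reason why \<Delta> = 4 and
      \<Delta> = 5 are checked by enumeration.\<close>
    have "int \<Delta> * (int s + 2)\<^sup>2 \<le> int s * (int \<Delta> * int \<Delta> + 4 * int \<Delta> - 1)"
    proof -
      have "0 \<le> int \<Delta> * ((int s - 1) * (int \<Delta> - 1 - int s))" using s by simp
      moreover have "int \<Delta> * 6 \<le> int \<Delta> * int \<Delta>" using 3 by (intro mult_left_mono) auto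
      moreover have "int s + 1 \<le> int \<Delta>" using s by simp
      moreover have "int s * (int \<Delta> * int \<Delta> + 4 * int \<Delta> - 1) - int \<Delta> * (int s + 2)\<^sup>2 =
          int \<Delta> * ((int s - 1) * (int \<Delta> - 1 - int s)) + (int \<Delta> * int \<Delta> - int \<Delta> * 6) + (int \<Delta> - int s)"
        by (simp add: power2_eq_square algebra_simps)
      ultimately show ?thesis by linarith
    qed
    also have "\<dots> \<le> int s * (4 * int M)"
    proof (rule mult_left_mono)
      have "int (\<Delta>\<^sup>2 + 4 * \<Delta>) \<le> int (4 * M + 1)" using M by (simp only: of_nat_le_iff)
      then show "int \<Delta> * int \<Delta> + 4 * int \<Delta> - 1 \<le> 4 * int M" by (simp add: power2_eq_square)
    qed simp
    finally have *: "int \<Delta> * (int s + 2)\<^sup>2 \<le> int s * (4 * int M)" .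
    have "int (4 * P) \<le> int ((s + 2)\<^sup>2)" using P by (simp only: of_nat_le_iff)
    then have "4 * int P \<le> (int s + 2)\<^sup>2" by (simp only: of_nat_add of_nat_mult of_nat_power of_nat_numeral)
    then have "int \<Delta> * (4 * int P) \<le> int \<Delta> * (int s + 2)\<^sup>2" by (rule mult_left_mono) simp
    then have "int (\<Delta> * P) \<le> int (s * M)" using * by simp
    then have "\<Delta> * P \<le> s * M" by (simp only: of_nat_le_iff)
    then have "real \<Delta> * real P \<le> real s * real M" by (metis of_nat_le_iff of_nat_mult)
    moreover have "0 < real M" using 3 by (simp add: M_def)
    moreover have "t_coeff \<Delta> = real \<Delta> / real M" using 3 by (simp add: t_coeff_def M_def)
    ultimately have "t_coeff \<Delta> * real P \<le> real s" by (simp add: divide_le_eq mult.commute)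
    then show ?thesis by (simp only: P_def s_def)
  qed
qed

section \<open>Blocks, tight components and heavy independent sets\<close>

locale special_graph = sgraph +
  fixes \<Delta> :: nat
  assumes Delta: "4 \<le> \<Delta>"
begin

abbreviation t :: real where "t \<equiv> t_coeff \<Delta>"

definition critical :: "nat \<Rightarrow> bool" where
  "critical m \<longleftrightarrow> m = \<Delta> div 2 \<or> m = (\<Delta> + 1) div 2"

definition block :: "'a set \<Rightarrow> bool" where
  "block D \<longleftrightarrow> (clique E D \<and> critical (card D - 1) \<and> finite D) \<or>
     (\<Delta> = 4 \<and> (\<exists>n f. odd n \<and> cycle_enum D n f))"

lemma critical_complement: "d + m = \<Delta> \<Longrightarrow> critical m \<Longrightarrow> critical d"
proof -
  assume h: "d + m = \<Delta>" "critical m"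
  have "\<Delta> div 2 + (\<Delta> + 1) div 2 = \<Delta>" by presburger
  with h show ?thesis by (auto simp: critical_def)
qed

lemma critical_ge2: "critical m \<Longrightarrow> 2 \<le> m"
  using Delta by (auto simp: critical_def)

text \<open>The stars of a complete \<open>D\<close> have \<open>(d + 1) * (m + 1)\<close> vertices,
  at most one more than the greedy bound covers; hence the loss \<open>t\<close>. If
  \<open>D\<close> is not complete, it contains no clique on \<open>d + 1\<close> vertices, as this
  would be closed under adjacency. Then Brooks applies for \<open>3 \<le> d\<close>, and
  \<open>D\<close> is a cycle for \<open>d = 2\<close>.\<close>

lemma tight_component_weight:
  assumes fin: "finite D" and conn: "conn D" and reg: "\<And>x. x \<in> D \<Longrightarrow> card (nbrs E D x) = d"
    and dm: "d + m = \<Delta>" and crit: "critical m"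
  shows "\<exists>I\<subseteq>D. indep E I \<and>
    t * (real (card D) * (1 + real m)) - (if block D then t else 0) \<le> real (card D) + real (card I) * (real m - 1)"
proof (cases "clique E D")
  case True
  obtain x where x: "x \<in> D" using conn by (auto simp: conn_def)
  have irrE: "irreflp E" using irr by (auto intro: irreflpI)
  have card: "card D = d + 1"
    using card_nbrs_clique[OF True irrE x fin] reg[OF x] x fin
    by (metis Suc_eq_plus1 card_gt_0_iff empty_iff Suc_diff_1)
  then have "block D" using True fin critical_complement[OF dm crit] by (simp add: block_def)
  moreover have "t * real ((d + 1) * (m + 1)) \<le> real \<Delta> + t"
  proof -
    have "t * real ((d + 1) * (m + 1)) \<le> t * real (\<Delta>\<^sup>2 div 4 + \<Delta> + 1)"
      using prod_le_critical[OF dm] t_coeff_nonneg by (intro mult_left_mono) (simp_all only: of_nat_le_iff)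
    then show ?thesis using t_coeff_mult_le[OF Delta] by (simp add: algebra_simps)
  qed
  moreover have "real \<Delta> = real (d + 1) + (real m - 1)" using dm by simp
  ultimately show ?thesis
    using x irr card by (intro exI[of _ "{x}"]) (auto simp: indep_def algebra_simps)
next
  case nocl: False
  have m2: "2 \<le> m" and d2: "2 \<le> d"
    using critical_ge2 crit critical_complement[OF dm crit] by auto
  show ?thesis
  proof (cases "3 \<le> d")
    case True
    have "\<exists>I\<subseteq>D. indep E I \<and> card D \<le> d * card I"
    proof (rule independent_set_brooks[OF fin _ _ _ True])
      show "symp E" using sym by (auto intro: sympI)
      show irrE: "irreflp E" using irr by (auto intro: irreflpI)
      show "card (nbrs E D v) \<le> d" if "v \<in> D" for v using reg[OF that] by simp
      show "card Q \<noteq> Suc d" if Q: "Q \<subseteq> D" "clique E Q" for Q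
      proof
        assume cQ: "card Q = Suc d"
        have finQ: "finite Q" using Q fin finite_subset by blast
        have "nbrs E D x = nbrs E Q x" if "x \<in> Q" for x
        proof (rule card_subset_eq[symmetric])
          show "card (nbrs E Q x) = card (nbrs E D x)"
            using card_nbrs_clique[OF Q(2) irrE that finQ] reg[of x] that Q(1) cQ by auto
          show "nbrs E Q x \<subseteq> nbrs E D x" by (rule nbrs_mono[OF Q(1)])
        qed (use fin in simp)
        then have "closed_in D Q" by (auto simp: closed_in_def nbrs_def)
        moreover have "Q \<noteq> {}" using cQ by auto
        ultimately have "Q = D" using conn_closed[OF conn Q(1)] by simp
        then show False using nocl Q by simp
      qed
    qed
    then obtain I where I: "I \<subseteq> D" "indep E I" "card D \<le> d * card I" by blast
    \<comment> \<open>Each chosen vertex now has to account for only \<open>d\<close> vertices of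
      \<open>D\<close> instead of \<open>d + 1\<close>, so the slack inequality for
      \<open>d - 1\<close> suffices.\<close>
    have "t * real ((d - 1 + 1) * (m + 1)) \<le> real (d - 1 + m)"
      using m2 dm True by (intro t_coeff_slack[OF Delta]) auto
    then have "t * (real d * (1 + real m)) \<le> real d + (real m - 1)"
      using True by (simp add: algebra_simps of_nat_diff)
    then have "real (card D) * (t * (real d * (1 + real m))) \<le> real (card D) * (real d + (real m - 1))"
      by (intro mult_left_mono) auto
    moreover have "real (card D) * (real m - 1) \<le> (real d * real (card I)) * (real m - 1)"
    proof (rule mult_right_mono)
      show "real (card D) \<le> real d * real (card I)" using I(3) by (metis of_nat_le_iff of_nat_mult)
    qed (use m2 in simp)
    ultimately have "real d * (t * (real (card D) * (1 + real m))) \<le> real d * (real (card D) + real (card I) * (real m - 1))"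
      by (simp add: algebra_simps)
    then have "t * (real (card D) * (1 + real m)) \<le> real (card D) + real (card I) * (real m - 1)"
      using True by simp
    then have "t * (real (card D) * (1 + real m)) - (if block D then t else 0) \<le> real (card D) + real (card I) * (real m - 1)"
      using t_coeff_nonneg[of \<Delta>] by (cases "block D") (simp_all)
    then show ?thesis using I by blast
  next
    case False
    then have d: "d = 2" using d2 by simp
    then obtain n f where nf: "cycle_enum D n f"
      using two_regular_cycle[OF fin conn] reg by blast
    then obtain I where I: "I \<subseteq> D" "indep E I" "card I = n div 2" "card D = n"
      using cycle_independent_set by blast
    have n3: "3 \<le> n" using nf by (simp add: cycle_enum_def)
    have "n \<noteq> 3"
    proof
      assume n: "n = 3"
      have "clique E D" unfolding clique_def
      proof (intro ballI impI)
        fix u v assume uv: "u \<in> D" "v \<in> D" "u \<noteq> v"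
        have "f ` {0..<3} = D" using nf n by (simp add: cycle_enum_def bij_betw_def)
        then obtain i j where ij: "i < 3" "j < 3" "u = f i" "v = f j" using uv by auto
        have "i \<noteq> j" using uv ij by auto
        moreover have "i = 0 \<or> i = 1 \<or> i = 2" "j = 0 \<or> j = 1 \<or> j = 2" using ij by auto
        ultimately have "j = (i + 1) mod 3 \<or> i = (j + 1) mod 3" by auto
        then show "E u v" using nf ij n by (simp add: cycle_enum_def)
      qed
      then show False using nocl by simp
    qed
    then have n4: "4 \<le> n" using n3 by simp
    have "(\<Delta> = 4 \<and> m = 2) \<or> (\<Delta> = 5 \<and> m = 3)"
    proof -
      have "2 * m \<le> \<Delta> + 1" using crit by (auto simp: critical_def)
      then have "\<Delta> = 4 \<or> \<Delta> = 5" using dm d Delta by linarith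
      then show ?thesis using dm d by auto
    qed
    then have "t * (real (card D) * (1 + real m)) - (if block D then t else 0) \<le> real (card D) + real (card I) * (real m - 1)"
    proof
      assume D: "\<Delta> = 4 \<and> m = 2"
      then have t: "t = 1 / 2" by (simp add: t_coeff_def)
      show ?thesis
      proof (cases "even n")
        case True
        then show ?thesis using D I t by (auto elim!: evenE simp: algebra_simps)
      next
        case False
        then have "block D" using D nf unfolding block_def by blast
        then show ?thesis using False D I t by (auto elim!: oddE simp: algebra_simps)
      qed
    next
      assume D: "\<Delta> = 5 \<and> m = 3"
      then have t: "t = 4 / 9" by (simp add: t_coeff_def)
      \<comment> \<open>The closest case is \<open>n = 5\<close>, with 80 against 81; the triangle
        would fail, but it is complete.\<close>
      have "16 * n \<le> 9 * n + 18 * (n div 2)" using n4 by presburger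
      then have "real (16 * n) \<le> real (9 * n + 18 * (n div 2))" by (simp only: of_nat_le_iff)
      then have "16 * real n \<le> 9 * real n + 18 * real (n div 2)"
        by (simp only: of_nat_add of_nat_mult of_nat_numeral)
      then have "t * (real (card D) * (1 + real m)) \<le> real (card D) + real (card I) * (real m - 1)"
        unfolding t I(3,4) using D by simp
      then show ?thesis using t_coeff_nonneg[of \<Delta>] by (cases "block D") (simp_all)
    qed
    then show ?thesis using I by blast
  qed
qed

text \<open>These are the components on which the greedy choice can fail.\<close>

definition tight_component :: "'a set \<Rightarrow> ('a \<Rightarrow> nat) \<Rightarrow> 'a set \<Rightarrow> bool" where
  "tight_component C a D \<longleftrightarrow> D \<subseteq> C \<and> conn D \<and> closed_in C D \<and>
     (\<exists>m. critical m \<and> (\<forall>x\<in>D. a x = m \<and> card (nbrs E C x) + m = \<Delta>))"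

text \<open>Tight components are split off first and treated separately. Once there are none, some
  vertex admits the greedy step. Deleting its closed neighbourhood creates no tight component: the
  vertices of such a component attain their degree bound after the deletion, so they have lost no
  neighbour, and the component was tight before.\<close>

lemma weighted_independent_set:
  assumes "finite C" "\<And>x. x \<in> C \<Longrightarrow> 1 \<le> a x" "\<And>x. x \<in> C \<Longrightarrow> card (nbrs E C x) + a x \<le> \<Delta>"
  shows "\<exists>I\<subseteq>C. indep E I \<and>
    t * (\<Sum>x\<in>C. 1 + real (a x)) - t * real (card {D. tight_component C a D \<and> block D})
      \<le> real (card C) + (\<Sum>x\<in>I. real (a x) - 1)"
  using assms
proof (induction "card C" arbitrary: C rule: less_induct)
  case (less C)
  note fin = less.prems(1) and a1 = less.prems(2) and deg = less.prems(3)
  let ?B = "\<lambda>C. {D. tight_component C a D \<and> block D}"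
  have finB: "finite (?B C)" 
    by (rule finite_subset[of _ "Pow C"]) (use fin in \<open>auto simp: tight_component_def\<close>)
  have sub: "\<exists>I\<subseteq>C'. indep E I \<and> t * (\<Sum>x\<in>C'. 1 + real (a x)) - t * real (card (?B C'))
      \<le> real (card C') + (\<Sum>x\<in>I. real (a x) - 1)" if C': "C' \<subset> C" for C'
  proof (rule less.hyps)
    show "card C' < card C" using C' fin by (simp add: psubset_card_mono)
    show "finite C'" using C' fin finite_subset by blast
    show "1 \<le> a x" if "x \<in> C'" for x using a1 that C' by blast
    show "card (nbrs E C' x) + a x \<le> \<Delta>" if "x \<in> C'" for x
      using card_mono[OF finite_nbrs[OF fin] nbrs_mono[of C' C E x]] deg[of x] that C' by fastforce
  qed
  show ?case
  proof (cases "\<exists>D. tight_component C a D")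
    case True
    then obtain D where D: "tight_component C a D" by blast
    then obtain m where m: "critical m" "\<And>x. x \<in> D \<Longrightarrow> a x = m" "\<And>x. x \<in> D \<Longrightarrow> card (nbrs E C x) + m = \<Delta>"
      by (auto simp: tight_component_def)
    have DC: "D \<subseteq> C" "conn D" "closed_in C D" using D by (auto simp: tight_component_def)
    have finD: "finite D" using DC fin finite_subset by blast
    have neD: "D \<noteq> {}" using DC by (auto simp: conn_def)
    have nbD: "nbrs E D x = nbrs E C x" if "x \<in> D" for x
      using DC that by (auto simp: nbrs_def closed_in_def)
    have nbC: "nbrs E (C - D) x = nbrs E C x" if "x \<in> C - D" for x
      using DC that sym by (auto simp: nbrs_def closed_in_def)
    obtain x0 where "x0 \<in> D" using neD by blast
    then have "\<Delta> - m + m = \<Delta>" using m(3)[of x0] by simp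
    then obtain I1 where I1: "I1 \<subseteq> D" "indep E I1"
      "t * (real (card D) * (1 + real m)) - (if block D then t else 0) \<le> real (card D) + real (card I1) * (real m - 1)"
      using tight_component_weight[OF finD DC(2) _ _ m(1), of "\<Delta> - m"] m(3) nbD by fastforce
    obtain I2 where I2: "I2 \<subseteq> C - D" "indep E I2"
      "t * (\<Sum>x\<in>C - D. 1 + real (a x)) - t * real (card (?B (C - D))) \<le> real (card (C - D)) + (\<Sum>x\<in>I2. real (a x) - 1)"
      using sub[of "C - D"] neD DC(1) by blast
    \<comment> \<open>No edge joins \<open>D\<close> to the rest, so degrees outside
      \<open>D\<close> do not change.\<close>
    have "?B (C - D) \<subseteq> ?B C - {D}"
    proof
      fix D' assume D': "D' \<in> ?B (C - D)"
      then have "D' \<subseteq> C - D" "conn D'" "closed_in (C - D) D'" by (auto simp: tight_component_def)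
      moreover from this have "closed_in C D'"
        using DC sym unfolding closed_in_def by blast
      moreover have "D' \<noteq> D" using calculation neD by blast
      moreover have "card (nbrs E (C - D) x) = card (nbrs E C x)" if "x \<in> D'" for x
        using nbC[of x] that calculation(1) by auto
      ultimately show "D' \<in> ?B C - {D}" using D' by (auto simp: tight_component_def)
    qed
    then have "card (?B (C - D)) \<le> card (?B C - {D})" using finB by (intro card_mono) auto
    then have "card (?B (C - D)) + (if block D then 1 else 0) \<le> card (?B C)"
      using D finB by (auto simp: card_Diff_singleton_if split: if_splits)
        (metis (mono_tags, lifting) One_nat_def Suc_pred card_gt_0_iff empty_iff le_simps(2) mem_Collect_eq Suc_le_mono)
    then have "real (card (?B (C - D))) + (if block D then 1 else 0) \<le> real (card (?B C))"
      by (simp split: if_splits)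
    then have B: "t * real (card (?B (C - D))) + (if block D then t else 0) \<le> t * real (card (?B C))"
      using t_coeff_nonneg[of \<Delta>] mult_left_mono[of "real (card (?B (C - D))) + (if block D then 1 else 0)" "real (card (?B C))" t]
      by (simp add: algebra_simps split: if_splits)
    have disj: "I1 \<inter> I2 = {}" "finite I1" "finite I2"
      using I1 I2 finD fin finite_subset[of I2 C] finite_subset[of I1 D] by auto
    have "(\<Sum>x\<in>C. 1 + real (a x)) = (\<Sum>x\<in>C - D. 1 + real (a x)) + (\<Sum>x\<in>D. 1 + real (a x))"
      using DC fin by (simp add: sum.subset_diff)
    also have "(\<Sum>x\<in>D. 1 + real (a x)) = real (card D) * (1 + real m)" using m(2) by simp
    finally have S: "(\<Sum>x\<in>C. 1 + real (a x)) = (\<Sum>x\<in>C - D. 1 + real (a x)) + real (card D) * (1 + real m)" .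
    have "(\<Sum>x\<in>I1 \<union> I2. real (a x) - 1) = (\<Sum>x\<in>I1. real (a x) - 1) + (\<Sum>x\<in>I2. real (a x) - 1)"
      using disj by (simp add: sum.union_disjoint)
    also have "(\<Sum>x\<in>I1. real (a x) - 1) = (\<Sum>x\<in>I1. real m - 1)"
      by (rule sum.cong) (use m(2) I1(1) in auto)
    finally have SI: "(\<Sum>x\<in>I1 \<union> I2. real (a x) - 1) = real (card I1) * (real m - 1) + (\<Sum>x\<in>I2. real (a x) - 1)"
      by simp
    have "card C = card (C - D) + card D"
      using DC fin finD card_mono[OF fin DC(1)] by (simp add: card_Diff_subset)
    then have cardC: "real (card C) = real (card (C - D)) + real (card D)" by simp
    have no: "\<not> E u v \<and> \<not> E v u" if "u \<in> I1" "v \<in> I2" for u v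
      using that I1(1) I2(1) DC(3) sym unfolding closed_in_def by blast
    have "indep E (I1 \<union> I2)"
      using I1(2) I2(2) no by (auto simp: indep_def)
    moreover have "t * (\<Sum>x\<in>C. 1 + real (a x)) - t * real (card (?B C)) \<le> real (card C) + (\<Sum>x\<in>I1 \<union> I2. real (a x) - 1)"
      using I1(3) I2(3) B unfolding S SI cardC by (simp add: algebra_simps)
    moreover have "I1 \<union> I2 \<subseteq> C" using I1 I2 DC by auto
    ultimately show ?thesis by blast
  next
    case False
    show ?thesis
    proof (cases "C = {}")
      case True
      then show ?thesis using t_coeff_nonneg[of \<Delta>] by (auto simp: indep_def)
    next
      case ne: False
      define M where "M = Max (a ` C)"
      have Mge: "a x \<le> M" if "x \<in> C" for x using that fin by (simp add: M_def)
      have "M \<in> a ` C" unfolding M_def using fin ne by (intro Max_in) auto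
      then obtain v0 where v0: "v0 \<in> C" "a v0 = M" by auto
      let ?N = "\<lambda>v. insert v (nbrs E C v)"
      have sumN: "(\<Sum>x\<in>?N v. 1 + a x) \<le> (card (nbrs E C v) + 1) * (M + 1)" if "v \<in> C" for v
      proof -
        have "(\<Sum>x\<in>?N v. 1 + a x) \<le> (\<Sum>x\<in>?N v. M + 1)"
          using Mge that by (intro sum_mono) (auto simp: nbrs_def)
        also have "\<dots> = (card (nbrs E C v) + 1) * (M + 1)"
          using irr fin by (simp add: nbrs_def)
        finally show ?thesis .
      qed
      \<comment> \<open>If the greedy inequality fails everywhere, then every vertex of the maximum
        weight \<open>M\<close> attains its degree bound, \<open>M\<close> is critical, and all its
        neighbours have weight \<open>M\<close> too. So the vertices of weight \<open>M\<close> form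
        a union of components, and the component of \<open>v0\<close> is tight.\<close>
      have good: "\<exists>v\<in>C. t * real (\<Sum>x\<in>?N v. 1 + a x) \<le> real (a v + card (nbrs E C v))"
      proof (rule ccontr)
        assume none: "\<not> ?thesis"
        have key: "card (nbrs E C v) + M = \<Delta> \<and> critical M \<and> (\<forall>x\<in>nbrs E C v. a x = M)"
          if v: "v \<in> C" "a v = M" for v
        proof -
          let ?d = "card (nbrs E C v)"
          have lt: "real (M + ?d) < t * real (\<Sum>x\<in>?N v. 1 + a x)" using none v by force
          have le: "t * real (\<Sum>x\<in>?N v. 1 + a x) \<le> t * real K" if "(\<Sum>x\<in>?N v. 1 + a x) \<le> K" for K
            using that t_coeff_nonneg by (intro mult_left_mono) (simp_all only: of_nat_le_iff)
          have full: "?d + M = \<Delta>"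
          proof (rule ccontr)
            assume "?d + M \<noteq> \<Delta>"
            then have "?d + M < \<Delta>" using deg[OF v(1)] v(2) by simp
            from t_coeff_slack[OF Delta _ this] a1[OF v(1)] v(2)
            have "t * real ((?d + 1) * (M + 1)) \<le> real (?d + M)" by simp
            moreover have "real (?d + M) = real (M + ?d)" by (simp only: add.commute)
            ultimately show False using lt le[OF sumN[OF v(1)]] by linarith
          qed
          have notle: "\<not> (\<Sum>x\<in>?N v. 1 + a x) \<le> \<Delta>\<^sup>2 div 4 + \<Delta>"
          proof
            assume "(\<Sum>x\<in>?N v. 1 + a x) \<le> \<Delta>\<^sup>2 div 4 + \<Delta>"
            from le[OF this] lt have "real (M + ?d) < t * real (\<Delta>\<^sup>2 div 4 + \<Delta>)" by linarith
            moreover have "real (M + ?d) = real \<Delta>" using full by (simp only: add.commute)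
            ultimately show False using t_coeff_mult_le[OF Delta] by linarith
          qed
          have "critical M"
            using prod_le_noncritical[OF full] sumN[OF v(1)] notle unfolding critical_def by linarith
          moreover have "a x = M" if x: "x \<in> nbrs E C v" for x
          proof (rule ccontr)
            assume "a x \<noteq> M"
            then have "a x < M" using Mge[of x] x by (auto simp: nbrs_def)
            then have "(\<Sum>x\<in>?N v. 1 + a x) < (\<Sum>x\<in>?N v. M + 1)"
              using Mge v x fin by (intro sum_strict_mono_ex1) (auto simp: nbrs_def)
            also have "\<dots> = (?d + 1) * (M + 1)" using irr fin by (simp add: nbrs_def)
            finally show False using prod_le_critical[OF full] notle by simp
          qed
          ultimately show ?thesis using full by simp
        qed
        let ?S = "{x\<in>C. a x = M}"
        have cl: "closed_in C ?S" using key by (auto simp: closed_in_def nbrs_def)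
        have "component C v0 \<subseteq> ?S"
          using reach_closed[OF _ _ cl] v0 by (auto simp: component_def)
        then have "a x = M \<and> card (nbrs E C x) + M = \<Delta>" if "x \<in> component C v0" for x
          using key[of x] that by blast
        moreover have "critical M" using key[OF v0] by simp
        ultimately have "tight_component C a (component C v0)"
          unfolding tight_component_def using component_subset conn_component[OF v0(1)] closed_in_component by blast
        then show False using False by blast
      qed
      then obtain v where v: "v \<in> C" "t * real (\<Sum>x\<in>?N v. 1 + a x) \<le> real (a v + card (nbrs E C v))" by blast
      let ?C = "C - ?N v"
      have NC: "?N v \<subseteq> C" using v by (auto simp: nbrs_def)
      have "?B ?C = {}"
      proof (rule ccontr)
        assume "?B ?C \<noteq> {}"
        then obtain D where D: "tight_component ?C a D" by blast
        then obtain m where m: "critical m" "\<And>x. x \<in> D \<Longrightarrow> a x = m" "\<And>x. x \<in> D \<Longrightarrow> card (nbrs E ?C x) + m = \<Delta>"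
          and DC: "D \<subseteq> ?C" "conn D" "closed_in ?C D"
          by (auto simp: tight_component_def)
        have nb: "nbrs E ?C x = nbrs E C x" if "x \<in> D" for x
        proof (rule card_seteq)
          show "nbrs E ?C x \<subseteq> nbrs E C x" by (rule nbrs_mono) auto
          show "card (nbrs E C x) \<le> card (nbrs E ?C x)" using deg[of x] m(2,3)[OF that] that DC(1) by fastforce
        qed (use fin in simp)
        then have "closed_in C D" using DC(3) by (fastforce simp: closed_in_def nbrs_def)
        then have "tight_component C a D" using m DC nb unfolding tight_component_def by fastforce
        then show False using False by blast
      qed
      moreover have "?C \<subset> C" using v by blast
      ultimately obtain I where I: "I \<subseteq> ?C" "indep E I"
        "t * (\<Sum>x\<in>?C. 1 + real (a x)) \<le> real (card ?C) + (\<Sum>x\<in>I. real (a x) - 1)"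
        using sub[of ?C] by (simp only: card.empty) auto
      have finI: "finite I" "v \<notin> I" using I(1) fin finite_subset[of I C] by auto
      have "\<not> E v x" "\<not> E x v" if "x \<in> I" for x
        using that I(1) sym by (auto simp: nbrs_def)
      then have ind: "indep E (insert v I)" using I(2) irr by (simp add: indep_def)
      have "(\<Sum>x\<in>C. 1 + real (a x)) = (\<Sum>x\<in>?C. 1 + real (a x)) + (\<Sum>x\<in>?N v. 1 + real (a x))"
        using NC fin by (simp only: sum.subset_diff)
      moreover have "(\<Sum>x\<in>?N v. 1 + real (a x)) = real (\<Sum>x\<in>?N v. 1 + a x)" by (simp only: of_nat_sum of_nat_add of_nat_1)
      ultimately have S: "t * (\<Sum>x\<in>C. 1 + real (a x)) = t * (\<Sum>x\<in>?C. 1 + real (a x)) + t * real (\<Sum>x\<in>?N v. 1 + a x)"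
        by (simp only: distrib_left)
      have "card C = card ?C + card (?N v)"
        using card_Diff_subset[OF finite_subset[OF NC fin] NC] card_mono[OF fin NC] by simp
      also have "card (?N v) = card (nbrs E C v) + 1" using irr fin by (simp add: nbrs_def)
      finally have cardC: "real (card C) = real (card ?C) + real (card (nbrs E C v)) + 1" by simp
      have SI: "(\<Sum>x\<in>insert v I. real (a x) - 1) = real (a v) - 1 + (\<Sum>x\<in>I. real (a x) - 1)"
        using finI by simp
      have "t * (\<Sum>x\<in>C. 1 + real (a x)) \<le> real (card C) + (\<Sum>x\<in>insert v I. real (a x) - 1)"
        using v(2) I(3) unfolding S cardC SI by simp
      moreover have "0 \<le> t * real (card (?B C))" using t_coeff_nonneg by simp
      ultimately have "t * (\<Sum>x\<in>C. 1 + real (a x)) - t * real (card (?B C)) \<le> real (card C) + (\<Sum>x\<in>insert v I. real (a x) - 1)"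
        by linarith
      moreover have "insert v I \<subseteq> C" using v I by auto
      ultimately show ?thesis using ind by blast
    qed
  qed
qed

end

section \<open>Star forests\<close>

context sgraph begin

lemma extend_to_maximal_independent:
  assumes fin: "finite A" and I: "I \<subseteq> A" "indep E I"
  shows "\<exists>J. I \<subseteq> J \<and> J \<subseteq> A \<and> indep E J \<and> (\<forall>v\<in>A - J. \<exists>u\<in>J. E v u)"
proof -
  let ?P = "\<lambda>J. I \<subseteq> J \<and> J \<subseteq> A \<and> indep E J"
  have "?P I" using I by simp
  moreover have "\<forall>J. ?P J \<longrightarrow> card J < Suc (card A)" using fin by (simp add: card_mono less_Suc_eq_le)
  ultimately obtain J where J: "?P J" and Jmax: "\<And>K. ?P K \<Longrightarrow> card K \<le> card J"
    using ex_has_greatest_nat[of ?P I card "Suc (card A)"] by auto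
  have "\<exists>u\<in>J. E v u" if v: "v \<in> A - J" for v
  proof (rule ccontr)
    assume no: "\<not> (\<exists>u\<in>J. E v u)"
    then have "\<forall>u\<in>J. \<not> E v u \<and> \<not> E u v" using sym by blast
    then have "indep E (insert v J)" using J irr by (simp add: indep_def)
    then have "?P (insert v J)" using J v by auto
    moreover have "finite J" using J fin finite_subset by blast
    ultimately show False using Jmax[of "insert v J"] v by simp
  qed
  then show ?thesis using J by blast
qed

text \<open>A partition into stars is encoded by the map to the centre, whose fixed points are the
  centres. The last clause rules out stars without leaves.\<close>

definition star_forest :: "'a set \<Rightarrow> ('a \<Rightarrow> 'a) \<Rightarrow> bool" where
  "star_forest V c \<longleftrightarrow> (\<forall>v\<in>V. c v \<in> V \<and> c (c v) = c v \<and> (c v \<noteq> v \<longrightarrow> E v (c v)) \<and>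
     (c v = v \<longrightarrow> (\<exists>u\<in>V. u \<noteq> v \<and> c u = v)))"

lemma star_forestI:
  assumes "\<And>v. v \<in> V \<Longrightarrow> c v \<in> V" "\<And>v. v \<in> V \<Longrightarrow> c (c v) = c v"
    "\<And>v. v \<in> V \<Longrightarrow> c v \<noteq> v \<Longrightarrow> E v (c v)"
    "\<And>v. v \<in> V \<Longrightarrow> c v = v \<Longrightarrow> \<exists>u\<in>V. u \<noteq> v \<and> c u = v"
  shows "star_forest V c"
  using assms by (simp add: star_forest_def)

lemma star_forestD:
  assumes "star_forest V c" "v \<in> V"
  shows "c v \<in> V" "c (c v) = c v" "c v \<noteq> v \<Longrightarrow> E v (c v)" "c v = v \<Longrightarrow> \<exists>u\<in>V. u \<noteq> v \<and> c u = v"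
  using assms by (auto simp: star_forest_def)

text \<open>The delicate cases are those where \<open>u\<close> is a leaf. If its star has another
  leaf, \<open>u\<close> leaves it and forms a new star with \<open>v\<close>. Otherwise its star is
  a single edge and is re-rooted at \<open>u\<close>.\<close>

lemma star_forest_extend:
  assumes sf: "star_forest W c" and v: "v \<notin> W" "E v u"
  shows "\<exists>c'. star_forest (insert u (insert v W)) c'"
proof -
  have uv: "u \<noteq> v" using v irr by auto
  note D = star_forestD[OF sf]
  consider "u \<notin> W" | "u \<in> W" "c u = u" | u2 where "u \<in> W" "c u \<noteq> u" "u2 \<in> W" "u2 \<noteq> u" "c u2 = c u" "u2 \<noteq> c u"
    | "u \<in> W" "c u \<noteq> u" "\<And>z. z \<in> W \<Longrightarrow> c z = c u \<Longrightarrow> z = u \<or> z = c u" by blast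
  then show ?thesis
  proof cases
    case 1
    have "star_forest (insert u (insert v W)) (c(u := u, v := u))"
    proof (rule star_forestI)
      fix z assume z: "z \<in> insert u (insert v W)"
      show "(c(u := u, v := u)) z \<in> insert u (insert v W)" using z D(1) by auto
      show "(c(u := u, v := u)) ((c(u := u, v := u)) z) = (c(u := u, v := u)) z"
        using z D(1,2) 1 v by auto
      show "E z ((c(u := u, v := u)) z)" if "(c(u := u, v := u)) z \<noteq> z"
        using z that D(3) v 1 by (auto split: if_splits)
      show "\<exists>w\<in>insert u (insert v W). w \<noteq> z \<and> (c(u := u, v := u)) w = z" if "(c(u := u, v := u)) z = z"
      proof (cases "z = u \<or> z = v")
        case True then show ?thesis using that uv by (intro bexI[of _ v]) auto
      next
        case False
        then have "c z = z" "z \<in> W" using that z by auto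
        then obtain w where "w \<in> W" "w \<noteq> z" "c w = z" using D(4)[of z] by auto
        then show ?thesis using False 1 v by (intro bexI[of _ w]) auto
      qed
    qed
    then show ?thesis by blast
  next
    case 2
    have "star_forest (insert u (insert v W)) (c(v := u))"
    proof (rule star_forestI)
      fix z assume z: "z \<in> insert u (insert v W)"
      show "(c(v := u)) z \<in> insert u (insert v W)" using z D(1) 2 by auto
      show "(c(v := u)) ((c(v := u)) z) = (c(v := u)) z"
        using z D(1,2) 2 v uv by auto
      show "E z ((c(v := u)) z)" if "(c(v := u)) z \<noteq> z"
        using z that D(3) v 2 by (auto split: if_splits)
      show "\<exists>w\<in>insert u (insert v W). w \<noteq> z \<and> (c(v := u)) w = z" if "(c(v := u)) z = z"
      proof -
        have "z \<in> W" "c z = z" using that z uv 2 by (auto split: if_splits)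
        then obtain w where "w \<in> W" "w \<noteq> z" "c w = z" using D(4)[of z] by auto
        then show ?thesis using v by (intro bexI[of _ w]) auto
      qed
    qed
    then show ?thesis by blast
  next
    case 3
    have "star_forest (insert u (insert v W)) (c(u := u, v := u))"
    proof (rule star_forestI)
      fix z assume z: "z \<in> insert u (insert v W)"
      show "(c(u := u, v := u)) z \<in> insert u (insert v W)" using z D(1) by auto
      have "c z \<noteq> v" if "z \<in> W" using D(1)[OF that] v by auto
      then show "(c(u := u, v := u)) ((c(u := u, v := u)) z) = (c(u := u, v := u)) z"
        using z D(2) by auto
      show "E z ((c(u := u, v := u)) z)" if "(c(u := u, v := u)) z \<noteq> z"
        using z that D(3) v by (auto split: if_splits)
      show "\<exists>w\<in>insert u (insert v W). w \<noteq> z \<and> (c(u := u, v := u)) w = z" if "(c(u := u, v := u)) z = z"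
      proof (cases "z = u \<or> z = v")
        case True then show ?thesis using that uv by (intro bexI[of _ v]) auto
      next
        case False
        then have "c z = z" "z \<in> W" using that z by auto
        then obtain w where w: "w \<in> W" "w \<noteq> z" "c w = z" using D(4)[of z] by auto
        show ?thesis
        proof (cases "w = u")
          case True
          then show ?thesis using 3 w v False by (intro bexI[of _ u2]) auto
        next
          case False
          then show ?thesis using w v by (intro bexI[of _ w]) auto
        qed
      qed
    qed
    then show ?thesis by blast
  next
    case 4
    define x where "x = c u"
    have x: "x \<in> W" "c x = x" "x \<noteq> u" "E x u" using D[of u] 4(1,2) sym by (auto simp: x_def)
    have only: "z = u \<or> z = x" if "z \<in> W" "c z = x" for z using 4(3) that by (simp add: x_def)
    have "star_forest (insert u (insert v W)) (c(u := u, v := u, x := u))" (is "star_forest _ ?c")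
    proof (rule star_forestI)
      fix z assume z: "z \<in> insert u (insert v W)"
      show "?c z \<in> insert u (insert v W)" using z D(1) by auto
      have "c z \<noteq> v" if "z \<in> W" using D(1)[OF that] v by auto
      moreover have "c z \<noteq> x" if "z \<in> W" "z \<noteq> u" "z \<noteq> x" using only that by auto
      ultimately show "?c (?c z) = ?c z"
        using z D(2) x uv v by auto
      show "E z (?c z)" if "?c z \<noteq> z"
        using z that D(3) v x by (auto split: if_splits)
      show "\<exists>w\<in>insert u (insert v W). w \<noteq> z \<and> ?c w = z" if "?c z = z"
      proof (cases "z = u \<or> z = v \<or> z = x")
        case True then show ?thesis using that uv x v by (intro bexI[of _ v]) (auto split: if_splits)
      next
        case False
        then have "c z = z" "z \<in> W" using that z by auto
        then obtain w where w: "w \<in> W" "w \<noteq> z" "c w = z" using D(4)[of z] by auto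
        moreover have "w \<noteq> u" "w \<noteq> x" using w False x by (auto simp: x_def)
        ultimately show ?thesis using v by (intro bexI[of _ w]) auto
      qed
    qed
    then show ?thesis by blast
  qed
qed

lemma star_forest_exists:
  assumes fin: "finite V" and nb: "\<And>v. v \<in> V \<Longrightarrow> \<exists>u\<in>V. E v u"
  shows "\<exists>c. star_forest V c"
proof -
  let ?P = "\<lambda>W. W \<subseteq> V \<and> (\<exists>c. star_forest W c)"
  have "?P {}" by (simp add: star_forest_def)
  moreover have "\<forall>W. ?P W \<longrightarrow> card W < Suc (card V)" using fin by (simp add: card_mono less_Suc_eq_le)
  ultimately obtain W where W: "?P W" and Wmax: "\<And>U. ?P U \<Longrightarrow> card U \<le> card W"
    using ex_has_greatest_nat[of ?P "{}" card "Suc (card V)"] by auto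
  have "V \<subseteq> W"
  proof
    fix v assume v: "v \<in> V"
    show "v \<in> W"
    proof (rule ccontr)
      assume vW: "v \<notin> W"
      obtain u where u: "u \<in> V" "E v u" using nb v by blast
      then have P: "?P (insert u (insert v W))" using W v vW star_forest_extend by blast
      have "finite (insert u (insert v W))" using W fin finite_subset by blast
      then have "card W < card (insert u (insert v W))" using vW by (intro psubset_card_mono) auto
      then show False using Wmax[OF P] by simp
    qed
  qed
  then show ?thesis using W by auto
qed

end

context special_graph begin

text \<open>
  These are the blocks that occur as a component of the subgraph induced by the centres and lose \<open>t\<close>:
  all vertices have degree \<open>\<Delta>\<close> and all outside neighbours are leaves of the block.
\<close>

definition deficient :: "'a set \<Rightarrow> ('a \<Rightarrow> 'a) \<Rightarrow> 'a set \<Rightarrow> bool" where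
  "deficient V c D \<longleftrightarrow> D \<subseteq> V \<and> conn D \<and> block D \<and>
     (\<forall>x\<in>D. card (nbrs E V x) = \<Delta> \<and> (\<forall>y\<in>V - D. E x y \<longrightarrow> c y = x))"

lemma star_forest_bound:
  assumes fin: "finite V" and sf: "star_forest V c" and deg: "\<And>v. v \<in> V \<Longrightarrow> card (nbrs E V v) \<le> \<Delta>"
  shows "\<exists>S\<subseteq>V. indep E S \<and> (\<forall>v\<in>V - S. \<exists>u\<in>S. E v u) \<and>
    t * real (card V) - t * real (card {D. deficient V c D}) \<le> real (card (V - S))"
proof -
  define X where "X = {v\<in>V. c v = v}"
  define L where "L x = {u\<in>V. u \<noteq> x \<and> c u = x}" for x
  define a where "a x = card (L x)" for x
  note D = star_forestD[OF sf]
  have XV: "X \<subseteq> V" and finX: "finite X" using fin by (auto simp: X_def)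
  have finL: "finite (L x)" for x using fin by (simp add: L_def)
  have LX: "L x \<inter> X = {}" for x by (auto simp: L_def X_def)
  have sub: "nbrs E X x \<union> L x \<subseteq> nbrs E V x" for x
    using D(3) sym by (auto simp: nbrs_def L_def X_def)
  have dis: "nbrs E X x \<inter> L x = {}" for x using LX by (auto simp: nbrs_def)
  have cardU: "card (nbrs E X x \<union> L x) = card (nbrs E X x) + a x" for x
    using finX finL dis by (simp add: card_Un_disjoint a_def)
  have le: "card (nbrs E X x) + a x \<le> card (nbrs E V x)" for x
    using card_mono[OF finite_nbrs[OF fin] sub] cardU by metis
  have a1: "1 \<le> a x" if x: "x \<in> X" for x
  proof -
    have "L x \<noteq> {}" using D(4)[of x] x by (auto simp: X_def L_def)
    then show ?thesis using finL by (simp add: a_def Suc_le_eq card_gt_0_iff)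
  qed
  obtain I where I: "I \<subseteq> X" "indep E I"
    "t * (\<Sum>x\<in>X. 1 + real (a x)) - t * real (card {D. tight_component X a D \<and> block D})
      \<le> real (card X) + (\<Sum>x\<in>I. real (a x) - 1)"
    using weighted_independent_set[of X a] finX a1 le deg XV order_trans by (metis (no_types, lifting) subsetD)
  \<comment> \<open>Equality in the degree bound leaves room for no neighbours except centres and
    own leaves.\<close>
  have tight: "deficient V c D" if T: "tight_component X a D" "block D" for D
  proof -
    have DX: "D \<subseteq> X" "conn D" "closed_in X D" using T by (auto simp: tight_component_def)
    have nb: "nbrs E V x = nbrs E X x \<union> L x \<and> card (nbrs E V x) = \<Delta>" if x: "x \<in> D" for x
    proof -
      have "card (nbrs E X x) + a x = \<Delta>" using T(1) x by (auto simp: tight_component_def)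
      moreover have "card (nbrs E V x) \<le> \<Delta>" using deg DX x XV by blast
      ultimately have "card (nbrs E V x) \<le> card (nbrs E X x \<union> L x)" using cardU[of x] by linarith
      then have "nbrs E X x \<union> L x = nbrs E V x"
        by (intro card_seteq[OF finite_nbrs[OF fin] sub])
      then show ?thesis using cardU[of x] \<open>card (nbrs E X x) + a x = \<Delta>\<close> by simp
    qed
    have "c y = x" if xy: "x \<in> D" "y \<in> V - D" "E x y" for x y
    proof -
      have "y \<in> nbrs E X x \<union> L x" using nb[OF xy(1)] xy by (auto simp: nbrs_def)
      moreover have "y \<notin> nbrs E X x" using DX(3) xy by (auto simp: closed_in_def nbrs_def)
      ultimately show ?thesis by (simp add: L_def)
    qed
    then show ?thesis using nb DX XV T(2) unfolding deficient_def by blast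
  qed
  have "finite {D. deficient V c D}"
    by (rule finite_subset[of _ "Pow V"]) (use fin in \<open>auto simp: deficient_def\<close>)
  then have "card {D. tight_component X a D \<and> block D} \<le> card {D. deficient V c D}"
    using tight by (intro card_mono) auto
  then have B: "t * real (card {D. tight_component X a D \<and> block D}) \<le> t * real (card {D. deficient V c D})"
    using t_coeff_nonneg by (intro mult_left_mono) auto
  have fib: "card {u\<in>V. c u = x} = 1 + a x" if "x \<in> X" for x
  proof -
    have "{u\<in>V. c u = x} = insert x (L x)" using that by (auto simp: X_def L_def)
    then show ?thesis using finL by (simp add: a_def) (simp add: L_def)
  qed
  have "c ` V \<subseteq> X" using D(1,2) by (auto simp: X_def)
  then have "card V = (\<Sum>x\<in>X. card {u\<in>V. c u = x})"
    using sum.group[OF fin finX, of c "\<lambda>_. 1::nat"] by simp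
  also have "\<dots> = (\<Sum>x\<in>X. 1 + a x)" by (rule sum.cong) (simp_all only: fib)
  finally have cardV: "(\<Sum>x\<in>X. 1 + real (a x)) = real (card V)" by simp
  obtain J where J: "I \<subseteq> J" "J \<subseteq> X" "indep E J" "\<And>v. v \<in> X - J \<Longrightarrow> \<exists>u\<in>J. E v u"
    using extend_to_maximal_independent[OF finX I(1,2)] by blast
  obtain S where S: "J \<subseteq> S" "S \<subseteq> V" "indep E S" "\<And>v. v \<in> V - S \<Longrightarrow> \<exists>u\<in>S. E v u"
    using extend_to_maximal_independent[OF fin _ J(3)] J(2) XV by (metis subset_trans)
  have finJ: "finite J" using J finX finite_subset by blast
  \<comment> \<open>\<open>J\<close> is already maximal among the centres, so \<open>S\<close> can
    only add leaves.\<close>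
  have SX: "S \<inter> X = J"
  proof (intro equalityI subsetI)
    fix v assume v: "v \<in> S \<inter> X"
    show "v \<in> J"
    proof (rule ccontr)
      assume "v \<notin> J"
      then obtain u where "u \<in> J" "E v u" using J(4)[of v] v by blast
      then show False using S(1,3) v by (auto simp: indep_def)
    qed
  qed (use S(1) J(2) in auto)
  have "(X - J) \<union> (\<Union>x\<in>J. L x) \<subseteq> V - S"
  proof
    fix y assume "y \<in> (X - J) \<union> (\<Union>x\<in>J. L x)"
    then show "y \<in> V - S"
    proof
      assume "y \<in> X - J" then show ?thesis using SX XV by auto
    next
      assume "y \<in> (\<Union>x\<in>J. L x)"
      then obtain x where x: "x \<in> J" "y \<in> L x" by blast
      then have "E y x" using D(3)[of y] by (auto simp: L_def)
      then show ?thesis using x S by (auto simp: indep_def L_def)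
    qed
  qed
  then have "card ((X - J) \<union> (\<Union>x\<in>J. L x)) \<le> card (V - S)" using fin by (intro card_mono) auto
  moreover have "card ((X - J) \<union> (\<Union>x\<in>J. L x)) = card (X - J) + card (\<Union>x\<in>J. L x)"
    using finX finL finJ LX by (intro card_Un_disjoint) auto
  moreover have "card (\<Union>x\<in>J. L x) = (\<Sum>x\<in>J. a x)"
    unfolding a_def using finJ finL by (intro card_UN_disjoint) (auto simp: L_def)
  moreover have "card X = card (X - J) + card J"
    using card_Diff_subset[OF finJ J(2)] card_mono[OF finX J(2)] by simp
  ultimately have "card X + (\<Sum>x\<in>J. a x) \<le> card (V - S) + card J" by simp
  then have "real (card X + (\<Sum>x\<in>J. a x)) \<le> real (card (V - S) + card J)" by (simp only: of_nat_le_iff)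
  then have "real (card X) + (\<Sum>x\<in>J. real (a x) - 1) \<le> real (card (V - S))"
    by (simp add: sum_subtractf)
  \<comment> \<open>Enlarging \<open>I\<close> to \<open>J\<close> costs nothing, since the weights
    \<open>a x - 1\<close> are non-negative.\<close>
  moreover have "(\<Sum>x\<in>I. real (a x) - 1) \<le> (\<Sum>x\<in>J. real (a x) - 1)"
    using J(1,2) finJ a1 by (intro sum_mono2) fastforce+
  ultimately have "t * real (card V) - t * real (card {D. deficient V c D}) \<le> real (card (V - S))"
    using I(3) B unfolding cardV by linarith
  then show ?thesis using S by blast
qed

lemma block_degree:
  assumes "block D" "x \<in> D" shows "critical (card (nbrs E D x))"
proof (cases "clique E D \<and> critical (card D - 1) \<and> finite D")
  case True
  then show ?thesis using card_nbrs_clique[of E D x] irr assms(2) by (simp add: irreflpI)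
next
  case False
  then obtain n f where D4: "\<Delta> = 4" and nf: "cycle_enum D n f" using assms(1) unfolding block_def by blast
  have n: "3 \<le> n" and bij: "bij_betw f {0..<n} D"
    and adj: "\<And>i j. i < n \<Longrightarrow> j < n \<Longrightarrow> E (f i) (f j) \<longleftrightarrow> j = (i + 1) mod n \<or> i = (j + 1) mod n"
    using nf by (auto simp: cycle_enum_def)
  have img: "D = f ` {0..<n}" and inj: "inj_on f {0..<n}" using bij by (auto simp: bij_betw_def)
  obtain i where i: "i < n" "x = f i" using assms(2) img by auto
  define k where "k = (if i = 0 then n - 1 else i - 1)"
  have k: "k < n" "(k + 1) mod n = i" using i n by (auto simp: k_def)
  have ku: "j = k" if "j < n" "(j + 1) mod n = i" for j
    using that i n by (cases "Suc j < n") (auto simp: k_def not_less le_Suc_eq)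
  have s: "(i + 1) mod n < n" using n by simp
  have sk: "(i + 1) mod n \<noteq> k"
    using i n by (cases "Suc i < n") (auto simp: k_def not_less le_Suc_eq)
  have "nbrs E D x = {f ((i + 1) mod n), f k}"
  proof (intro equalityI subsetI)
    fix y assume "y \<in> nbrs E D x"
    then obtain j where "j < n" "y = f j" "E (f i) (f j)" using i by (auto simp: nbrs_def img)
    then show "y \<in> {f ((i + 1) mod n), f k}" using adj[OF i(1)] ku by blast
  next
    fix y assume "y \<in> {f ((i + 1) mod n), f k}"
    then show "y \<in> nbrs E D x" using adj[OF i(1) s] adj[OF i(1) k(1)] k s i(2) by (auto simp: nbrs_def img)
  qed
  moreover have "f ((i + 1) mod n) \<noteq> f k" using inj_onD[OF inj, of "(i + 1) mod n" k] s k sk by auto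
  ultimately have "card (nbrs E D x) = 2" by simp
  then show ?thesis using D4 unfolding critical_def by simp
qed

text \<open>The degree of \<open>x\<close> inside the block is \<Delta>/2 rounded, so
  \<open>x\<close> has a neighbour outside, and deficiency makes it a leaf of
  \<open>x\<close>.\<close>

lemma deficient_center:
  assumes sf: "star_forest V c" and U: "deficient V c D" and x: "x \<in> D" and fin: "finite V"
  shows "c x = x"
proof -
  have "critical (card (nbrs E D x))" using block_degree U x by (simp add: deficient_def)
  then have "card (nbrs E D x) < \<Delta>" using Delta by (auto simp: critical_def)
  moreover have "card (nbrs E V x) = \<Delta>" using U x by (simp add: deficient_def)
  ultimately have "nbrs E D x \<noteq> nbrs E V x" by auto
  then obtain y where "y \<in> V - D" "E x y" using U by (auto simp: nbrs_def deficient_def)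
  then have "c y = x" "y \<in> V" using U x by (auto simp: deficient_def)
  then show ?thesis using star_forestD(2)[OF sf] by force
qed

end

section \<open>Special vertex sets\<close>

context sgraph begin

text \<open>A form of lying on a cycle that avoids walks and is monotone in \<open>V\<close>;
  \<open>cycle_verts_induce\<close> identifies it with \<open>cycle_verts\<close>.\<close>

definition on_cycle :: "'a set \<Rightarrow> 'a \<Rightarrow> bool" where
  "on_cycle V v \<longleftrightarrow> (\<exists>u\<in>V. \<exists>w\<in>V. u \<noteq> w \<and> E v u \<and> E v w \<and> reach (V - {v}) u w)"

definition cycle_set :: "'a set \<Rightarrow> 'a set" where
  "cycle_set V = {v\<in>V. on_cycle V v}"

lemma on_cycle_mono: "on_cycle U v \<Longrightarrow> U \<subseteq> V \<Longrightarrow> on_cycle V v"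
  unfolding on_cycle_def using reach_mono[of "U - {v}" _ _ "V - {v}"] by blast

text \<open>Cut the path at its last visit to \<open>y\<close>.\<close>

lemma reach_last_exit:
  assumes "reach V y q"
  shows "q = y \<or> (\<exists>z\<in>V - {y}. E y z \<and> reach (V - {y}) z q)"
  using assms unfolding reach_def[of V]
proof (induction rule: rtranclp_induct)
  case (step q r)
  show ?case
  proof (cases "r = y \<or> q = y")
    case True
    then show ?thesis using step.hyps(2) by auto
  next
    case False
    then obtain z where "z \<in> V - {y}" "E y z" "reach (V - {y}) z q" using step.IH by blast
    moreover have "reach (V - {y}) q r" using step.hyps(2) False by (intro reach_step) auto
    ultimately show ?thesis using reach_trans by blast
  qed
qed simp

text \<open>Unlike \<open>cycle_enum\<close> this permits chords, so complete blocks and odd cycles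
  can be treated alike.\<close>

definition hamiltonian :: "'a set \<Rightarrow> nat \<Rightarrow> (nat \<Rightarrow> 'a) \<Rightarrow> bool" where
  "hamiltonian C n f \<longleftrightarrow> 3 \<le> n \<and> bij_betw f {0..<n} C \<and> (\<forall>i<n. E (f i) (f ((i + 1) mod n)))"

lemma hamiltonian_rotate1:
  assumes "hamiltonian C n f"
  shows "hamiltonian C n (\<lambda>i. f ((i + 1) mod n))"
proof -
  have n: "3 \<le> n" and bij: "bij_betw f {0..<n} C" and e: "\<And>i. i < n \<Longrightarrow> E (f i) (f ((i + 1) mod n))"
    using assms by (auto simp: hamiltonian_def)
  have "bij_betw (\<lambda>i. (i + 1) mod n) {0..<n} {0..<n}"
  proof (rule bij_betwI[where g = "\<lambda>i. if i = 0 then n - 1 else i - 1"])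
    fix x assume "x \<in> {0..<n}"
    then show "(if (x + 1) mod n = 0 then n - 1 else (x + 1) mod n - 1) = x"
      by (cases "Suc x < n") (auto simp: not_less le_Suc_eq)
  qed (use n in auto)
  then have "bij_betw (f \<circ> (\<lambda>i. (i + 1) mod n)) {0..<n} C" using bij by (rule bij_betw_trans)
  then show ?thesis using n e unfolding hamiltonian_def by (simp add: o_def)
qed

lemma hamiltonian_rotate:
  assumes "hamiltonian C n f" "k < n"
  shows "\<exists>g. hamiltonian C n g \<and> g (n - 1) = f k"
  using assms
proof (induction k arbitrary: f)
  case 0
  then show ?case
    using hamiltonian_rotate1[OF 0(1)] by (intro exI[of _ "\<lambda>i. f ((i + 1) mod n)"]) simp
next
  case (Suc k)
  from Suc.IH[OF hamiltonian_rotate1[OF Suc.prems(1)]] Suc.prems(2) show ?case by simp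
qed

text \<open>Position \<open>n - 1\<close> matters because the pairings below never use the edge from
  there back to position 0.\<close>

lemma hamiltonian_last:
  assumes "hamiltonian C n f" "x \<in> C"
  shows "\<exists>g. hamiltonian C n g \<and> g (n - 1) = x"
proof -
  have "x \<in> f ` {0..<n}" using assms by (auto simp: hamiltonian_def bij_betw_def)
  then show ?thesis using hamiltonian_rotate[OF assms(1)] by auto
qed

lemma hamiltonian_on_cycle:
  assumes "hamiltonian C n f" "x \<in> C" shows "on_cycle C x"
proof -
  obtain g where g: "hamiltonian C n g" "g (n - 1) = x" using hamiltonian_last[OF assms] by blast
  have n: "3 \<le> n" and img: "g ` {0..<n} = C" and inj: "inj_on g {0..<n}"
    and e: "\<And>i. i < n \<Longrightarrow> E (g i) (g ((i + 1) mod n))"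
    using g by (auto simp: hamiltonian_def bij_betw_def)
  have inC: "g i \<in> C" if "i < n" for i using that img by auto
  have ne: "g i \<noteq> g j" if "i < n" "j < n" "i \<noteq> j" for i j using that inj by (auto dest: inj_onD)
  have "reach (C - {x}) (g 0) (g i)" if "i < n - 1" for i
    using that
  proof (induction i)
    case (Suc i)
    have "E (g i) (g (Suc i))" using e[of i] Suc.prems by simp
    moreover have "g i \<in> C - {x}" "g (Suc i) \<in> C - {x}"
      using Suc.prems inC ne[of _ "n - 1"] g(2) by auto
    ultimately show ?case using Suc reach_trans reach_step by (metis Suc_lessD)
  qed simp
  then have "reach (C - {x}) (g 0) (g (n - 2))" using n by simp
  moreover have "E x (g 0)" using e[of "n - 1"] g(2) n by simp
  moreover have "E x (g (n - 2))"
  proof -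
    have "(n - 2 + 1) mod n = n - 1" using n by (simp add: Suc_diff_Suc)
    then show ?thesis using e[of "n - 2"] g(2) n sym by auto
  qed
  ultimately show ?thesis
    unfolding on_cycle_def using inC[of 0] inC[of "n - 2"] ne[of 0 "n - 2"] n by (intro bexI[of _ "g 0"] bexI[of _ "g (n - 2)"]) auto
qed

end

context special_graph begin

lemma block_hamiltonian:
  assumes "block C" shows "\<exists>n f. hamiltonian C n f"
proof (cases "clique E C \<and> critical (card C - 1) \<and> finite C")
  case True
  then have n: "3 \<le> card C" using critical_ge2[of "card C - 1"] by simp
  obtain f where f: "bij_betw f {0..<card C} C" using True ex_bij_betw_nat_finite by blast
  have "E (f i) (f ((i + 1) mod card C))" if i: "i < card C" for i
  proof -
    have "(i + 1) mod card C \<noteq> i" using i n by (cases "Suc i < card C") (auto simp: not_less le_Suc_eq)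
    moreover have "(i + 1) mod card C < card C" using n by (intro mod_less_divisor) simp
    ultimately have "f ((i + 1) mod card C) \<noteq> f i" "f i \<in> C" "f ((i + 1) mod card C) \<in> C"
      using f i by (auto simp: bij_betw_def dest: inj_onD)
    then show ?thesis using True by (auto simp: clique_def)
  qed
  then show ?thesis using f n unfolding hamiltonian_def by blast
next
  case False
  then obtain n f where "cycle_enum C n f" using assms unfolding block_def by blast
  then have "hamiltonian C n f" by (simp add: cycle_enum_def hamiltonian_def)
  then show ?thesis by blast
qed

text \<open>The conditions of \<open>special\<close> for the subgraph induced by \<open>V\<close>;
  the transfer is \<open>special_set_special\<close>.\<close>

definition special_set :: "'a set \<Rightarrow> bool" where
  "special_set V \<longleftrightarrow> conn V \<and> (\<forall>v\<in>V. on_cycle V v \<longrightarrow> card (nbrs E V v) = \<Delta>) \<and>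
     (\<forall>u\<in>V. \<forall>v\<in>V. E u v \<longrightarrow> on_cycle V u \<or> on_cycle V v) \<and>
     (\<forall>v\<in>cycle_set V. block (component (cycle_set V) v))"

text \<open>By its degree \<open>y\<close> is on no cycle, so its neighbour \<open>u\<close> in the
  given component of \<open>K - {y}\<close> is on a cycle of \<open>K\<close>. That cycle avoids
  \<open>y\<close> and survives in the component. But \<open>u\<close> has lost the neighbour
  \<open>y\<close>, so its degree is now below \<Delta>.\<close>

lemma not_special_set_remove:
  assumes fin: "finite K" and K: "special_set K" and y: "y \<in> K" "card (nbrs E K y) < \<Delta>" and w: "w \<in> K - {y}"
  shows "\<not> special_set (component (K - {y}) w)"
proof
  let ?L = "component (K - {y}) w"
  assume L: "special_set ?L"
  have clL: "closed_in (K - {y}) ?L" by (rule closed_in_component)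
  have LK: "?L \<subseteq> K - {y}" by (rule component_subset)
  have "\<exists>u\<in>?L. E y u"
  proof (rule ccontr)
    assume "\<not> (\<exists>u\<in>?L. E y u)"
    then have "closed_in K ?L" using clL sym unfolding closed_in_def by blast
    then have "?L = K" using K LK component_self[OF w] conn_closed[of K ?L] by (auto simp: special_set_def)
    then show False using LK y by blast
  qed
  then obtain u where u: "u \<in> ?L" "E y u" by blast
  have uK: "u \<in> K" "u \<noteq> y" using u LK by auto
  have ny: "\<not> on_cycle K y" using K y by (auto simp: special_set_def)
  then have cu: "on_cycle K u" using K uK y(1) u(2) by (auto simp: special_set_def)
  then obtain p q where pq: "p \<in> K" "q \<in> K" "p \<noteq> q" "E u p" "E u q" "reach (K - {u}) p q"
    by (auto simp: on_cycle_def)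
  \<comment> \<open>the cycle through \<open>u\<close> avoids \<open>y\<close>, since otherwise \<open>y\<close> would lie on it\<close>
  have sub: "K - {u} - {y} \<subseteq> K - {y}" by auto
  have nopath: False if "reach (K - {u}) y r" "r \<noteq> y" "r \<in> K" "E u r" for r
  proof -
    note h = that
    obtain z where z: "z \<in> K - {u} - {y}" "E y z" "reach (K - {u} - {y}) z r"
      using reach_last_exit[OF h(1)] h(2) by blast
    have "reach (K - {y}) r u" using h uK sym by (intro reach_step) auto
    then have "reach (K - {y}) z u" using reach_mono[OF z(3) sub] reach_trans by blast
    then have "on_cycle K y" unfolding on_cycle_def using z u(2) uK by blast
    then show False using ny by blast
  qed
  have "p \<noteq> y" using nopath[of q] pq by auto
  have "q \<noteq> y" using nopath[of p] pq reach_sym by blast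
  \<comment> \<open>If \<open>p\<close> is reachable from \<open>y\<close>, then
    \<open>nopath\<close> applies; if not, the whole component of \<open>p\<close> in
    \<open>K - {u}\<close> avoids \<open>y\<close>.\<close>
  have "reach (K - {u} - {y}) p q"
  proof (cases "reach (K - {u}) y p")
    case True
    then show ?thesis using nopath[of p] pq \<open>p \<noteq> y\<close> by blast
  next
    case False
    let ?S = "component (K - {u}) p"
    have "p \<noteq> u" using pq irr by auto
    have S: "y \<notin> ?S" using False reach_sym by (auto simp: component_def)
    have "closed_in (K - {u}) ?S" "p \<in> ?S" using closed_in_component component_self pq \<open>p \<noteq> u\<close> by auto
    then have "reach ?S p q" using reach_closed_restrict[OF pq(6) _ component_subset] by blast
    moreover have "?S \<subseteq> K - {u} - {y}" using S component_subset[of "K - {u}" p] by blast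
    ultimately show ?thesis by (rule reach_mono)
  qed
  then have r: "reach (K - {y} - {u}) p q" by (rule reach_mono) auto
  have pqL: "p \<in> ?L" "q \<in> ?L"
    using clL u(1) pq \<open>p \<noteq> y\<close> \<open>q \<noteq> y\<close> by (auto simp: closed_in_def)
  have "reach (?L - {u}) p q"
  proof (rule reach_closed_restrict[OF r])
    show "p \<in> ?L - {u}" using pqL pq irr by auto
    show "?L - {u} \<subseteq> K - {y} - {u}" using LK by auto
    show "closed_in (K - {y} - {u}) (?L - {u})" using clL by (auto simp: closed_in_def)
  qed
  then have "on_cycle ?L u" unfolding on_cycle_def using pq pqL by blast
  then have "card (nbrs E ?L u) = \<Delta>" using L u by (simp add: special_set_def)
  moreover have "card (nbrs E ?L u) < card (nbrs E K u)"
    using LK y(1) u(2) sym fin by (intro psubset_card_mono) (auto simp: nbrs_def)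
  moreover have "card (nbrs E K u) = \<Delta>" using K cu uK by (simp add: special_set_def)
  ultimately show False by simp
qed

text \<open>By \<open>attach\<close> and \<open>one\<close>, a component of \<open>V - C\<close>
  hangs on \<open>C\<close> by a single edge, so no cycle uses both. An attaching vertex is on no
  cycle, because its edge to \<open>C\<close> would push its degree above \<Delta>. So
  \<open>C\<close> is a component of the cycle set of \<open>V\<close>, and the other components
  come from the pieces.\<close>

lemma special_set_join:
  assumes fin: "finite V" and conn: "conn V" and C: "block C" "conn C" "C \<subseteq> V"
    and deg: "\<And>v. v \<in> V \<Longrightarrow> card (nbrs E V v) \<le> \<Delta>"
    and degC: "\<And>x. x \<in> C \<Longrightarrow> card (nbrs E V x) = \<Delta>"
    and one: "\<And>x x' y. x \<in> C \<Longrightarrow> x' \<in> C \<Longrightarrow> y \<in> V - C \<Longrightarrow> E x y \<Longrightarrow> E x' y \<Longrightarrow> x = x'"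
    and comps: "\<And>v. v \<in> V - C \<Longrightarrow> special_set (component (V - C) v)"
    and attach: "\<And>y y' x x'. y \<in> V - C \<Longrightarrow> y' \<in> component (V - C) y \<Longrightarrow> x \<in> C \<Longrightarrow> x' \<in> C \<Longrightarrow> E x y \<Longrightarrow> E x' y' \<Longrightarrow> y = y'"
  shows "special_set V"
proof -
  let ?K = "component (V - C)"
  have KV: "?K v \<subseteq> V - C" for v by (rule component_subset)
  have clK: "closed_in (V - C) (?K v)" for v by (rule closed_in_component)
  have Keq: "?K u = ?K v" if "u \<in> ?K v" "v \<in> V - C" for u v using component_eq that by blast
  have att: "y = y'" if "y \<in> ?K v" "y' \<in> ?K v" "v \<in> V - C" "x \<in> C" "x' \<in> C" "E x y" "E x' y'" for v y y' x x'
    using attach[of y y' x x'] that Keq[of y v] KV[of v] by auto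
  have leave: "z' \<in> C" if "z \<in> ?K v" "z' \<in> V - ?K v" "E z z'" for z z' v
    using clK[of v] that by (auto simp: closed_in_def)
  have a: "on_cycle (?K v) v" if v: "v \<in> V - C" "on_cycle V v" for v
  proof -
    obtain u w where uw: "u \<in> V" "w \<in> V" "u \<noteq> w" "E v u" "E v w" "reach (V - {v}) u w"
      using v by (auto simp: on_cycle_def)
    have vK: "v \<in> ?K v" using v component_self by blast
    have uwv: "u \<noteq> v" "w \<noteq> v" using uw irr by auto
    show ?thesis
    proof (cases "\<exists>x\<in>C. E x v")
      case True
      then obtain x where x: "x \<in> C" "E x v" by blast
      \<comment> \<open>Here \<open>v\<close> is the attaching vertex, and without it the rest of
        its piece is cut off from \<open>C\<close>. Both cycle neighbours of \<open>v\<close> thus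
        lie on the same side, and by \<open>one\<close> not in \<open>C\<close>.\<close>
      have cl: "closed_in (V - {v}) (?K v - {v})"
        unfolding closed_in_def
      proof (intro ballI impI)
        fix z z' assume z: "z \<in> ?K v - {v}" "z' \<in> V - {v}" "E z z'"
        show "z' \<in> ?K v - {v}"
        proof (rule ccontr)
          assume "z' \<notin> ?K v - {v}"
          then have "z' \<in> C" using leave[of z v z'] z by auto
          then show False using att[of z v v z' x] z vK v x sym by blast
        qed
      qed
      have inC: "r \<in> ?K v - {v} \<or> r \<in> C" if "r = u \<or> r = w" for r
        using that uw uwv leave[of v v] vK by blast
      have "u \<in> ?K v - {v} \<and> w \<in> ?K v - {v}"
      proof (rule ccontr)
        assume "\<not> ?thesis"
        then have "u \<notin> ?K v - {v} \<and> w \<notin> ?K v - {v}"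
          using reach_closed[OF uw(6) _ cl] reach_closed[OF reach_sym[OF uw(6)] _ cl] by blast
        then have "u \<in> C" "w \<in> C" using inC by blast+
        then show False using one[of u w v] v uw sym by blast
      qed
      moreover from this have "reach (?K v - {v}) u w"
        using KV by (intro reach_closed_restrict[OF uw(6) _ _ cl]) auto
      ultimately show ?thesis unfolding on_cycle_def using uw by blast
    next
      case False
      then have uwK: "u \<in> ?K v" "w \<in> ?K v" using uw leave[of v v] vK sym by blast+
      \<comment> \<open>A detour outside the piece leaves and returns through the same attaching
        vertex \<open>y\<close>, so it can be cut out. While the path is outside, the invariant
        remembers that \<open>y\<close> was reached.\<close>
      have "(r \<in> ?K v \<longrightarrow> reach (?K v - {v}) u r) \<and>
          (r \<notin> ?K v \<longrightarrow> (\<exists>y\<in>?K v. (\<exists>x\<in>C. E x y) \<and> reach (?K v - {v}) u y))" if "reach (V - {v}) u r" for r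
        using that unfolding reach_def[of "V - {v}"]
      proof (induction rule: rtranclp_induct)
        case base
        then show ?case using uwK by simp
      next
        case (step r s)
        have rs: "r \<in> V" "s \<in> V" "r \<noteq> v" "s \<noteq> v" "E r s" using step.hyps(2) by auto
        consider "r \<in> ?K v" "s \<in> ?K v" | "r \<in> ?K v" "s \<notin> ?K v" | "r \<notin> ?K v" "s \<in> ?K v" | "r \<notin> ?K v" "s \<notin> ?K v" by blast
        then show ?case
        proof cases
          case 1
          then have "reach (?K v - {v}) r s" using rs by (intro reach_step) auto
          then show ?thesis using 1 step.IH reach_trans by blast
        next
          case 2
          then have "s \<in> C" using leave rs by blast
          then show ?thesis using 2 step.IH sym[OF rs(5)] by blast
        next
          case 3
          then have rC: "r \<in> C" using leave[of s v r] rs sym by blast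
          obtain y x where y: "y \<in> ?K v" "x \<in> C" "E x y" "reach (?K v - {v}) u y" using 3 step.IH by blast
          then have "y = s" using att[OF y(1) 3(2) v(1) y(2) rC y(3) rs(5)] by simp
          then show ?thesis using y 3 by blast
        next
          case 4
          then show ?thesis using step.IH by blast
        qed
      qed
      then have "reach (?K v - {v}) u w" using uw uwK by blast
      then show ?thesis unfolding on_cycle_def using uw uwK by blast
    qed
  qed
  have b: "on_cycle V v" if "on_cycle (?K v) v" for v using on_cycle_mono[OF that] KV by blast
  have c: "\<not> on_cycle V y" if y: "y \<in> V - C" "x \<in> C" "E x y" for x y
  proof
    assume "on_cycle V y"
    then have "card (nbrs E (?K y) y) = \<Delta>"
      using a[OF y(1)] comps[OF y(1)] component_self[OF y(1)] by (simp add: special_set_def)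
    moreover have "card (nbrs E (?K y) y) < card (nbrs E V y)"
      using KV[of y] y C(3) sym fin by (intro psubset_card_mono) (auto simp: nbrs_def)
    ultimately show False using deg[of y] y by simp
  qed
  have d: "on_cycle V x" if x: "x \<in> C" for x
    using block_hamiltonian[OF C(1)] hamiltonian_on_cycle x on_cycle_mono C(3) by blast
  have deg1: "card (nbrs E V v) = \<Delta>" if v: "v \<in> V" "on_cycle V v" for v
  proof (cases "v \<in> C")
    case True then show ?thesis using degC by simp
  next
    case False
    then have v': "v \<in> V - C" using v by simp
    then have "card (nbrs E (?K v) v) = \<Delta>"
      using a[OF v' v(2)] comps[OF v'] component_self[OF v'] by (simp add: special_set_def)
    moreover have "card (nbrs E (?K v) v) \<le> card (nbrs E V v)"
      using KV fin by (intro card_mono nbrs_mono) auto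
    ultimately show ?thesis using deg[OF v(1)] by simp
  qed
  have edge: "on_cycle V u \<or> on_cycle V v" if uv: "u \<in> V" "v \<in> V" "E u v" for u v
  proof (cases "u \<in> C \<or> v \<in> C")
    case True then show ?thesis using d by blast
  next
    case False
    then have u: "u \<in> V - C" and v: "v \<in> V - C" using uv by auto
    have vK: "v \<in> ?K u" using leave[of u u v] component_self[OF u] uv False by blast
    then have "on_cycle (?K u) u \<or> on_cycle (?K u) v"
      using comps[OF u] component_self[OF u] uv by (simp add: special_set_def)
    then show ?thesis using b Keq[OF vK u] by metis
  qed
  let ?Z = "cycle_set V"
  have blocks: "block (component ?Z v)" if v: "v \<in> ?Z" for v
  proof (cases "v \<in> C")
    case True
    have "component ?Z v = C"
    proof (rule component_eqI[OF C(2) _ _ True])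
      show "C \<subseteq> ?Z" using C(3) d by (auto simp: cycle_set_def)
      show "closed_in ?Z C" using c by (auto simp: closed_in_def cycle_set_def)
    qed
    then show ?thesis using C by simp
  next
    case False
    then have v': "v \<in> V - C" and vc: "on_cycle V v" using v by (auto simp: cycle_set_def)
    let ?Y = "cycle_set (?K v)"
    have vY: "v \<in> ?Y" using a[OF v' vc] component_self[OF v'] by (simp add: cycle_set_def)
    have YZ: "?Y \<subseteq> ?Z" using KV[of v] on_cycle_mono[of "?K v" _ V] by (auto simp: cycle_set_def)
    have "component ?Z v = component ?Y v"
    proof (rule component_eqI[OF conn_component[OF vY] _ _ component_self[OF vY]])
      show "component ?Y v \<subseteq> ?Z" using component_subset YZ by blast
      show "closed_in ?Z (component ?Y v)" unfolding closed_in_def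
      proof (intro ballI impI)
        fix x y assume xy: "x \<in> component ?Y v" "y \<in> ?Z" "E x y"
        have x: "x \<in> ?K v" "x \<in> ?Z" using xy(1) component_subset[of ?Y v] YZ by (auto simp: cycle_set_def)
        have y: "y \<in> V" "on_cycle V y" using xy by (auto simp: cycle_set_def)
        have "y \<notin> C" using c[of x y] x KV sym xy(3) by (auto simp: cycle_set_def)
        then have yK: "y \<in> ?K v" using leave[of x v y] x y xy by blast
        then have "on_cycle (?K v) y" using a[of y] y \<open>y \<notin> C\<close> Keq[OF yK v'] by simp
        then have "y \<in> ?Y" using yK by (simp add: cycle_set_def)
        then show "y \<in> component ?Y v" using closed_in_component[of ?Y v] xy by (auto simp: closed_in_def)
      qed
    qed
    then show ?thesis using comps[OF v'] vY by (simp add: special_set_def)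
  qed
  show ?thesis unfolding special_set_def using conn deg1 edge blocks by blast
qed

end

section \<open>Star forests with few deficient blocks\<close>

text \<open>
  Walking along a Hamiltonian cycle of a block, where \<open>b i\<close> says that the \<open>i\<close>-th vertex must remain a
  centre, \<open>starts b i\<close> says that the \<open>i\<close>-th vertex becomes a leaf of its successor. In the resulting
  star forest no vertex is a leaf of its predecessor, so a deficient block that meets this block is
  closed under successors.
\<close>

primrec starts :: "(nat \<Rightarrow> bool) \<Rightarrow> nat \<Rightarrow> bool" where
  "starts b 0 \<longleftrightarrow> \<not> b 0"
| "starts b (Suc i) \<longleftrightarrow> \<not> b (Suc i) \<and> \<not> starts b i"

lemma starts_not: "b i \<Longrightarrow> \<not> starts b i"
  by (cases i) auto

lemma starts_even: "(\<And>j. j \<le> i \<Longrightarrow> \<not> b j) \<Longrightarrow> starts b i \<longleftrightarrow> even i"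
  by (induction i) auto

context sgraph begin

text \<open>Forced centres may end up without a leaf here, because they receive one from outside the
  block. The condition on \<open>n - 1\<close> ensures that the successor of a leaf never wraps
  around to position 0.\<close>

lemma hamiltonian_pairing:
  assumes ham: "hamiltonian C n f" and last: "\<not> starts b (n - 1)"
  shows "\<exists>h. (\<forall>i<n. h (f i) = f (if starts b i then i + 1 else i)) \<and>
    (\<forall>x\<in>C. h x \<in> C \<and> h (h x) = h x \<and> (h x \<noteq> x \<longrightarrow> E x (h x))) \<and>
    (\<forall>i<n. \<not> b i \<longrightarrow> h (f i) = f i \<longrightarrow> (\<exists>u\<in>C. u \<noteq> f i \<and> h u = f i)) \<and>
    (\<forall>i<n. h (f ((i + 1) mod n)) \<noteq> f i)"
proof -
  have n: "3 \<le> n" and img: "f ` {0..<n} = C" and inj: "inj_on f {0..<n}"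
    and e: "\<And>i. i < n \<Longrightarrow> E (f i) (f ((i + 1) mod n))"
    using ham by (auto simp: hamiltonian_def bij_betw_def)
  have feq: "f i = f j \<longleftrightarrow> i = j" if "i < n" "j < n" for i j using that inj by (auto dest: inj_onD)
  have inC: "f i \<in> C" if "i < n" for i using that img by auto
  define h where "h v = f (let i = the_inv_into {0..<n} f v in if starts b i then i + 1 else i)" for v
  have h: "h (f i) = f (if starts b i then i + 1 else i)" if "i < n" for i
    using that the_inv_into_f_f[OF inj, of i] by (simp add: h_def Let_def)
  have lt: "i + 1 < n" if "starts b i" "i < n" for i
  proof -
    have "i \<noteq> n - 1" using that last by auto
    then show ?thesis using that by simp
  qed
  have idx: "\<exists>i<n. x = f i" if "x \<in> C" for x using that img by auto
  have 1: "h x \<in> C \<and> h (h x) = h x \<and> (h x \<noteq> x \<longrightarrow> E x (h x))" if x: "x \<in> C" for x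
  proof -
    obtain i where i: "i < n" "x = f i" using idx[OF x] by blast
    show ?thesis
    proof (cases "starts b i")
      case True
      have "h x = f (i + 1)" using h[OF i(1)] i True by simp
      moreover have "h (f (i + 1)) = f (i + 1)" using h[OF lt[OF True i(1)]] True by simp
      moreover have "E x (f (i + 1))" using e[OF i(1)] lt[OF True i(1)] i by simp
      ultimately show ?thesis using inC[OF lt[OF True i(1)]] by simp
    next
      case False
      then have "h x = x" using h[OF i(1)] i by simp
      then show ?thesis using x by simp
    qed
  qed
  have 2: "\<exists>u\<in>C. u \<noteq> f i \<and> h u = f i" if i: "i < n" "\<not> b i" "h (f i) = f i" for i
  proof -
    have "\<not> starts b i"
    proof
      assume s: "starts b i"
      then have "f (i + 1) = f i" using h[OF i(1)] i(3) by simp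
      then show False using feq lt[OF s i(1)] i(1) by simp
    qed
    \<comment> \<open>A vertex that is not forced fails to start only because its predecessor
      starts, and this predecessor is its leaf.\<close>
    then obtain k where k: "i = Suc k" "starts b k" using i(2) by (cases i) auto
    then have "h (f k) = f i" "f k \<noteq> f i" using h[of k] i(1) feq by auto
    then show ?thesis using inC[of k] k i(1) by auto
  qed
  have 3: "h (f ((i + 1) mod n)) \<noteq> f i" if i: "i < n" for i
  proof
    assume a: "h (f ((i + 1) mod n)) = f i"
    define j where "j = (i + 1) mod n"
    have j: "j < n" using n by (simp add: j_def)
    have ji: "j = i + 1 \<or> (i = n - 1 \<and> j = 0)"
      using i by (cases "Suc i < n") (auto simp: j_def not_less le_Suc_eq)
    show False
    proof (cases "starts b j")
      case True
      then have "f (j + 1) = f i" using h[OF j] a by (simp add: j_def)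
      then have "j + 1 = i" using feq lt[OF True j] i by simp
      then show False using ji n by auto
    next
      case False
      then have "f j = f i" using h[OF j] a by (simp add: j_def)
      then have "j = i" using feq i j by simp
      then show False using ji n by auto
    qed
  qed
  show ?thesis using h 1 2 3 by blast
qed

text \<open>The second alternative for \<open>h\<close> lets a vertex of \<open>C\<close> join a
  star of \<open>W\<close>; the odd case needs it to send \<open>p\<close> to
  \<open>q\<close>.\<close>

lemma star_forest_glue:
  assumes g: "star_forest W g" and dis: "C \<inter> Y = {}" "C \<inter> W = {}" "Y \<inter> W = {}"
    and \<pi>: "\<And>y. y \<in> Y \<Longrightarrow> \<pi> y \<in> C \<and> E (\<pi> y) y \<and> h (\<pi> y) = \<pi> y"
    and h: "\<And>x. x \<in> C \<Longrightarrow> (h x \<in> C \<and> h (h x) = h x) \<or> (h x \<in> W \<and> g (h x) = h x)"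
    and hE: "\<And>x. x \<in> C \<Longrightarrow> h x \<noteq> x \<Longrightarrow> E x (h x)"
    and hc: "\<And>x. x \<in> C \<Longrightarrow> h x = x \<Longrightarrow> (\<exists>u\<in>C. u \<noteq> x \<and> h u = x) \<or> (\<exists>y\<in>Y. \<pi> y = x)"
  shows "star_forest (C \<union> Y \<union> W) (\<lambda>v. if v \<in> C then h v else if v \<in> Y then \<pi> v else g v)"
    (is "star_forest ?V ?c")
proof (rule star_forestI)
  note D = star_forestD[OF g]
  fix v assume v: "v \<in> ?V"
  consider "v \<in> C" | "v \<in> Y" "v \<notin> C" | "v \<in> W" "v \<notin> C" "v \<notin> Y" using v dis by blast
  note cs = this
  show "?c v \<in> ?V" using cs h \<pi> D(1) by cases auto
  show "?c (?c v) = ?c v"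
  proof (rule cs)
    assume "v \<in> C"
    then show ?thesis using h[of v] dis by auto
  next
    assume "v \<in> Y" "v \<notin> C"
    then show ?thesis using \<pi>[of v] by auto
  next
    assume "v \<in> W" "v \<notin> C" "v \<notin> Y"
    then show ?thesis using D(1,2)[of v] dis by auto
  qed
  show "E v (?c v)" if "?c v \<noteq> v" using cs that hE \<pi> D(3) sym by cases auto
  show "\<exists>u\<in>?V. u \<noteq> v \<and> ?c u = v" if cv: "?c v = v"
  proof (rule cs)
    assume vC: "v \<in> C"
    then have "(\<exists>u\<in>C. u \<noteq> v \<and> h u = v) \<or> (\<exists>y\<in>Y. \<pi> y = v)" using hc[of v] cv by simp
    then show ?thesis
    proof
      assume "\<exists>u\<in>C. u \<noteq> v \<and> h u = v"
      then obtain u where "u \<in> C" "u \<noteq> v" "h u = v" by blast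
      then show ?thesis by (intro bexI[of _ u]) auto
    next
      assume "\<exists>y\<in>Y. \<pi> y = v"
      then obtain y where "y \<in> Y" "\<pi> y = v" by blast
      moreover from this have "y \<notin> C" "y \<noteq> v" using dis vC by auto
      ultimately show ?thesis by (intro bexI[of _ y]) auto
    qed
  next
    assume "v \<in> Y" "v \<notin> C"
    then show ?thesis using \<pi>[of v] cv by auto
  next
    assume w: "v \<in> W" "v \<notin> C" "v \<notin> Y"
    then obtain u where "u \<in> W" "u \<noteq> v" "g u = v" using D(4)[of v] cv by auto
    moreover from this have "u \<notin> C" "u \<notin> Y" using dis by auto
    ultimately show ?thesis by (intro bexI[of _ u]) auto
  qed
qed

end

section \<open>Private blocks and what surrounds them\<close>

context special_graph begin

text \<open>What deficiency implies for the graph alone, without reference to a star forest: a leaf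
  has only one centre, so an outside vertex sees the block at most once.\<close>

definition private_block :: "'a set \<Rightarrow> 'a set \<Rightarrow> bool" where
  "private_block V C \<longleftrightarrow> C \<subseteq> V \<and> conn C \<and> block C \<and> (\<forall>x\<in>C. card (nbrs E V x) = \<Delta>) \<and>
     (\<forall>x\<in>C. \<forall>x'\<in>C. \<forall>y\<in>V - C. E x y \<longrightarrow> E x' y \<longrightarrow> x = x')"

lemma deficient_private_block: "deficient V c D \<Longrightarrow> private_block V D"
  unfolding deficient_def private_block_def by metis

text \<open>Consider an edge from \<open>x \<in> C\<close> to \<open>w \<in> D - C\<close>. In a
  complete \<open>D\<close>, the vertex \<open>w\<close> would see two vertices of \<open>C\<close>;
  in a cycle \<open>D\<close>, both neighbours of \<open>x\<close> are already in
  \<open>C\<close>.\<close>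

lemma block_maximal:
  assumes C: "private_block V C" and D: "conn D" "block D" "C \<subseteq> D" "D \<subseteq> V"
  shows "D = C"
proof (rule ccontr)
  assume ne: "D \<noteq> C"
  have "C \<noteq> {}" using C by (auto simp: private_block_def conn_def)
  then have "\<not> closed_in D C" using conn_closed[OF D(1,3)] ne by blast
  then obtain x w where xw: "x \<in> C" "w \<in> D" "w \<notin> C" "E x w" by (auto simp: closed_in_def)
  have bC: "block C" using C by (simp add: private_block_def)
  have degC: "2 \<le> card (nbrs E C x)" using critical_ge2 block_degree[OF bC xw(1)] by blast
  then have "nbrs E C x \<noteq> {}" by auto
  then obtain x' where x': "x' \<in> C" "x' \<noteq> x" using irr by (auto simp: nbrs_def)
  show False
  proof (cases "clique E D \<and> critical (card D - 1) \<and> finite D")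
    case True
    then have "E x' w" using x' xw D(3) by (auto simp: clique_def)
    then show False using C x' xw D(4) unfolding private_block_def by blast
  next
    case False
    then have D4: "\<Delta> = 4" and "\<exists>n f. cycle_enum D n f" using D(2) unfolding block_def by blast+
    then have finD: "finite D" unfolding cycle_enum_def by (metis bij_betw_finite finite_atLeastLessThan)
    have "critical (card (nbrs E D x))" using block_degree[OF D(2)] xw(1) D(3) by blast
    then have "card (nbrs E D x) = 2" using D4 unfolding critical_def by simp
    moreover have "card (nbrs E C x) < card (nbrs E D x)"
      using D(3) xw finD by (intro psubset_card_mono) (auto simp: nbrs_def)
    ultimately show False using degC by simp
  qed
qed

text \<open>The members of \<open>D\<close> are centres, so \<open>D\<close> avoids
  \<open>Y\<close>. An outside neighbour of \<open>D\<close> has its centre in \<open>D\<close>,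
  which excludes \<open>C\<close> and \<open>Y\<close>. So \<open>D\<close> and all its neighbours
  lie in \<open>W\<close>.\<close>

lemma deficient_restrict:
  assumes fin: "finite V" and sf: "star_forest V c" and U: "deficient V c D"
    and V: "V = C \<union> Y \<union> W" "C \<inter> Y = {}" "C \<inter> W = {}" "Y \<inter> W = {}"
    and cY: "\<And>y. y \<in> Y \<Longrightarrow> c y \<in> C" and cW: "\<And>w. w \<in> W \<Longrightarrow> c w = g w"
    and D: "D \<inter> C = {}" "\<And>z. z \<in> C \<Longrightarrow> c z \<notin> D"
  shows "deficient W g D"
proof -
  have cD: "c x = x" if "x \<in> D" for x using deficient_center[OF sf U that fin] .
  have "D \<inter> Y = {}" using cD cY V by fastforce
  then have DW: "D \<subseteq> W" using U V D by (auto simp: deficient_def)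
  have nW: "y \<in> W" if "x \<in> D" "y \<in> V" "E x y" for x y
  proof (cases "y \<in> D")
    case False
    then have "c y = x" using U that by (auto simp: deficient_def)
    then have "y \<notin> C" "y \<notin> Y" using D that(1) cY by auto
    then show ?thesis using that V by auto
  qed (use DW in auto)
  have "nbrs E V x = nbrs E W x" if "x \<in> D" for x
    using nW[OF that] V(1) by (auto simp: nbrs_def)
  moreover have "g y = x" if "x \<in> D" "y \<in> W - D" "E x y" for x y
    using U that V(1) cW[of y] by (auto simp: deficient_def)
  ultimately show ?thesis using U DW unfolding deficient_def by auto
qed

lemma star_forest_union:
  assumes "\<And>w. w \<in> W \<Longrightarrow> \<exists>g. star_forest (component W w) g \<and> (\<forall>D. \<not> deficient (component W w) g D)"
  shows "\<exists>g. star_forest W g \<and> (\<forall>D. \<not> deficient W g D)"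
proof -
  let ?K = "component W"
  have KW: "?K w \<subseteq> W" for w by (rule component_subset)
  have Keq: "?K u = ?K w" if "u \<in> ?K w" "w \<in> W" for u w using component_eq that by blast
  have self: "w \<in> ?K w" if "w \<in> W" for w using component_self that by blast
  have "\<exists>G. \<forall>K\<in>?K ` W. star_forest K (G K) \<and> (\<forall>D. \<not> deficient K (G K) D)"
    using assms by (intro bchoice) blast
  then obtain G where G: "\<And>w. w \<in> W \<Longrightarrow> star_forest (?K w) (G (?K w))"
    and Gc: "\<And>w D. w \<in> W \<Longrightarrow> \<not> deficient (?K w) (G (?K w)) D" by blast
  define g where "g w = G (?K w) w" for w
  have gK: "g u = G (?K w) u" if "u \<in> ?K w" "w \<in> W" for u w using Keq[OF that] by (simp add: g_def)
  have "star_forest W g"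
  proof (rule star_forestI)
    fix w assume w: "w \<in> W"
    note D = star_forestD[OF G[OF w] self[OF w]]
    have gw: "g w = G (?K w) w" by (simp add: g_def)
    show "g w \<in> W" using D(1) KW[of w] gw by auto
    show "g (g w) = g w" using gK[OF D(1) w] D(2) gw by simp
    show "E w (g w)" if "g w \<noteq> w" using D(3) that gw by simp
    show "\<exists>u\<in>W. u \<noteq> w \<and> g u = w" if "g w = w"
      using D(4) that gw gK[OF _ w] KW[of w] by (metis subsetD)
  qed
  moreover have "\<not> deficient W g D" for D
  proof
    assume U: "deficient W g D"
    then obtain x where x: "x \<in> D" "x \<in> W" by (auto simp: deficient_def conn_def)
    have DK: "D \<subseteq> ?K x"
    proof
      fix y assume y: "y \<in> D"
      then have "reach D x y" using U x by (auto simp: deficient_def conn_def)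
      then have "reach W x y" using U by (elim reach_mono) (auto simp: deficient_def)
      then show "y \<in> ?K x" using y U by (auto simp: component_def deficient_def)
    qed
    have "nbrs E (?K x) z = nbrs E W z" if "z \<in> D" for z
      using closed_in_component[of W x] DK that KW[of x] by (auto simp: nbrs_def closed_in_def)
    then have "deficient (?K x) (G (?K x)) D"
      using U DK KW[of x] gK[OF _ x(2)] unfolding deficient_def by (metis DiffE DiffI subsetD)
    then show False using Gc x by blast
  qed
  ultimately show ?thesis by blast
qed

text \<open>
  \<open>Y\<close> contains one neighbour of \<open>C\<close> from each special component of \<open>V - C\<close>. These become leaves of \<open>C\<close>,
  and what remains of \<open>V - C\<close> has no special component.
\<close>

lemma private_block_decomposition:
  assumes fin: "finite V" and conn: "conn V" and private_block: "private_block V C"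
    and deg: "\<And>v. v \<in> V \<Longrightarrow> card (nbrs E V v) \<le> \<Delta>"
    and IH: "\<And>K. K \<subset> V \<Longrightarrow> conn K \<Longrightarrow> \<not> special_set K \<Longrightarrow> \<exists>g. star_forest K g \<and> (\<forall>D. \<not> deficient K g D)"
  shows "\<exists>Y \<pi> g. Y \<subseteq> V - C \<and> (\<forall>y\<in>Y. \<pi> y \<in> C \<and> E (\<pi> y) y) \<and>
    star_forest (V - C - Y) g \<and> (\<forall>D. \<not> deficient (V - C - Y) g D) \<and>
    ((\<forall>y\<in>V - C. (\<exists>x\<in>C. E x y) \<longrightarrow> y \<in> Y) \<longrightarrow> special_set V)"
proof -
  let ?K = "component (V - C)"
  have CV: "C \<subseteq> V" and neC: "C \<noteq> {}" using private_block by (auto simp: private_block_def conn_def)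
  have KV: "?K v \<subseteq> V - C" for v by (rule component_subset)
  have Keq: "?K u = ?K v" if "u \<in> ?K v" "v \<in> V - C" for u v using component_eq that by blast
  have self: "v \<in> ?K v" if "v \<in> V - C" for v using component_self that by blast
  define att where "att y \<longleftrightarrow> (\<exists>x\<in>C. E x y)" for y
  have ex: "\<exists>y\<in>?K v. att y" if v: "v \<in> V - C" for v
  proof (rule ccontr)
    assume "\<not> ?thesis"
    then have "closed_in V (?K v)"
      using closed_in_component[of "V - C" v] sym unfolding closed_in_def att_def by blast
    then have "?K v = V" using conn_closed[OF conn] KV[of v] self[OF v] by blast
    then show False using KV[of v] CV neC by blast
  qed
  \<comment> \<open>The choice depends on the component alone, so two members of \<open>Y\<close> in
    the same component coincide.\<close>
  define rep where "rep K = (SOME y. y \<in> K \<and> att y)" for K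
  have rep: "rep (?K v) \<in> ?K v" "att (rep (?K v))" if "v \<in> V - C" for v
    using someI_ex[of "\<lambda>y. y \<in> ?K v \<and> att y"] ex[OF that] unfolding rep_def by blast+
  define Y where "Y = {rep (?K v) | v. v \<in> V - C \<and> special_set (?K v)}"
  have YI: "rep (?K v) \<in> Y" if "v \<in> V - C" "special_set (?K v)" for v using that by (auto simp: Y_def)
  have Yv: "y \<in> V - C" "special_set (?K y)" "y = rep (?K y)" "att y" if "y \<in> Y" for y
  proof -
    note yY = that
    obtain v where v: "v \<in> V - C" "special_set (?K v)" "y = rep (?K v)" using yY unfolding Y_def by blast
    have yK: "y \<in> ?K v" using rep[OF v(1)] v(3) by simp
    show "y \<in> V - C" using yK KV by blast
    show "special_set (?K y)" "y = rep (?K y)" using Keq[OF yK v(1)] v by simp_all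
    show "att y" using rep[OF v(1)] v(3) by simp
  qed
  define \<pi> where "\<pi> y = (SOME x. x \<in> C \<and> E x y)" for y
  have \<pi>: "\<pi> y \<in> C \<and> E (\<pi> y) y" if "y \<in> Y" for y
    using Yv(4)[OF that] someI_ex[of "\<lambda>x. x \<in> C \<and> E x y"] unfolding \<pi>_def att_def by blast
  let ?W = "V - C - Y"
  \<comment> \<open>A special component loses its representative, whose degree inside the component
    is below \<Delta> because it has a neighbour in \<open>C\<close>; so none of the remaining
    pieces is special.\<close>
  have nspec: "\<not> special_set (component ?W w)" if w: "w \<in> ?W" for w
  proof -
    have wV: "w \<in> V - C" using w by blast
    show ?thesis
    proof (cases "special_set (?K w)")
      case False
      have "?K w \<inter> Y = {}"
      proof (rule ccontr)
        assume "?K w \<inter> Y \<noteq> {}"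
        then obtain y where y: "y \<in> ?K w" "y \<in> Y" by blast
        then show False using Yv(2)[OF y(2)] Keq[OF y(1) wV] False by simp
      qed
      then have "component ?W w = ?K w"
        using conn_component[OF wV] KV[of w] closed_in_component[of "V - C" w] self[OF wV]
        by (intro component_eqI) (auto simp: closed_in_def)
      then show ?thesis using False by simp
    next
      case True
      define y where "y = rep (?K w)"
      have y: "y \<in> ?K w" "att y" "y \<in> Y" using rep[OF wV] YI[OF wV True] by (simp_all add: y_def)
      have wy: "w \<in> ?K w - {y}" using w y(3) self[OF wV] by blast
      have only: "z = y" if "z \<in> ?K w" "z \<in> Y" for z
        using Yv(3)[OF that(2)] Keq[OF that(1) wV] by (simp add: y_def)
      have "component ?W w = component (?K w - {y}) w"
      proof (rule component_eqI[OF conn_component[OF wy] _ _ component_self[OF wy]])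
        show "component (?K w - {y}) w \<subseteq> ?W" using component_subset[of "?K w - {y}" w] KV[of w] only by blast
        show "closed_in ?W (component (?K w - {y}) w)" unfolding closed_in_def
        proof (intro ballI impI)
          fix x z assume xz: "x \<in> component (?K w - {y}) w" "z \<in> ?W" "E x z"
          have "x \<in> ?K w" using xz(1) component_subset by blast
          then have "z \<in> ?K w" using closed_in_component[of "V - C" w] xz by (auto simp: closed_in_def)
          moreover have "z \<noteq> y" using xz(2) y(3) by blast
          ultimately show "z \<in> component (?K w - {y}) w"
            using closed_in_component[of "?K w - {y}" w] xz by (auto simp: closed_in_def)
        qed
      qed
      moreover have "card (nbrs E (?K w) y) < \<Delta>"
      proof -
        have yV: "y \<in> V" using y(1) KV[of w] by blast
        have "nbrs E (?K w) y \<subset> nbrs E V y"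
          using KV[of w] y(2) CV sym unfolding nbrs_def att_def by blast
        then have "card (nbrs E (?K w) y) < card (nbrs E V y)" using fin by (intro psubset_card_mono) auto
        then show ?thesis using deg[OF yV] by simp
      qed
      ultimately show ?thesis
        using not_special_set_remove[OF _ True y(1) _ wy] finite_subset[OF KV, of w] fin by simp
    qed
  qed
  have "\<exists>g. star_forest ?W g \<and> (\<forall>D. \<not> deficient ?W g D)"
  proof (rule star_forest_union)
    fix w assume w: "w \<in> ?W"
    have "component ?W w \<subset> V" using component_subset[of ?W w] neC CV by blast
    then show "\<exists>g. star_forest (component ?W w) g \<and> (\<forall>D. \<not> deficient (component ?W w) g D)"
      using IH conn_component[OF w] nspec[OF w] by blast
  qed
  then obtain g where g: "star_forest ?W g" "\<forall>D. \<not> deficient ?W g D" by blast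
  have "special_set V" if all: "\<forall>y\<in>V - C. (\<exists>x\<in>C. E x y) \<longrightarrow> y \<in> Y"
  proof (rule special_set_join[OF fin conn _ _ CV deg])
    show "block C" "conn C" using private_block by (auto simp: private_block_def)
    show "card (nbrs E V x) = \<Delta>" if "x \<in> C" for x using private_block that by (auto simp: private_block_def)
    show "x = x'" if "x \<in> C" "x' \<in> C" "y \<in> V - C" "E x y" "E x' y" for x x' y
      using private_block that unfolding private_block_def by blast
    show "special_set (?K v)" if v: "v \<in> V - C" for v
    proof -
      obtain y where y: "y \<in> ?K v" "att y" using ex[OF v] by blast
      then have "y \<in> Y" using all KV[of v] by (auto simp: att_def)
      from Yv(2)[OF this] show ?thesis unfolding Keq[OF y(1) v] .
    qed
    show "y = y'" if h: "y \<in> V - C" "y' \<in> ?K y" "x \<in> C" "x' \<in> C" "E x y" "E x' y'" for y y' x x'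
    proof -
      have "y \<in> Y" "y' \<in> Y" using all h KV[of y] by blast+
      then show ?thesis using Yv(3) Keq[OF h(2,1)] by metis
    qed
  qed
  then show ?thesis using Yv(1) \<pi> g by (intro exI[of _ Y] exI[of _ \<pi>] exI[of _ g]) blast
qed

end

section \<open>Pairing an odd Hamiltonian cycle apart from one vertex\<close>

context sgraph begin

text \<open>The vertex \<open>s\<close> keeps the centre \<open>z\<close> out of deficient blocks:
  as a leaf it is in no such block itself, yet it is not a leaf of its neighbour \<open>z\<close>.
  Only \<open>p\<close> may lack such an \<open>s\<close>, and \<open>x\<close> remains unassigned
  next to \<open>p\<close>.\<close>

definition almost_paired :: "'a set \<Rightarrow> 'a \<Rightarrow> 'a \<Rightarrow> ('a \<Rightarrow> 'a) \<Rightarrow> bool" where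
  "almost_paired C x p h \<longleftrightarrow>
     (\<forall>z\<in>C - {x}. h z \<in> C - {x} \<and> h (h z) = h z \<and> (h z \<noteq> z \<longrightarrow> E z (h z)) \<and>
        (h z = z \<longrightarrow> (\<exists>u\<in>C - {x}. u \<noteq> z \<and> h u = z)) \<and>
        (h z = z \<longrightarrow> z = p \<or> (\<exists>s\<in>C - {x}. E z s \<and> h s \<noteq> s \<and> h s \<noteq> z))) \<and>
     p \<in> C - {x} \<and> h p = p \<and> E x p"

text \<open>Even positions become leaves of the following odd ones. The successor of a centre before
  position \<open>n - 2\<close> is a leaf of the next centre and serves as \<open>s\<close>.\<close>

lemma hamiltonian_odd_pairing:
  assumes ham: "hamiltonian C n f" and odd: "odd n" and x: "x = f (n - 1)"
  shows "\<exists>h. almost_paired C x (f (n - 2)) h"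
proof -
  have n: "3 \<le> n" and img: "f ` {0..<n} = C" and inj: "inj_on f {0..<n}"
    and e: "\<And>i. i < n \<Longrightarrow> E (f i) (f ((i + 1) mod n))"
    using ham by (auto simp: hamiltonian_def bij_betw_def)
  have feq: "f i = f j \<longleftrightarrow> i = j" if "i < n" "j < n" for i j using that inj by (auto dest: inj_onD)
  have inC: "f i \<in> C" if "i < n" for i using that img by auto
  define b where "b i \<longleftrightarrow> i = n - 1" for i
  have last: "\<not> starts b (n - 1)" by (rule starts_not) (simp add: b_def)
  obtain h where h: "\<And>i. i < n \<Longrightarrow> h (f i) = f (if starts b i then i + 1 else i)"
    and h1: "\<And>z. z \<in> C \<Longrightarrow> h z \<in> C \<and> h (h z) = h z \<and> (h z \<noteq> z \<longrightarrow> E z (h z))"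
    and h2: "\<And>i. i < n \<Longrightarrow> \<not> b i \<Longrightarrow> h (f i) = f i \<Longrightarrow> \<exists>u\<in>C. u \<noteq> f i \<and> h u = f i"
    using hamiltonian_pairing[OF ham last] by blast
  have hi: "h (f i) = f (if even i then i + 1 else i)" if "i < n - 1" for i
    using h[of i] starts_even[of i b] that by (auto simp: b_def)
  have hx: "h x = x" using h[of "n - 1"] last n x by simp
  have idx: "\<exists>i<n - 1. z = f i" if "z \<in> C - {x}" for z
  proof -
    note z = that
    obtain i where i: "i < n" "z = f i" using z img by auto
    then have "i \<noteq> n - 1" using z x by auto
    then show ?thesis using i by (intro exI[of _ i]) auto
  qed
  have mem: "f i \<in> C - {x}" if "i < n - 1" for i
    using that inC[of i] feq[of i "n - 1"] x n by auto
  have step: "E (f i) (f (i + 1))" if "i < n - 1" for i using e[of i] that by simp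
  have "h z \<in> C - {x} \<and> h (h z) = h z \<and> (h z \<noteq> z \<longrightarrow> E z (h z)) \<and>
      (h z = z \<longrightarrow> (\<exists>u\<in>C - {x}. u \<noteq> z \<and> h u = z)) \<and>
      (h z = z \<longrightarrow> z = f (n - 2) \<or> (\<exists>s\<in>C - {x}. E z s \<and> h s \<noteq> s \<and> h s \<noteq> z))" if z: "z \<in> C - {x}" for z
  proof -
    obtain i where i: "i < n - 1" "z = f i" using idx[OF z] by blast
    have zC: "z \<in> C" using z by blast
    show ?thesis
    proof (cases "even i")
      case True
      then have "i + 1 < n - 1" using i odd by presburger
      moreover have hz: "h z = f (i + 1)" using hi[OF i(1)] i True by simp
      moreover have "h z \<noteq> z" using hz feq[of "i + 1" i] i calculation(1) by auto
      ultimately show ?thesis using mem[of "i + 1"] h1[OF zC] by auto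
    next
      case False
      have hz: "h z = z" using hi[OF i(1)] i False by simp
      have "\<not> b i" using i by (simp add: b_def)
      then have "\<exists>u\<in>C. u \<noteq> z \<and> h u = z" using h2[of i] i hz by simp
      then obtain u where u: "u \<in> C" "u \<noteq> z" "h u = z" by blast
      then have "u \<in> C - {x}" using hx z by auto
      moreover have "z = f (n - 2) \<or> (\<exists>s\<in>C - {x}. E z s \<and> h s \<noteq> s \<and> h s \<noteq> z)"
      proof (cases "i = n - 2")
        case False
        then have lt: "i + 1 < n - 1" using i by simp
        then have lt2: "i + 2 < n" by simp
        have "h (f (i + 1)) = f (i + 2)" using hi[OF lt] \<open>odd i\<close> by simp
        then show ?thesis
          using mem[OF lt] step[OF i(1)] i feq[of "i + 2" "i + 1"] feq[of "i + 2" i] lt2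
          by (intro disjI2 bexI[of _ "f (i + 1)"]) auto
      qed (use i in simp)
      ultimately show ?thesis using u z hz by auto
    qed
  qed
  moreover have "f (n - 2) \<in> C - {x}" using mem[of "n - 2"] n by simp
  moreover have "h (f (n - 2)) = f (n - 2)" using hi[of "n - 2"] n odd by simp
  moreover have "E x (f (n - 2))" using step[of "n - 2"] n sym x by (simp add: Suc_diff_Suc numeral_2_eq_2)
  ultimately have "almost_paired C x (f (n - 2)) h" unfolding almost_paired_def by blast
  then show ?thesis by blast
qed

lemma hamiltonian_successor_closed:
  assumes ham: "hamiltonian C n f" and D: "\<And>i. i < n \<Longrightarrow> f i \<in> D \<Longrightarrow> f ((i + 1) mod n) \<in> D"
    and ne: "C \<inter> D \<noteq> {}"
  shows "C \<subseteq> D"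
proof
  have n: "3 \<le> n" and img: "f ` {0..<n} = C" using ham by (auto simp: hamiltonian_def bij_betw_def)
  obtain i where i: "i < n" "f i \<in> D" using ne img by auto
  have step: "f ((i + k) mod n) \<in> D" for k
  proof (induction k)
    case (Suc k)
    have "((i + k) mod n + 1) mod n = (i + Suc k) mod n" by (simp add: mod_Suc_eq)
    then show ?case using D[OF _ Suc] n by simp
  qed (use i in simp)
  fix z assume "z \<in> C"
  then obtain j where j: "j < n" "z = f j" using img by auto
  \<comment> \<open>Adding \<open>n\<close> prevents truncation of the subtraction.\<close>
  have "(i + (j + n - i)) mod n = j" using i j by simp
  then show "z \<in> D" using step[of "j + n - i"] j by simp
qed

end

context special_graph begin

text \<open>The decomposition leaves no deficient block in \<open>W\<close>, so as long as the new
  map sends \<open>C\<close> into itself, a deficient block must meet \<open>C\<close>. If it is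
  closed under successors, it contains \<open>C\<close> and equals \<open>C\<close> by
  \<open>block_maximal\<close>. Then \<open>Y\<close> contains all outside neighbours of
  \<open>C\<close>, which makes \<open>V\<close> special.\<close>

lemma private_block_star_forest:
  assumes fin: "finite V" and conn: "conn V" and private_block: "private_block V C"
    and deg: "\<And>v. v \<in> V \<Longrightarrow> card (nbrs E V v) \<le> \<Delta>"
    and IH: "\<And>K. K \<subset> V \<Longrightarrow> conn K \<Longrightarrow> \<not> special_set K \<Longrightarrow> \<exists>g. star_forest K g \<and> (\<forall>D. \<not> deficient K g D)"
  shows "\<exists>c. star_forest V c \<and> (\<forall>D. deficient V c D \<longrightarrow> D = C \<and> special_set V)"
proof -
  have "\<exists>Y \<pi> g. Y \<subseteq> V - C \<and> (\<forall>y\<in>Y. \<pi> y \<in> C \<and> E (\<pi> y) y) \<and>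
    star_forest (V - C - Y) g \<and> (\<forall>D. \<not> deficient (V - C - Y) g D) \<and>
    ((\<forall>y\<in>V - C. (\<exists>x\<in>C. E x y) \<longrightarrow> y \<in> Y) \<longrightarrow> special_set V)"
    by (rule private_block_decomposition[OF fin conn private_block deg IH])
  then obtain Y \<pi> g where Y: "Y \<subseteq> V - C" and \<pi>: "\<And>y. y \<in> Y \<Longrightarrow> \<pi> y \<in> C \<and> E (\<pi> y) y"
    and g: "star_forest (V - C - Y) g" and gc: "\<And>D. \<not> deficient (V - C - Y) g D"
    and join: "(\<And>y x. y \<in> V - C \<Longrightarrow> x \<in> C \<Longrightarrow> E x y \<Longrightarrow> y \<in> Y) \<Longrightarrow> special_set V"
    by blast
  define W where "W = V - C - Y"
  have CV: "C \<subseteq> V" and bC: "block C" using private_block by (auto simp: private_block_def)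
  have V: "V = C \<union> Y \<union> W" "C \<inter> Y = {}" "C \<inter> W = {}" "Y \<inter> W = {}"
    using Y CV by (auto simp: W_def)
  note gW = g[folded W_def] and gcW = gc[folded W_def]
  obtain n f0 where ham0: "hamiltonian C n f0" using block_hamiltonian[OF bC] by blast
  have n: "3 \<le> n" using ham0 by (simp add: hamiltonian_def)
  let ?c = "\<lambda>h v. if v \<in> C then h v else if v \<in> Y then \<pi> v else g v"
  have cY: "?c h y \<in> C" if "y \<in> Y" for h y using \<pi>[OF that] that V by auto
  have cW: "?c h w = g w" if "w \<in> W" for h w using that V by auto
  show ?thesis
    \<comment> \<open>If no vertex of an odd block is forced to be a centre, pair up its vertices except for three that
      form a star centred at \<open>p\<close>. If this yields a deficient block \<open>D\<close>, then \<open>p \<in> D\<close>: attach \<open>p\<close> to a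
      neighbour \<open>q \<in> D\<close> outside the block instead and pair up the rest.\<close>
  proof (cases "Y \<noteq> {} \<or> even n")
    case True
    \<comment> \<open>With \<open>Y\<close> non-empty, a forced centre is rotated to position
      \<open>n - 1\<close>; with \<open>Y\<close> empty and \<open>n\<close> even, that position is
      odd and hence a centre anyway.\<close>
    have "\<exists>f. hamiltonian C n f \<and> \<not> starts (\<lambda>i. f i \<in> \<pi> ` Y) (n - 1)"
    proof (cases "Y = {}")
      case False
      then obtain y where "y \<in> Y" by blast
      then obtain f where "hamiltonian C n f" "f (n - 1) = \<pi> y" using hamiltonian_last[OF ham0] \<pi> by blast
      then show ?thesis using starts_not[of "\<lambda>i. f i \<in> \<pi> ` Y" "n - 1"] \<open>y \<in> Y\<close> by auto
    next
      case Y: True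
      then have "even n" using True by simp
      then have "\<not> starts (\<lambda>i. f0 i \<in> \<pi> ` Y) (n - 1)" using starts_even[of "n - 1" "\<lambda>i. f0 i \<in> \<pi> ` Y"] Y n by simp
      then show ?thesis using ham0 by blast
    qed
    then obtain f where ham: "hamiltonian C n f" and last: "\<not> starts (\<lambda>i. f i \<in> \<pi> ` Y) (n - 1)" by blast
    have img: "f ` {0..<n} = C" and e: "\<And>i. i < n \<Longrightarrow> E (f i) (f ((i + 1) mod n))"
      using ham by (auto simp: hamiltonian_def bij_betw_def)
    obtain h where h: "\<And>i. i < n \<Longrightarrow> h (f i) = f (if starts (\<lambda>i. f i \<in> \<pi> ` Y) i then i + 1 else i)"
      and h1: "\<And>x. x \<in> C \<Longrightarrow> h x \<in> C \<and> h (h x) = h x \<and> (h x \<noteq> x \<longrightarrow> E x (h x))"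
      and h2: "\<And>i. i < n \<Longrightarrow> f i \<notin> \<pi> ` Y \<Longrightarrow> h (f i) = f i \<Longrightarrow> \<exists>u\<in>C. u \<noteq> f i \<and> h u = f i"
      and h3: "\<And>i. i < n \<Longrightarrow> h (f ((i + 1) mod n)) \<noteq> f i"
      using hamiltonian_pairing[OF ham last] by blast
    have hB: "h (\<pi> y) = \<pi> y" if y: "y \<in> Y" for y
    proof -
      obtain i where "i < n" "\<pi> y = f i" using \<pi>[OF y] img by auto
      moreover from this have "f i \<in> \<pi> ` Y" using y by (metis imageI)
      ultimately show ?thesis using h[of i] starts_not[of "\<lambda>i. f i \<in> \<pi> ` Y" i] by simp
    qed
    have sf: "star_forest V (?c h)"
      unfolding V(1)
    proof (rule star_forest_glue[OF gW V(2-4)])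
      show "\<pi> y \<in> C \<and> E (\<pi> y) y \<and> h (\<pi> y) = \<pi> y" if "y \<in> Y" for y using \<pi> hB that by blast
      show "h x \<in> C \<and> h (h x) = h x \<or> h x \<in> W \<and> g (h x) = h x" if "x \<in> C" for x using h1 that by blast
      show "E x (h x)" if "x \<in> C" "h x \<noteq> x" for x using h1 that by blast
      show "(\<exists>u\<in>C. u \<noteq> x \<and> h u = x) \<or> (\<exists>y\<in>Y. \<pi> y = x)" if x: "x \<in> C" "h x = x" for x
      proof -
        obtain i where "i < n" "x = f i" using x img by auto
        then have "x \<in> \<pi> ` Y \<or> (\<exists>u\<in>C. u \<noteq> x \<and> h u = x)" using h2[of i] x by auto
        then show ?thesis by auto
      qed
    qed
    have "D = C \<and> special_set V" if U: "deficient V (?c h) D" for D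
    proof -
      have DV: "D \<subseteq> V" "conn D" "block D" using U by (auto simp: deficient_def)
      have leaf: "?c h y = x" if "x \<in> D" "y \<in> V - D" "E x y" for x y using U that unfolding deficient_def by blast
      have "C \<inter> D \<noteq> {}"
      proof
        assume "C \<inter> D = {}"
        moreover from this have "?c h z \<notin> D" if "z \<in> C" for z using h1[OF that] that by auto
        ultimately have "deficient W g D"
          using deficient_restrict[where C = C and Y = Y and W = W and V = V and D = D and c = "?c h" and g = g, OF fin sf U V cY[where h = h] cW[where h = h]] by blast
        then show False using gcW by blast
      qed
      \<comment> \<open>A successor outside \<open>D\<close> would be a leaf of its predecessor,
        contrary to \<open>h3\<close>.\<close>
      moreover have "f ((i + 1) mod n) \<in> D" if i: "i < n" "f i \<in> D" for i
      proof (rule ccontr)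
        assume a: "f ((i + 1) mod n) \<notin> D"
        have "(i + 1) mod n < n" using n by simp
        then have sC: "f ((i + 1) mod n) \<in> C" using img by auto
        then have "?c h (f ((i + 1) mod n)) = f i" using leaf[OF i(2) _ e[OF i(1)]] CV a by blast
        then show False using h3[OF i(1)] sC by simp
      qed
      ultimately have "C \<subseteq> D" using hamiltonian_successor_closed[OF ham, of D] by blast
      then have DC: "D = C" using block_maximal[OF private_block DV(2,3) _ DV(1)] by blast
      \<comment> \<open>An outside neighbour of \<open>C\<close> is a leaf of \<open>C\<close> by
        deficiency, whereas \<open>g\<close> keeps \<open>W\<close> within \<open>W\<close>.\<close>
      have "y \<in> Y" if y: "y \<in> V - C" "x \<in> C" "E x y" for x y
      proof (rule ccontr)
        assume "y \<notin> Y"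
        then have yW: "y \<in> W" using y by (simp add: W_def)
        then have "g y = x" using leaf[of x y] y DC cW[OF yW] by simp
        then show False using star_forestD(1)[OF gW yW] V(3) y(2) by blast
      qed
      then show ?thesis using DC join by blast
    qed
    then show ?thesis using sf by blast
  next
    case False
    then have Y0: "Y = {}" and odd: "odd n" by auto
    have \<pi>0: "\<pi> y \<in> C \<and> E (\<pi> y) y \<and> h (\<pi> y) = \<pi> y" if "y \<in> Y" for y h using that Y0 by simp
    define x where "x = f0 (n - 1)"
    define p where "p = f0 (n - 2)"
    have img: "f0 ` {0..<n} = C" using ham0 by (auto simp: hamiltonian_def bij_betw_def)
    have xC: "x \<in> C" using img n by (auto simp: x_def)
    obtain h where ap: "almost_paired C x p h"
      using hamiltonian_odd_pairing[OF ham0 odd x_def] unfolding p_def by blast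
    have h: "h z \<in> C - {x} \<and> h (h z) = h z \<and> (h z \<noteq> z \<longrightarrow> E z (h z)) \<and>
        (h z = z \<longrightarrow> (\<exists>u\<in>C - {x}. u \<noteq> z \<and> h u = z)) \<and>
        (h z = z \<longrightarrow> z = p \<or> (\<exists>s\<in>C - {x}. E z s \<and> h s \<noteq> s \<and> h s \<noteq> z))" if "z \<in> C - {x}" for z
      using ap[unfolded almost_paired_def, THEN conjunct1, THEN bspec, OF that] .
    have p: "p \<in> C - {x}" "h p = p" "E x p" using ap unfolding almost_paired_def by blast+
    define h1 where "h1 = h(x := p)"
    have h1x: "h1 x = p" and h1: "\<And>z. z \<noteq> x \<Longrightarrow> h1 z = h z" by (auto simp: h1_def)
    have h1C: "h1 z \<in> C" if "z \<in> C" for z using that h[of z] p h1x h1 by (cases "z = x") auto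
    have sf1: "star_forest V (?c h1)"
      unfolding V(1)
    proof (rule star_forest_glue[OF gW V(2-4) \<pi>0])
      show "h1 z \<in> C \<and> h1 (h1 z) = h1 z \<or> h1 z \<in> W \<and> g (h1 z) = h1 z" if "z \<in> C" for z
      proof (cases "z = x")
        case True then show ?thesis using p h1x h1[of p] by auto
      next
        case False then show ?thesis using that h[of z] h1[of z] h1[of "h z"] by auto
      qed
      show "E z (h1 z)" if "z \<in> C" "h1 z \<noteq> z" for z
        using that h[of z] h1x h1[of z] p by (cases "z = x") auto
      show "(\<exists>u\<in>C. u \<noteq> z \<and> h1 u = z) \<or> (\<exists>y\<in>Y. \<pi> y = z)" if z: "z \<in> C" "h1 z = z" for z
      proof -
        have zx: "z \<noteq> x" using z h1x p by auto
        then obtain u where "u \<in> C - {x}" "u \<noteq> z" "h u = z" using h[of z] z h1[of z] by auto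
        then show ?thesis using h1[of u] by auto
      qed
    qed
    show ?thesis
    proof (cases "\<exists>D. deficient V (?c h1) D")
      case False
      then show ?thesis using sf1 by blast
    next
      case True
      then obtain D where U: "deficient V (?c h1) D" by blast
      have DV: "D \<subseteq> V" "conn D" "block D" using U by (auto simp: deficient_def)
      have leafD: "?c h1 y = z" if "z \<in> D" "y \<in> V - D" "E z y" for z y using U that unfolding deficient_def by blast
      have cenD: "?c h1 z = z" if "z \<in> D" for z using deficient_center[OF sf1 U that fin] .
      \<comment> \<open>Every centre in \<open>C\<close> except \<open>p\<close> has a neighbour
        that is a leaf of another centre.\<close>
      have sub: "z = p" if z: "z \<in> D" "z \<in> C" for z
      proof (rule ccontr)
        assume zp: "z \<noteq> p"
        have hz: "h1 z = z" using cenD[OF z(1)] z(2) by simp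
        then have zx: "z \<noteq> x" using h1x p by auto
        then obtain s where s: "s \<in> C - {x}" "E z s" "h s \<noteq> s" "h s \<noteq> z"
          using h[of z] z hz h1[of z] zp by auto
        then have cs: "?c h1 s = h s" using h1[of s] by auto
        then show False using leafD[OF z(1) _ s(2)] cenD[of s] s CV by (cases "s \<in> D") auto
      qed
      have "C \<inter> D \<noteq> {}"
      proof
        assume "C \<inter> D = {}"
        moreover from this have "?c h1 z \<notin> D" if "z \<in> C" for z using h1C[OF that] that by auto
        ultimately have "deficient W g D"
          using deficient_restrict[where C = C and Y = Y and W = W and V = V and D = D and c = "?c h1" and g = g, OF fin sf1 U V cY[where h = h1] cW[where h = h1]] by blast
        then show False using gcW by blast
      qed
      then have pD: "p \<in> D" using sub by blast
      have "2 \<le> card (nbrs E D p)" using critical_ge2 block_degree[OF DV(3) pD] by blast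
      then have "nbrs E D p \<noteq> {}" by auto
      then obtain q where q: "q \<in> D" "E p q" by (auto simp: nbrs_def)
      have qC: "q \<notin> C" using sub[of q] q irr by auto
      then have qW: "q \<in> W" using q(1) DV(1) V Y0 by auto
      \<comment> \<open>As a member of the deficient block \<open>D\<close>, the vertex
        \<open>q\<close> is a centre and can take \<open>p\<close> as a further leaf.\<close>
      have gq: "g q = q" using cenD[OF q(1)] cW[OF qW] by simp
      have pC: "p \<in> C" using p by blast
      obtain f where ham: "hamiltonian C n f" "f (n - 1) = p" using hamiltonian_last[OF ham0 pC] by blast
      define p' where "p' = f (n - 2)"
      obtain k where ap': "almost_paired C p p' k"
        using hamiltonian_odd_pairing[OF ham(1) odd ham(2)[symmetric]] unfolding p'_def by blast
      have k: "k z \<in> C - {p} \<and> k (k z) = k z \<and> (k z \<noteq> z \<longrightarrow> E z (k z)) \<and>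
          (k z = z \<longrightarrow> (\<exists>u\<in>C - {p}. u \<noteq> z \<and> k u = z)) \<and>
          (k z = z \<longrightarrow> z = p' \<or> (\<exists>s\<in>C - {p}. E z s \<and> k s \<noteq> s \<and> k s \<noteq> z))" if "z \<in> C - {p}" for z
        using ap'[unfolded almost_paired_def, THEN conjunct1, THEN bspec, OF that] .
      have p': "p' \<in> C - {p}" "k p' = p'" "E p p'" using ap' unfolding almost_paired_def by blast+
      define h2 where "h2 = k(p := q)"
      have h2p: "h2 p = q" and h2: "\<And>z. z \<noteq> p \<Longrightarrow> h2 z = k z" by (auto simp: h2_def)
      have sf2: "star_forest V (?c h2)"
        unfolding V(1)
      proof (rule star_forest_glue[OF gW V(2-4) \<pi>0])
        show "h2 z \<in> C \<and> h2 (h2 z) = h2 z \<or> h2 z \<in> W \<and> g (h2 z) = h2 z" if "z \<in> C" for z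
        proof (cases "z = p")
          case True then show ?thesis using h2p qW gq by auto
        next
          case False then show ?thesis using that k[of z] h2[of z] h2[of "k z"] by auto
        qed
        show "E z (h2 z)" if "z \<in> C" "h2 z \<noteq> z" for z
          using that k[of z] h2p h2[of z] q by (cases "z = p") auto
        show "(\<exists>u\<in>C. u \<noteq> z \<and> h2 u = z) \<or> (\<exists>y\<in>Y. \<pi> y = z)" if z: "z \<in> C" "h2 z = z" for z
        proof -
          have zp: "z \<noteq> p" using z h2p qC by auto
          then obtain u where "u \<in> C - {p}" "u \<noteq> z" "k u = z" using k[of z] z h2[of z] by auto
          then show ?thesis using h2[of u] by auto
        qed
      qed
      have "\<not> deficient V (?c h2) D'" for D'
      proof
        assume U': "deficient V (?c h2) D'"
        have DV': "D' \<subseteq> V" "conn D'" "block D'" using U' by (auto simp: deficient_def)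
        have leaf: "?c h2 y = z" if "z \<in> D'" "y \<in> V - D'" "E z y" for z y using U' that unfolding deficient_def by blast
        have cen: "?c h2 z = z" if "z \<in> D'" for z using deficient_center[OF sf2 U' that fin] .
        \<comment> \<open>Now every centre in \<open>C\<close> has a neighbour that is a leaf of
          another centre; for \<open>p'\<close> it is \<open>p\<close>, a leaf of
          \<open>q\<close>.\<close>
        have dis: "z \<notin> C" if z: "z \<in> D'" for z
        proof
          assume zC: "z \<in> C"
          have hz: "h2 z = z" using cen[OF z] zC by simp
          then have zp: "z \<noteq> p" using h2p qC zC by auto
          have "\<exists>s\<in>C. E z s \<and> h2 s \<noteq> s \<and> h2 s \<noteq> z"
          proof (cases "z = p'")
            case True
            then show ?thesis using p' sym h2p qC pC zC by (intro bexI[of _ p]) auto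
          next
            case False
            then obtain s where "s \<in> C - {p}" "E z s" "k s \<noteq> s" "k s \<noteq> z"
              using k[of z] zC zp hz h2[of z] by auto
            then show ?thesis using h2[of s] by auto
          qed
          then obtain s where s: "s \<in> C" "E z s" "h2 s \<noteq> s" "h2 s \<noteq> z" by blast
          then show False using leaf[OF z _ s(2)] cen[of s] CV by (cases "s \<in> D'") auto
        qed
        have disC: "D' \<inter> C = {}" using dis by blast
        \<comment> \<open>Only \<open>p\<close> has its centre outside \<open>C\<close>, namely
          \<open>q\<close>. So a deficient block that misses \<open>q\<close> would already be
          deficient for \<open>W\<close>.\<close>
        have qD': "q \<in> D'"
        proof (rule ccontr)
          assume nq: "q \<notin> D'"
          have "?c h2 z \<notin> D'" if "z \<in> C" for z
          proof (cases "z = p")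
            case True then show ?thesis using nq h2p pC by simp
          next
            case False
            then have "h2 z \<in> C" using k[of z] that h2[of z] by auto
            then show ?thesis using disC that by auto
          qed
          then have "deficient W g D'"
            using deficient_restrict[where C = C and Y = Y and W = W and V = V and D = D' and c = "?c h2" and g = g, OF fin sf2 U' V cY[where h = h2] cW[where h = h2] disC] by blast
          then show False using gcW by blast
        qed
        have pD': "p \<notin> D'" using dis pC by blast
        \<comment> \<open>If \<open>D\<close> is complete, a third vertex \<open>u\<close> of
          \<open>D\<close> must lie in \<open>D'\<close>, and then \<open>p\<close> would have to be
          a leaf of \<open>u\<close> rather than of \<open>q\<close>. If \<open>D\<close> is a
          cycle, the neighbours of \<open>q\<close> in \<open>D'\<close> are among those in
          \<open>D\<close> other than \<open>p\<close>, so there is at most one.\<close>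
        show False
        proof (cases "clique E D \<and> critical (card D - 1) \<and> finite D")
          case True
          then have "3 \<le> card D" using critical_ge2[of "card D - 1"] by simp
          then have "\<not> D \<subseteq> {p, q}" using card_mono[of "{p, q}" D] card_insert_le_m1[of 2 "{q}" p] by auto
          then obtain u where u: "u \<in> D" "u \<noteq> p" "u \<noteq> q" by blast
          have adj: "E q u" "E u p" using True u q(1) pD by (auto simp: clique_def)
          have uC: "u \<notin> C" using sub u by blast
          then have uW: "u \<in> W" using u(1) DV(1) V Y0 by auto
          have gu: "g u = u" using cenD[OF u(1)] cW[OF uW] by simp
          have "u \<in> D'"
          proof (rule ccontr)
            assume "u \<notin> D'"
            then have "?c h2 u = q" using leaf[OF qD' _ adj(1)] u DV by blast
            then show False using cW[OF uW] gu u by simp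
          qed
          then have "?c h2 p = u" using leaf[OF _ _ adj(2)] pD' pC CV by blast
          then show False using h2p pC u by simp
        next
          case False
          then have D4: "\<Delta> = 4" using DV(3) unfolding block_def by blast
          have finD: "finite D" using DV(1) fin finite_subset by blast
          have "nbrs E D' q \<subseteq> nbrs E D q - {p}"
          proof
            fix y assume "y \<in> nbrs E D' q"
            then have y: "y \<in> D'" "E q y" by (auto simp: nbrs_def)
            then have yC: "y \<notin> C" using dis by blast
            then have yW: "y \<in> W" using y(1) DV'(1) V Y0 by auto
            have gy: "g y = y" using cen[OF y(1)] cW[OF yW] by simp
            have "y \<noteq> q" using y irr by auto
            have "y \<in> D"
            proof (rule ccontr)
              assume "y \<notin> D"
              then have "?c h1 y = q" using leafD[OF q(1) _ y(2)] y DV' by blast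
              then show False using cW[OF yW] gy \<open>y \<noteq> q\<close> by simp
            qed
            then show "y \<in> nbrs E D q - {p}" using y yC pC by (auto simp: nbrs_def)
          qed
          then have "card (nbrs E D' q) \<le> card (nbrs E D q - {p})" using finD by (intro card_mono) auto
          also have "\<dots> < card (nbrs E D q)"
            using pD q(2) sym finD by (intro psubset_card_mono) (auto simp: nbrs_def)
          also have "card (nbrs E D q) = 2"
            using block_degree[OF DV(3) q(1)] D4 unfolding critical_def by simp
          finally have "card (nbrs E D' q) < 2" .
          then show False using critical_ge2 block_degree[OF DV'(3) qD'] by fastforce
        qed
      qed
      then show ?thesis using sf2 by blast
    qed
  qed
qed

lemma special_set_singleton: "special_set {v}"
proof -
  have "\<not> on_cycle {v} u" for u unfolding on_cycle_def by auto
  then show ?thesis using irr by (auto simp: special_set_def conn_def cycle_set_def)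
qed

text \<open>Without a private block every star forest will do. Otherwise the induction hypothesis is
  needed for proper subsets that are connected and not special; these have at least two vertices,
  since a single vertex is special.\<close>

lemma star_forest_deficient:
  assumes "finite V" "conn V" "\<And>v. v \<in> V \<Longrightarrow> card (nbrs E V v) \<le> \<Delta>" "2 \<le> card V"
  shows "\<exists>c C. star_forest V c \<and> (\<forall>D. deficient V c D \<longrightarrow> D = C \<and> special_set V)"
  using assms
proof (induction "card V" arbitrary: V rule: less_induct)
  case (less V)
  note fin = less.prems(1) and conn = less.prems(2) and deg = less.prems(3) and card2 = less.prems(4)
  show ?case
  proof (cases "\<exists>C. private_block V C")
    case False
    have "\<exists>u\<in>V. E v u" if "v \<in> V" for v using conn_nbr[OF conn that card2] by blast
    then obtain c where "star_forest V c" using star_forest_exists[OF fin] by blast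
    then show ?thesis using False deficient_private_block by blast
  next
    case True
    then obtain C where C: "private_block V C" by blast
    have "\<exists>g. star_forest K g \<and> (\<forall>D. \<not> deficient K g D)" if K: "K \<subset> V" "conn K" "\<not> special_set K" for K
    proof -
      have finK: "finite K" using K(1) fin finite_subset by blast
      have "2 \<le> card K"
      proof (rule ccontr)
        assume "\<not> 2 \<le> card K"
        moreover have "card K \<noteq> 0" using K(2) finK by (auto simp: conn_def)
        ultimately have "card K = 1" by simp
        then show False using K(3) special_set_singleton by (auto simp: card_1_singleton_iff)
      qed
      moreover have "card (nbrs E K v) \<le> \<Delta>" if "v \<in> K" for v
        using card_mono[OF finite_nbrs[OF fin] nbrs_mono[of K V E v]] deg[of v] that K(1) by fastforce
      moreover have "card K < card V" using K(1) fin by (rule psubset_card_mono[rotated])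
      ultimately show ?thesis using less.hyps[of K] finK K by blast
    qed
    then show ?thesis using private_block_star_forest[OF fin conn C deg] by blast
  qed
qed

lemma connected_independent_dominating_set:
  assumes fin: "finite V" and conn: "conn V" and deg: "\<And>v. v \<in> V \<Longrightarrow> card (nbrs E V v) \<le> \<Delta>"
  shows "\<exists>S\<subseteq>V. indep E S \<and> (\<forall>v\<in>V - S. \<exists>u\<in>S. E v u) \<and>
    t * real (card V) - t * (if special_set V then 1 else 0) \<le> real (card (V - S))"
proof (cases "2 \<le> card V")
  case True
  obtain c C where c: "star_forest V c" and C: "\<And>D. deficient V c D \<Longrightarrow> D = C \<and> special_set V"
    using star_forest_deficient[OF fin conn deg True] by blast
  have "card {D. deficient V c D} \<le> (if special_set V then 1 else 0)"
  proof (cases "special_set V")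
    case True
    have "{D. deficient V c D} \<subseteq> {C}" using C by blast
    then have "card {D. deficient V c D} \<le> card {C}" by (intro card_mono) auto
    then show ?thesis using True by simp
  next
    case False
    then have "{D. deficient V c D} = {}" using C by blast
    then show ?thesis by (simp only: card.empty)
  qed
  then have "real (card {D. deficient V c D}) \<le> (if special_set V then 1 else 0)" by (simp split: if_splits)
  then have "t * real (card {D. deficient V c D}) \<le> t * (if special_set V then 1 else 0)"
    using t_coeff_nonneg by (intro mult_left_mono) auto
  moreover obtain S where S: "S \<subseteq> V" "indep E S" "\<forall>v\<in>V - S. \<exists>u\<in>S. E v u"
    "t * real (card V) - t * real (card {D. deficient V c D}) \<le> real (card (V - S))"
    using star_forest_bound[OF fin c deg] by blast
  ultimately have "t * real (card V) - t * (if special_set V then 1 else 0) \<le> real (card (V - S))" by linarith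
  then show ?thesis using S by blast
next
  case False
  have "card V \<noteq> 0" using conn fin by (auto simp: conn_def)
  then have "card V = 1" using False by simp
  then obtain v where v: "V = {v}" by (auto simp: card_1_singleton_iff)
  then show ?thesis using special_set_singleton[of v] irr by (intro exI[of _ V]) (auto simp: indep_def)
qed

end

section \<open>Transfer to digraphs\<close>

lemma dominates_induce_iff:
  "u \<rightarrow>\<^bsub>G \<restriction> S\<^esub> v \<longleftrightarrow> u \<in> S \<and> v \<in> S \<and> u \<rightarrow>\<^bsub>G\<^esub> v"
  by (auto simp: arcs_ends_conv)

lemma induce_induce: "K \<subseteq> S \<Longrightarrow> (G \<restriction> S) \<restriction> K = G \<restriction> K"
  by (auto simp: induce_subgraph_def)

lemma (in wf_digraph) induce_verts: "G \<restriction> verts G = G"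
  by (rule pre_digraph.equality) auto

locale bounded_graph = graph G for G :: "('a, 'b) pre_digraph" +
  fixes \<Delta> :: nat
  assumes Delta4: "4 \<le> \<Delta>"
begin

sublocale special_graph "\<lambda>u v. u \<rightarrow>\<^bsub>G\<^esub> v" \<Delta>
proof
  show "v \<rightarrow>\<^bsub>G\<^esub> u" if "u \<rightarrow>\<^bsub>G\<^esub> v" for u v using that by (rule graph_symmetric)
  show "\<not> v \<rightarrow>\<^bsub>G\<^esub> v" for v using no_loops by (auto simp: arcs_ends_conv)
  show "4 \<le> \<Delta>" by (rule Delta4)
qed

abbreviation E :: "'a \<Rightarrow> 'a \<Rightarrow> bool" where "E u v \<equiv> u \<rightarrow>\<^bsub>G\<^esub> v"

lemma graph_induce: "S \<subseteq> verts G \<Longrightarrow> graph (G \<restriction> S)"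
  using digraphI_induced[of "G \<restriction> S"] induced_graph_imp_graph[of "G \<restriction> S"]
  by (auto simp: graph_def pseudo_graph_def digraph_def)

text \<open>Digraph reachability requires its start to be a vertex, whereas \<open>reach\<close> is
  reflexive everywhere; hence the conjunct \<open>u \<in> S\<close>.\<close>

lemma reachable_induce_iff:
  "u \<rightarrow>\<^sup>*\<^bsub>G \<restriction> S\<^esub> v \<longleftrightarrow> u \<in> S \<and> reach S u v"
proof
  assume "u \<rightarrow>\<^sup>*\<^bsub>G \<restriction> S\<^esub> v"
  then have "(u, v) \<in> rtrancl_on S (arcs_ends (G \<restriction> S))" by (simp add: reachable_def)
  then show "u \<in> S \<and> reach S u v"
  proof (induction rule: rtrancl_on_induct)
    case (step y z)
    then have "reach S y z" by (intro reach_step) (auto simp: dominates_induce_iff)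
    then show ?case using step.IH reach_trans by blast
  qed simp
next
  assume h: "u \<in> S \<and> reach S u v"
  then have "(\<lambda>x y. x \<in> S \<and> y \<in> S \<and> E x y)\<^sup>*\<^sup>* u v" by (simp add: reach_def)
  then have "(u, v) \<in> rtrancl_on S (arcs_ends (G \<restriction> S))"
  proof (induction rule: rtranclp_induct)
    case (step y z)
    from step.hyps(2) show ?case
      by (intro rtrancl_on_into_rtrancl_on[OF step.IH]) (simp_all add: dominates_induce_iff)
  qed (use h in auto)
  then show "u \<rightarrow>\<^sup>*\<^bsub>G \<restriction> S\<^esub> v" by (simp add: reachable_def)
qed

lemma sccs_induce: "pre_digraph.sccs (G \<restriction> S) = (\<lambda>v. G \<restriction> component S v) ` S"
proof -
  interpret H: wf_digraph "G \<restriction> S" by (rule wellformed_induce_subgraph)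
  have "H.scc_of v = component S v" if v: "v \<in> S" for v
    unfolding H.scc_of_def component_def reachable_induce_iff
    using v reach_sym[of S] reach_in[of S v] by auto
  then have "H.sccs_verts = component S ` S"
    unfolding H.sccs_verts_conv_scc_of by simp
  then have "H.sccs = (\<lambda>K. (G \<restriction> S) \<restriction> K) ` component S ` S"
    by (simp add: H.sccs_conv_sccs_verts)
  also have "\<dots> = (\<lambda>v. G \<restriction> component S v) ` S"
    using induce_induce[OF component_subset] by (auto simp: image_iff)
  finally show ?thesis .
qed

lemma sccs_components: "sccs = (\<lambda>v. G \<restriction> component (verts G) v) ` verts G"
  using sccs_induce[of "verts G"] by (simp only: induce_verts)

lemma out_degree_induce:
  assumes "v \<in> S" shows "out_degree (G \<restriction> S) v = card (nbrs E S v)"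
proof -
  have "bij_betw (head G) (out_arcs (G \<restriction> S) v) (nbrs E S v)"
  proof (rule bij_betw_imageI)
    show "inj_on (head G) (out_arcs (G \<restriction> S) v)"
      by (rule inj_onI) (auto intro: no_multi_arcs simp: arc_to_ends_def)
    show "head G ` out_arcs (G \<restriction> S) v = nbrs E S v"
      using assms by (auto simp: nbrs_def arcs_ends_conv image_iff)
  qed
  then show ?thesis unfolding out_degree_def by (rule bij_betw_same_card)
qed

text \<open>A cycle is rotated to start at \<open>v\<close>; removing \<open>v\<close> leaves a path
  between its two neighbours on the cycle. Conversely such a path is shortened to a simple one and
  closed through \<open>v\<close>.\<close>

lemma cycle_verts_induce:
  assumes S: "S \<subseteq> verts G" shows "cycle_verts (G \<restriction> S) = cycle_set S"
proof (intro equalityI subsetI)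
  interpret H: graph "G \<restriction> S" by (rule graph_induce[OF S])
  fix v assume "v \<in> cycle_verts (G \<restriction> S)"
  then obtain u p where p: "H.awalk u p u" "distinct (tl (H.awalk_verts u p))" "3 \<le> length p" "v \<in> tail G ` set p"
    unfolding cycle_verts_def H.cycle_def by auto
  obtain a p1 p2 where a: "p = p1 @ a # p2" "tail G a = v" using p(4) by (auto dest: split_list)
  have w1: "H.awalk u p1 v" and w2: "H.awalk v (a # p2) u"
    using p(1) a by (auto simp: H.awalk_Cons_iff)
  have dist: "distinct (map (head G) p)"
    using p(1,2,3) H.awalk_verts_conv'[of u p u] by (auto simp: H.awalk_def split: if_splits)
  define q where "q = p2 @ p1"
  have wq: "H.awalk v (a # q) v"
    unfolding q_def using H.awalk_appendI[OF w2 w1] by simp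
  have distq: "distinct (map (head G) (a # q))" using dist a by (auto simp: q_def)
  have "q \<noteq> []" using p(3) a by (auto simp: q_def)
  then obtain r b where r: "q = r @ [b]" by (metis rev_exhaust)
  \<comment> \<open>Length at least 3 leaves an arc between the first arc \<open>a\<close> and the
    last arc \<open>b\<close>, so the two neighbours of \<open>v\<close> differ.\<close>
  have "r \<noteq> []" using p(3) a r by (cases p1; cases p2) (auto simp: q_def)
  define w where "w = head G a"
  have aw: "a \<in> arcs G" "tail G a = v" "v \<in> S" "w \<in> S"
    using wq by (auto simp: H.awalk_Cons_iff w_def)
  have "H.awalk w q v"
    using H.awalk_Cons_iff[THEN iffD1, OF wq, THEN conjunct2, THEN conjunct2] by (simp add: w_def)
  then have wr: "H.awalk w (r @ [b]) v" using r by simp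
  then have wr1: "H.awalk w r (tail G b)" and b: "b \<in> arcs G" "head G b = v" "tail G b \<in> S"
    by (auto simp: H.awalk_Cons_iff H.awalk_Nil_iff)
  have "head G b \<notin> head G ` insert a (set r)" using distq r by auto
  then have hv: "head G c \<noteq> v" if "c \<in> insert a (set r)" for c
    using that b by (metis image_eqI)
  have "reach (S - {v}) x (tail G b)" if "H.awalk x r' (tail G b)" "x \<noteq> v" "\<forall>c\<in>set r'. head G c \<noteq> v" for x r'
    using that
  proof (induction r' arbitrary: x)
    case (Cons c r')
    then have "c \<in> arcs G" "tail G c = x" "x \<in> S" "head G c \<in> S" by (auto simp: H.awalk_Cons_iff)
    then have "reach (S - {v}) x (head G c)"
      using Cons.prems by (intro reach_step) (auto simp: arcs_ends_conv image_iff)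
    moreover have "reach (S - {v}) (head G c) (tail G b)"
      using Cons by (auto simp: H.awalk_Cons_iff)
    ultimately show ?case by (rule reach_trans)
  qed (simp add: H.awalk_Nil_iff)
  then have "reach (S - {v}) w (tail G b)" using wr1 hv by (auto simp: w_def)
  moreover have "E v w" using aw by (auto simp: arcs_ends_conv w_def image_iff)
  moreover have "E v (tail G b)" using b graph_symmetric by (auto simp: arcs_ends_conv image_iff)
  moreover have "w \<noteq> tail G b"
  proof -
    obtain r'' c where c: "r = r'' @ [c]" using \<open>r \<noteq> []\<close> by (metis rev_exhaust)
    then have "tail G b = head G c" using wr by (auto simp: H.awalk_Cons_iff H.awalk_Nil_iff)
    moreover have "head G a \<noteq> head G c" using distq r c by auto
    ultimately show ?thesis by (simp add: w_def)
  qed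
  ultimately show "v \<in> cycle_set S"
    unfolding cycle_set_def on_cycle_def using aw b by blast
next
  interpret H: graph "G \<restriction> S" by (rule graph_induce[OF S])
  fix v assume "v \<in> cycle_set S"
  then obtain u w where uw: "v \<in> S" "u \<in> S" "w \<in> S" "u \<noteq> w" "E v u" "E v w" "reach (S - {v}) u w"
    by (auto simp: cycle_set_def on_cycle_def)
  interpret H': wf_digraph "G \<restriction> (S - {v})" by (rule wellformed_induce_subgraph)
  have "u \<noteq> v" using uw irr by auto
  then have "u \<rightarrow>\<^sup>*\<^bsub>G \<restriction> (S - {v})\<^esub> w" using uw by (simp add: reachable_induce_iff)
  then obtain p where p: "H'.apath u p w" using H'.reachable_apath by blast
  have pa: "H'.awalk u p w" "distinct (awalk_verts u p)"
    using p by (auto simp: H'.apath_def awalk_verts_induce)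
  have pv: "set (awalk_verts u p) \<subseteq> S - {v}"
    using pa(1) by (auto simp: H'.awalk_conv awalk_verts_induce)
  have sub: "subgraph (G \<restriction> (S - {v})) (G \<restriction> S)"
    by (intro subgraphI) (auto simp: compatible_def)
  have wp: "H.awalk u p w" by (rule H.subgraph_awalk_imp_awalk[OF pa(1) sub])
  obtain a where a: "a \<in> arcs G" "tail G a = v" "head G a = u" using uw(5) by (auto elim: reachableE)
  have "E w v" using uw(6) by (rule graph_symmetric)
  then obtain b where b: "b \<in> arcs G" "tail G b = w" "head G b = v" by (auto elim: reachableE)
  have ne: "p \<noteq> []" using wp uw by (auto simp: H.awalk_Nil_iff)
  have walk: "H.awalk v (a # p @ [b]) v"
    using wp a b uw by (auto simp: H.awalk_Cons_iff H.awalk_Nil_iff)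
  have "head G (last p) = w" using wp ne
    by (metis H.awalkE H.awalk_verts_conv induce_subgraph_head last_snoc)
  then have "awalk_verts u (p @ [b]) = awalk_verts u p @ [v]"
    using ne b by (simp add: awalk_verts_conv)
  then have "distinct (tl (H.awalk_verts v (a # p @ [b])))"
    using pa(2) pv a by (auto simp: awalk_verts_induce)
  then have "H.cycle (a # p @ [b])" unfolding H.cycle_def using walk by blast
  moreover have "3 \<le> length (a # p @ [b])" using ne by (cases p) auto
  moreover have "v \<in> tail (G \<restriction> S) ` set (a # p @ [b])" using a by auto
  ultimately show "v \<in> cycle_verts (G \<restriction> S)" unfolding cycle_verts_def by blast
qed

lemma connected_induce:
  assumes "S \<subseteq> verts G" "conn S" shows "Digraph_Component.connected (G \<restriction> S)"
proof -
  interpret H: graph "G \<restriction> S" by (rule graph_induce[OF assms(1)])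
  have "u \<rightarrow>\<^sup>*\<^bsub>mk_symmetric (G \<restriction> S)\<^esub> v" if "u \<in> S" "v \<in> S" for u v
    using that assms(2) by (intro H.reachable_mk_symmetricI) (simp add: reachable_induce_iff conn_def)
  then show ?thesis
    using assms(2) unfolding connected_def strongly_connected_def by (auto simp: conn_def)
qed

lemma complete_induce:
  assumes "S \<subseteq> verts G" "clique E S" shows "K\<^bsub>card S\<^esub> (G \<restriction> S)"
  unfolding complete_digraph_def using graph_induce[OF assms(1)] assms(2) irr
  by (auto simp: dominates_induce_iff clique_def)

lemma odd_cycle_induce:
  assumes S: "S \<subseteq> verts G" and "cycle_enum S n f" "odd n" shows "is_odd_cycle (G \<restriction> S)"
proof -
  have n: "3 \<le> n" and bij: "bij_betw f {0..<n} S"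
    and adj: "\<And>i j. i < n \<Longrightarrow> j < n \<Longrightarrow> E (f i) (f j) \<longleftrightarrow> j = (i + 1) mod n \<or> i = (j + 1) mod n"
    using assms(2) by (auto simp: cycle_enum_def)
  define g where "g = the_inv_into {0..<n} f"
  have bg: "bij_betw g S {0..<n}" unfolding g_def by (rule bij_betw_the_inv_into[OF bij])
  have injg: "inj_on g S" and imgg: "g ` S = {0..<n}" using bg by (auto simp: bij_betw_def)
  have fg: "f (g x) = x" if "x \<in> S" for x
    using that bij unfolding g_def by (intro f_the_inv_into_f) (auto simp: bij_betw_def)
  have gf: "g (f i) = i" if "i < n" for i
    using that bij unfolding g_def by (intro the_inv_into_f_f) (auto simp: bij_betw_def)
  have lt: "g x < n" if "x \<in> S" for x using that imgg by auto
  have fS: "f i \<in> S" if "i < n" for i using that bij by (auto simp: bij_betw_def)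
  interpret H: graph "G \<restriction> S" by (rule graph_induce[OF S])
  \<comment> \<open>The arcs of \<open>cycle_graph\<close> are ordered pairs of positions, so an arc
    is mapped to the positions of its ends, and the projections become tail and head.\<close>
  define hom where "hom = \<lparr>iso_verts = g, iso_arcs = (\<lambda>a. (g (tail G a), g (head G a))),
    iso_head = snd, iso_tail = fst\<rparr>"
  have "H.digraph_isomorphism hom"
    unfolding H.digraph_isomorphism_def hom_def
  proof (intro conjI)
    show "inj_on (iso_arcs \<lparr>iso_verts = g, iso_arcs = (\<lambda>a. (g (tail G a), g (head G a))),
        iso_head = snd, iso_tail = fst\<rparr>) (arcs (G \<restriction> S))"
      by (rule inj_onI) (auto intro!: no_multi_arcs simp: arc_to_ends_def dest: inj_onD[OF injg])
  qed (use injg H.wf_digraph in auto)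
  moreover have "with_proj (cycle_graph n) = app_iso hom (G \<restriction> S)"
  proof (rule pre_digraph.equality)
    show "verts (with_proj (cycle_graph n)) = verts (app_iso hom (G \<restriction> S))"
      using imgg by (simp add: cycle_graph_def hom_def)
    have "(i, j) \<in> (\<lambda>a. (g (tail G a), g (head G a))) ` arcs (G \<restriction> S)"
      if ij: "i < n" "j < n" "j = (i + 1) mod n \<or> i = (j + 1) mod n" for i j
    proof -
      have "E (f i) (f j)" using adj[OF ij(1,2)] ij(3) by simp
      then obtain a where "a \<in> arcs G" "tail G a = f i" "head G a = f j" by (auto elim: reachableE)
      then show ?thesis using gf ij fS by (intro image_eqI[of _ _ a]) auto
    qed
    moreover have "g (tail G a) < n \<and> g (head G a) < n \<and>
        (g (head G a) = (g (tail G a) + 1) mod n \<or> g (tail G a) = (g (head G a) + 1) mod n)"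
      if a: "a \<in> arcs (G \<restriction> S)" for a
    proof -
      have S2: "tail G a \<in> S" "head G a \<in> S" using a by auto
      moreover have "E (tail G a) (head G a)" using a by (auto simp: arcs_ends_conv)
      ultimately show ?thesis using adj[of "g (tail G a)" "g (head G a)"] fg lt by simp
    qed
    ultimately show "arcs (with_proj (cycle_graph n)) = arcs (app_iso hom (G \<restriction> S))"
      by (auto simp: cycle_graph_def hom_def)
  qed (simp_all add: hom_def)
  ultimately show ?thesis unfolding is_odd_cycle_def digraph_iso_def using n \<open>odd n\<close> by blast
qed

lemma special_set_special:
  assumes S: "S \<subseteq> verts G" and spec: "special_set S" shows "special \<Delta> (G \<restriction> S)"
proof -
  have Z: "cycle_set S \<subseteq> S" by (auto simp: cycle_set_def)
  have "K\<^bsub>(\<Delta> + 1) div 2 + 1\<^esub> H \<or> K\<^bsub>\<Delta> div 2 + 1\<^esub> H \<or> (\<Delta> = 4 \<and> is_odd_cycle H)"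
    if "H \<in> pre_digraph.sccs (G \<restriction> cycle_set S)" for H
  proof -
    note H = that
    obtain v where v: "v \<in> cycle_set S" "H = G \<restriction> component (cycle_set S) v"
      using H unfolding sccs_induce by blast
    let ?K = "component (cycle_set S) v"
    have KV: "?K \<subseteq> verts G" using component_subset Z S by blast
    have "block ?K" using spec v(1) by (simp add: special_set_def)
    then consider "clique E ?K" "critical (card ?K - 1)" "finite ?K"
      | n f where "\<Delta> = 4" "odd n" "cycle_enum ?K n f" unfolding block_def by blast
    then show ?thesis
    proof cases
      case 1
      have "K\<^bsub>card ?K\<^esub> H" using complete_induce[OF KV 1(1)] v by simp
      moreover have "card ?K = card ?K - 1 + 1"
        using component_self[OF v(1)] 1(3) by (metis Suc_eq_plus1 Suc_diff_1 card_gt_0_iff empty_iff)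
      ultimately show ?thesis using 1(2) unfolding critical_def by metis
    next
      case 2
      then show ?thesis using odd_cycle_induce[OF KV] v by blast
    qed
  qed
  moreover have "out_degree (G \<restriction> S) v = \<Delta>" if "v \<in> cycle_set S" for v
    using that spec out_degree_induce[of v S] by (auto simp: cycle_set_def special_set_def)
  moreover have "tail (G \<restriction> S) e \<in> cycle_set S \<or> head (G \<restriction> S) e \<in> cycle_set S" if e: "e \<in> arcs (G \<restriction> S)" for e
  proof -
    have "E (tail G e) (head G e)" using e by (auto simp: arcs_ends_conv)
    then show ?thesis using e spec by (auto simp: cycle_set_def special_set_def)
  qed
  moreover have "conn S" using spec by (simp add: special_set_def)
  ultimately show ?thesis
    unfolding special_def cycle_verts_induce[OF S] induce_induce[OF Z]
    using connected_induce[OF S] by blast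
qed

end

section \<open>Summation over the connected components\<close>

theorem theorem4p1:
  fixes G :: "('a, 'b) pre_digraph" and \<Delta> :: nat
  assumes "\<Delta> \<ge> 4"
    and "graph G"
    and "\<And>v. v \<in> verts G \<Longrightarrow> out_degree G v \<le> \<Delta>"
  shows "real (indep_domination_number G)
           \<le> (1 - t_coeff \<Delta>) * real (card (verts G)) + t_coeff \<Delta> * real (num_special \<Delta> G)"
proof -
  interpret graph G by (rule assms(2))
  interpret bounded_graph G \<Delta> by unfold_locales (rule assms(1))
  let ?V = "verts G"
  let ?C = "component ?V ` ?V"
  have KV: "K \<subseteq> ?V" "conn K" "finite K" "closed_in ?V K" if "K \<in> ?C" for K
    using that component_subset[of ?V] conn_component finite_subset[OF component_subset[of ?V] finite_verts] closed_in_component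
    by auto
  have disj: "K = K'" if "K \<in> ?C" "K' \<in> ?C" "x \<in> K" "x \<in> K'" for K K' x
    using that component_eq by blast
  have cover: "\<Union>?C = ?V" using component_self component_subset by blast
  have deg: "card (nbrs E K v) \<le> \<Delta>" if "K \<in> ?C" "v \<in> K" for K v
  proof -
    have v: "v \<in> ?V" using KV(1)[OF that(1)] that(2) by blast
    have "card (nbrs E K v) \<le> card (nbrs E ?V v)"
      using KV(1)[OF that(1)] by (intro card_mono nbrs_mono) auto
    also have "\<dots> = out_degree G v" using out_degree_induce[OF v] by (simp only: induce_verts)
    finally show ?thesis using assms(3)[OF v] by simp
  qed
  have "\<forall>K\<in>?C. \<exists>S. S \<subseteq> K \<and> indep E S \<and> (\<forall>v\<in>K - S. \<exists>u\<in>S. E v u) \<and>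
      t * real (card K) - t * (if special_set K then 1 else 0) \<le> real (card (K - S))"
    using connected_independent_dominating_set[OF KV(3,2) deg] by blast
  then obtain S where S: "\<And>K. K \<in> ?C \<Longrightarrow> S K \<subseteq> K" "\<And>K. K \<in> ?C \<Longrightarrow> indep E (S K)"
      "\<And>K v. K \<in> ?C \<Longrightarrow> v \<in> K - S K \<Longrightarrow> \<exists>u\<in>S K. E v u"
      "\<And>K. K \<in> ?C \<Longrightarrow> t * real (card K) - t * (if special_set K then 1 else 0) \<le> real (card (K - S K))"
    by (metis (no_types, lifting))
  \<comment> \<open>No edges join different components, so the chosen sets unite to an independent
    dominating set and the numbers of missed vertices add up.\<close>
  define U where "U = (\<Union>K\<in>?C. S K)"
  have UV: "U \<subseteq> ?V" using S(1) KV(1) unfolding U_def by blast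
  have ids: "independent_dominating_set G U"
    unfolding independent_dominating_set_def
  proof (intro conjI ballI)
    fix u v assume uv: "u \<in> U" "v \<in> U"
    then obtain K K' where K: "K \<in> ?C" "u \<in> S K" "K' \<in> ?C" "v \<in> S K'" unfolding U_def by blast
    show "\<not> E u v"
    proof
      assume e: "E u v"
      have "u \<in> K" "v \<in> K'" "v \<in> ?V" using K S(1) uv UV by blast+
      then have "v \<in> K" using KV(4)[OF K(1)] e by (auto simp: closed_in_def)
      then have "K = K'" using disj[OF K(1,3)] \<open>v \<in> K'\<close> by blast
      then show False using S(2)[OF K(1)] K e by (simp add: indep_def)
    qed
  next
    fix v assume v: "v \<in> ?V - U"
    then obtain K where K: "K \<in> ?C" "v \<in> K" using cover by blast
    then have "v \<in> K - S K" using v by (auto simp: U_def)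
    then show "\<exists>u\<in>U. E v u" using S(3)[OF K(1)] K(1) unfolding U_def by blast
  qed (rule UV)
  have finC: "finite ?C" by simp
  have sumV: "card ?V = (\<Sum>K\<in>?C. card K)"
    using card_Union_disjoint[of ?C] disj KV(3) cover by (fastforce simp: pairwise_def disjnt_def)
  have "?V - U = (\<Union>K\<in>?C. K - S K)"
  proof (intro equalityI subsetI)
    fix v assume "v \<in> ?V - U"
    then show "v \<in> (\<Union>K\<in>?C. K - S K)" using cover by (auto simp: U_def)
  next
    fix v assume "v \<in> (\<Union>K\<in>?C. K - S K)"
    then obtain K where K: "K \<in> ?C" "v \<in> K" "v \<notin> S K" by blast
    have "v \<notin> U"
    proof
      assume "v \<in> U"
      then obtain K' where "K' \<in> ?C" "v \<in> S K'" by (auto simp: U_def)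
      then show False using disj[OF K(1) _ K(2)] S(1) K(3) by blast
    qed
    then show "v \<in> ?V - U" using K KV(1) by blast
  qed
  then have "card (?V - U) = (\<Sum>K\<in>?C. card (K - S K))"
  proof (simp only:, intro card_UN_disjoint finC ballI impI)
    fix K K' assume K: "K \<in> ?C" "K' \<in> ?C" "K \<noteq> K'"
    show "(K - S K) \<inter> (K' - S K') = {}" using disj[OF K(1,2)] K(3) by blast
  qed (use KV(3) in blast)
  then have "real (card (?V - U)) = (\<Sum>K\<in>?C. real (card (K - S K)))" by simp
  also have "\<dots> \<ge> (\<Sum>K\<in>?C. t * real (card K) - t * (if special_set K then 1 else 0))"
    by (rule sum_mono) (rule S(4))
  also have "(\<Sum>K\<in>?C. t * real (card K) - t * (if special_set K then 1 else 0)) =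
      t * real (card ?V) - t * real (card {K\<in>?C. special_set K})"
    using finC unfolding sumV by (simp add: sum_subtractf sum_distrib_left[symmetric] sum.If_cases Int_def)
  finally have bound: "t * real (card ?V) - t * real (card {K\<in>?C. special_set K}) \<le> real (card (?V - U))" .
  have "card {K\<in>?C. special_set K} \<le> num_special \<Delta> G"
    unfolding num_special_def
  proof (rule card_inj_on_le[of "\<lambda>K. G \<restriction> K"])
    show "inj_on ((\<restriction>) G) {K\<in>?C. special_set K}" by (rule inj_onI) (metis induce_subgraph_verts)
    show "(\<restriction>) G ` {K\<in>?C. special_set K} \<subseteq> {C \<in> sccs. special \<Delta> C}"
      using special_set_special KV(1) by (auto simp: sccs_components)
    show "finite {C \<in> sccs. special \<Delta> C}" by (simp add: sccs_components)
  qed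
  then have "t * real (card {K\<in>?C. special_set K}) \<le> t * real (num_special \<Delta> G)"
    using t_coeff_nonneg by (intro mult_left_mono) auto
  moreover have "indep_domination_number G \<le> card U"
    unfolding indep_domination_number_def
  proof (rule Min_le)
    have "{S. independent_dominating_set G S} \<subseteq> Pow ?V" by (auto simp: independent_dominating_set_def)
    then show "finite (card ` {S. independent_dominating_set G S})"
      by (intro finite_imageI) (rule finite_subset, auto)
  qed (use ids in blast)
  moreover have "card ?V = card (?V - U) + card U"
    using card_Diff_subset[OF finite_subset[OF UV finite_verts] UV] card_mono[OF finite_verts UV] by simp
  ultimately show ?thesis using bound by (simp add: algebra_simps)
qed

end
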